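(* Let $X$ be a compact complex surface (complex dimension $n=2$) with a fixed smooth volume form $\mu$ compatible with the complex structure, endowed with an exact Bott-Chern algebroid $Q$, and let $\sigma\in\Sigma_Q(\mathbb{R})$ be a positive Aeppli class on $Q$. If there is a solution $\omega_0\in B_\sigma^+$ of the system $$d(e^{-f_\omega}\omega^{n-1})=0,\qquad dd^c\omega=0,$$ then it is the unique solution in $B_\sigma^+$. Furthermore, in this case the dilaton functional $$M(\omega)=\int_Xe^{-f_\omega}\frac{\omega^n}{n!}$$ is bounded from above on $B_\sigma^+$.
   Context: Convention: $d^c=i(\bar\partial-\partial)$, so $dd^c=2i\partial\bar\partial$. An exact holomorphic Courant algebroid $Q$ over a complex manifold $X$ is a holomorphic Courant algebroid fitting in $0\to T^*X\to Q\to TX\to0$. Isomorphism classes $[Q]$ are classified by $\{H\in\Omega^{3,0}\oplus\Omega^{2,1}: dH=0\}/d\Omega^{2,0}$. $Q$ is Bott-Chern if $[Q]=[2i\partial\tau]$ for a real $(1,1)$-form $\tau$ (then necessarily $dd^c\tau=0$). $B_Q$ is the set of real $(1,1)$-forms $\tau$ with $dd^c\tau=0$ and $[2i\partial\tau]=[Q]$. Two elements $\tau,\tau'\in B_Q$ are equivalent if $[\tau-\tau']=0$ in the Aeppli cohomology $H^{1,1}_A(X,\mathbb R)$, where $H_A^{1,1}(X)=\ker(dd^c|_{\Omega^{1,1}})/\mathrm{Im}(\partial\oplus\bar\partial)$; the set of equivalence classes is $\Sigma_Q(\mathbb R)$ (Aeppli classes of $Q$). Hermitian metrics on $Q$ are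 the positive elements $\omega\in B_Q$; $B_\sigma^+$ denotes the set of hermitian metrics with class $\sigma$, and $\sigma$ is positive if $B_\sigma^+\neq\emptyset$. For a hermitian form $\omega$, the dilaton function $f_\omega$ is defined by $\omega^n/n!=e^{2f_\omega}\mu$. *)

theory Defs
  imports "HOL-Analysis.Analysis" "HOL-Combinatorics.Permutations"
begin

section \<open>Smooth and holomorphic functions on open subsets of complex n-space\<close>

fun Ck_on :: "nat \<Rightarrow> 'a::euclidean_space set \<Rightarrow> ('a \<Rightarrow> 'b::real_normed_vector) \<Rightarrow> bool" where
  "Ck_on 0 S f \<longleftrightarrow> continuous_on S f"
| "Ck_on (Suc k) S f \<longleftrightarrow> (\<forall>z\<in>S. f differentiable (at z)) \<and>
     (\<forall>v. Ck_on k S (\<lambda>z. frechet_derivative f (at z) v))"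

definition smooth_on :: "'a::euclidean_space set \<Rightarrow> ('a \<Rightarrow> 'b::real_normed_vector) \<Rightarrow> bool" where
  "smooth_on S f \<longleftrightarrow> (\<forall>k. Ck_on k S f)"

definition holo_on :: "(complex^'n) set \<Rightarrow> (complex^'n \<Rightarrow> complex) \<Rightarrow> bool" where
  "holo_on S f \<longleftrightarrow> (\<forall>z\<in>S. \<exists>L. (f has_derivative L) (at z) \<and> (\<forall>a v. L (a *s v) = a * L v))"

definition vec_holo_on :: "(complex^'n) set \<Rightarrow> (complex^'n \<Rightarrow> complex^'m) \<Rightarrow> bool" where
  "vec_holo_on S f \<longleftrightarrow> (\<forall>k. holo_on S (\<lambda>z. f z $ k))"


section \<open>Complex manifolds\<close>

text \<open>The manifold is the whole type \<open>'x\<close>; its complex structure is given by a holomorphic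
  atlas. A chart is a domain together with a coordinate map that is only relevant there.\<close>

type_synonym ('x, 'n) chart = "'x set \<times> ('x \<Rightarrow> complex^'n)"

abbreviation cdom :: "('x, 'n) chart \<Rightarrow> 'x set" where "cdom \<equiv> fst"
abbreviation cmap :: "('x, 'n) chart \<Rightarrow> 'x \<Rightarrow> complex^'n" where "cmap \<equiv> snd"

definition cimg :: "('x, 'n) chart \<Rightarrow> (complex^'n) set" where
  "cimg c = cmap c ` cdom c"

definition cinv :: "('x, 'n) chart \<Rightarrow> complex^'n \<Rightarrow> 'x" where
  "cinv c = inv_into (cdom c) (cmap c)"

definition transition :: "('x, 'n) chart \<Rightarrow> ('x, 'n) chart \<Rightarrow> complex^'n \<Rightarrow> complex^'n" where
  "transition c c' = cmap c' \<circ> cinv c"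

definition jac :: "('x, 'n) chart \<Rightarrow> ('x, 'n) chart \<Rightarrow> complex^'n \<Rightarrow> complex^'n \<Rightarrow> complex^'n" where
  "jac c c' z = frechet_derivative (transition c c') (at z)"

definition holomorphic_atlas :: "('x::topological_space, 'n::finite) chart set \<Rightarrow> bool" where
  "holomorphic_atlas A \<longleftrightarrow>
     (\<Union>c\<in>A. cdom c) = UNIV \<and>
     (\<forall>c\<in>A. open (cdom c) \<and> open (cimg c) \<and> homeomorphism (cdom c) (cimg c) (cmap c) (cinv c)) \<and>
     (\<forall>c\<in>A. \<forall>c'\<in>A. vec_holo_on (cmap c ` (cdom c \<inter> cdom c')) (transition c c'))"

definition smooth_fun ::
  "('x, 'n::finite) chart set \<Rightarrow> 'x set \<Rightarrow> ('x \<Rightarrow> 'b::real_normed_vector) \<Rightarrow> bool" where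
  "smooth_fun A U g \<longleftrightarrow> (\<forall>c\<in>A. smooth_on (cmap c ` (U \<inter> cdom c)) (g \<circ> cinv c))"

definition holo_fun :: "('x, 'n::finite) chart set \<Rightarrow> 'x set \<Rightarrow> ('x \<Rightarrow> complex) \<Rightarrow> bool" where
  "holo_fun A U g \<longleftrightarrow> (\<forall>c\<in>A. holo_on (cmap c ` (U \<inter> cdom c)) (g \<circ> cinv c))"

definition vec_holo_fun :: "('x, 'n::finite) chart set \<Rightarrow> 'x set \<Rightarrow> ('x \<Rightarrow> complex^'m) \<Rightarrow> bool" where
  "vec_holo_fun A U g \<longleftrightarrow> (\<forall>c\<in>A. vec_holo_on (cmap c ` (U \<inter> cdom c)) (g \<circ> cinv c))"


section \<open>Differential forms\<close>

text \<open>A complex-valued \<open>k\<close>-form is given by its coordinate expressions: \<open>\<alpha> c z vs\<close> is the value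
  at the point with coordinates \<open>z\<close> in the chart \<open>c\<close> on the list \<open>vs\<close> of \<open>k\<close> real tangent vectors,
  which are written in the coordinates of \<open>c\<close> as elements of \<open>complex^'n\<close>. The complex structure
  of the tangent space is multiplication by \<open>\<i>\<close>. Off its natural domain (other charts, points
  outside the chart, lists of the wrong length) a form is 0, so that equality of forms is
  equality of functions.\<close>

type_synonym 'n lform = "complex^'n \<Rightarrow> (complex^'n) list \<Rightarrow> complex"
type_synonym ('x, 'n) dform = "('x, 'n) chart \<Rightarrow> 'n lform"

definition alternating_multilinear :: "nat \<Rightarrow> ((complex^'n) list \<Rightarrow> complex) \<Rightarrow> bool" where
  "alternating_multilinear k a \<longleftrightarrow>
     (\<forall>vs i. length vs = k \<longrightarrow> i < k \<longrightarrow> linear (\<lambda>v. a (vs[i := v]))) \<and>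
     (\<forall>vs i j. length vs = k \<longrightarrow> i < j \<longrightarrow> j < k \<longrightarrow> vs ! i = vs ! j \<longrightarrow> a vs = 0)"

definition is_form :: "('x, 'n::finite) chart set \<Rightarrow> nat \<Rightarrow> ('x, 'n) dform \<Rightarrow> bool" where
  "is_form A k \<alpha> \<longleftrightarrow>
     (\<forall>c z vs. \<alpha> c z vs \<noteq> 0 \<longrightarrow> c \<in> A \<and> z \<in> cimg c \<and> length vs = k) \<and>
     (\<forall>c\<in>A. \<forall>z\<in>cimg c. alternating_multilinear k (\<alpha> c z)) \<and>
     (\<forall>c\<in>A. \<forall>vs. length vs = k \<longrightarrow> smooth_on (cimg c) (\<lambda>z. \<alpha> c z vs)) \<and>
     (\<forall>c\<in>A. \<forall>c'\<in>A. \<forall>z\<in>cmap c ` (cdom c \<inter> cdom c'). \<forall>vs. length vs = k \<longrightarrow>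
        \<alpha> c' (transition c c' z) (map (jac c c' z) vs) = \<alpha> c z vs)"

definition form_add :: "('x, 'n::finite) dform \<Rightarrow> ('x, 'n) dform \<Rightarrow> ('x, 'n) dform" where
  "form_add \<alpha> \<beta> = (\<lambda>c z vs. \<alpha> c z vs + \<beta> c z vs)"

definition form_diff :: "('x, 'n::finite) dform \<Rightarrow> ('x, 'n) dform \<Rightarrow> ('x, 'n) dform" where
  "form_diff \<alpha> \<beta> = (\<lambda>c z vs. \<alpha> c z vs - \<beta> c z vs)"

definition form_scale :: "complex \<Rightarrow> ('x, 'n::finite) dform \<Rightarrow> ('x, 'n) dform" where
  "form_scale a \<alpha> = (\<lambda>c z vs. a * \<alpha> c z vs)"

definition form_zero :: "('x, 'n::finite) dform" where
  "form_zero = (\<lambda>c z vs. 0)"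

definition fun_mult :: "('x \<Rightarrow> real) \<Rightarrow> ('x, 'n::finite) dform \<Rightarrow> ('x, 'n) dform" where
  "fun_mult g \<alpha> = (\<lambda>c z vs. complex_of_real (g (cinv c z)) * \<alpha> c z vs)"

definition real_form :: "('x, 'n::finite) dform \<Rightarrow> bool" where
  "real_form \<alpha> \<longleftrightarrow> (\<forall>c z vs. \<alpha> c z vs \<in> \<real>)"

text \<open>The wedge of the \<open>dz_i\<close> for \<open>i\<close> in the list \<open>I\<close> with the conjugates of the \<open>dz_j\<close> for \<open>j\<close>
  in the list \<open>J\<close>, evaluated on vectors.\<close>

definition basic_form :: "'n list \<Rightarrow> 'n list \<Rightarrow> (complex^'n) list \<Rightarrow> complex" where
  "basic_form I J vs = (\<Sum>s | s permutes {..<length I + length J}. of_int (sign s) *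
     (\<Prod>i<length I. (vs ! s i) $ (I ! i)) *
     (\<Prod>j<length J. cnj ((vs ! s (length I + j)) $ (J ! j))))"

text \<open>Type \<open>(p,q)\<close>: in each chart the form is a combination of the basic forms with \<open>p\<close> factors
  \<open>dz\<close> and \<open>q\<close> conjugate factors.\<close>

definition form_of_type ::
  "('x, 'n::finite) chart set \<Rightarrow> nat \<Rightarrow> nat \<Rightarrow> ('x, 'n) dform \<Rightarrow> bool" where
  "form_of_type A p q \<alpha> \<longleftrightarrow> is_form A (p + q) \<alpha> \<and>
     (\<forall>c\<in>A. \<forall>z\<in>cimg c. \<exists>a. \<forall>vs. length vs = p + q \<longrightarrow>
        \<alpha> c z vs = (\<Sum>I | length I = p. \<Sum>J | length J = q. a I J * basic_form I J vs))"

definition drop_nth :: "nat \<Rightarrow> 'a list \<Rightarrow> 'a list" where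
  "drop_nth i vs = take i vs @ drop (Suc i) vs"

definition dir_del :: "(complex^'n \<Rightarrow> complex) \<Rightarrow> complex^'n \<Rightarrow> complex^'n \<Rightarrow> complex" where
  "dir_del f z v =
     (frechet_derivative f (at z) v - \<i> * frechet_derivative f (at z) (\<i> *s v)) / 2"

definition dir_delbar :: "(complex^'n \<Rightarrow> complex) \<Rightarrow> complex^'n \<Rightarrow> complex^'n \<Rightarrow> complex" where
  "dir_delbar f z v =
     (frechet_derivative f (at z) v + \<i> * frechet_derivative f (at z) (\<i> *s v)) / 2"

text \<open>The invariant formulas for \<open>d\<close>, and for \<open>\<partial>\<close> and \<open>\<partial>\<close>-bar, on constant vector fields. The
  latter differentiate the coefficients of the basic forms by \<open>\<partial>\<close> and \<open>\<partial>\<close>-bar.\<close>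

definition local_d :: "'n::finite lform \<Rightarrow> 'n lform" where
  "local_d \<beta> z vs = (\<Sum>i<length vs.
     (-1)^i * frechet_derivative (\<lambda>w. \<beta> w (drop_nth i vs)) (at z) (vs ! i))"

definition local_del :: "'n::finite lform \<Rightarrow> 'n lform" where
  "local_del \<beta> z vs = (\<Sum>i<length vs. (-1)^i * dir_del (\<lambda>w. \<beta> w (drop_nth i vs)) z (vs ! i))"

definition local_delbar :: "'n::finite lform \<Rightarrow> 'n lform" where
  "local_delbar \<beta> z vs =
     (\<Sum>i<length vs. (-1)^i * dir_delbar (\<lambda>w. \<beta> w (drop_nth i vs)) z (vs ! i))"

definition ext_d :: "('x, 'n::finite) dform \<Rightarrow> ('x, 'n) dform" where
  "ext_d \<alpha> = (\<lambda>c z vs. if z \<in> cimg c then local_d (\<alpha> c) z vs else 0)"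

definition del :: "('x, 'n::finite) dform \<Rightarrow> ('x, 'n) dform" where
  "del \<alpha> = (\<lambda>c z vs. if z \<in> cimg c then local_del (\<alpha> c) z vs else 0)"

definition delbar :: "('x, 'n::finite) dform \<Rightarrow> ('x, 'n) dform" where
  "delbar \<alpha> = (\<lambda>c z vs. if z \<in> cimg c then local_delbar (\<alpha> c) z vs else 0)"

definition ext_dc :: "('x, 'n::finite) dform \<Rightarrow> ('x, 'n) dform" where
  "ext_dc \<alpha> = form_scale \<i> (form_diff (delbar \<alpha>) (del \<alpha>))"

definition wedge :: "nat \<Rightarrow> nat \<Rightarrow> ('x, 'n::finite) dform \<Rightarrow> ('x, 'n) dform \<Rightarrow> ('x, 'n) dform" where
  "wedge k l \<alpha> \<beta> = (\<lambda>c z vs. if length vs = k + l then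
     (\<Sum>s | s permutes {..<k + l}. of_int (sign s) *
        \<alpha> c z (map (\<lambda>i. vs ! s i) [0..<k]) * \<beta> c z (map (\<lambda>i. vs ! s i) [k..<k + l]))
     / (fact k * fact l) else 0)"

text \<open>Powers of a 2-form; only positive exponents respect the convention on values off the
  atlas.\<close>

fun wedge_power :: "('x, 'n::finite) dform \<Rightarrow> nat \<Rightarrow> ('x, 'n) dform" where
  "wedge_power \<omega> 0 = (\<lambda>c z vs. if vs = [] then 1 else 0)"
| "wedge_power \<omega> (Suc m) = wedge 2 (2 * m) \<omega> (wedge_power \<omega> m)"

definition top_power :: "('x, 'n::finite) dform \<Rightarrow> ('x, 'n) dform" where
  "top_power \<omega> = form_scale (1 / fact CARD('n)) (wedge_power \<omega> CARD('n))"


section \<open>Integration of forms of top degree\<close>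

text \<open>The real basis \<open>e_1, \<i> e_1, ..., e_n, \<i> e_n\<close>, positive for the complex orientation. It has unit
  volume for \<open>lborel\<close>.\<close>

definition frame :: "(complex^'n::{finite,linorder}) list" where
  "frame = concat (map (\<lambda>i. [axis i 1, axis i \<i>]) (sorted_list_of_set UNIV))"

definition partition_of_unity ::
  "('x::topological_space, 'n::finite) chart set \<Rightarrow> ('x, 'n) chart set \<Rightarrow>
   (('x, 'n) chart \<Rightarrow> 'x \<Rightarrow> real) \<Rightarrow> bool" where
  "partition_of_unity A F \<rho> \<longleftrightarrow> finite F \<and> F \<subseteq> A \<and>
     (\<forall>c\<in>F. smooth_fun A UNIV (\<rho> c) \<and> (\<forall>x. 0 \<le> \<rho> c x) \<and> closure {x. \<rho> c x \<noteq> 0} \<subseteq> cdom c) \<and>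
     (\<forall>x. (\<Sum>c\<in>F. \<rho> c x) = 1)"

text \<open>On a compact manifold the integral does not depend on the chosen partition of unity.\<close>

definition form_integral ::
  "('x::topological_space, 'n::{finite,linorder}) chart set \<Rightarrow> ('x, 'n) dform \<Rightarrow> complex" where
  "form_integral A \<alpha> = (case (SOME (F, \<rho>). partition_of_unity A F \<rho>) of (F, \<rho>) \<Rightarrow>
     \<Sum>c\<in>F. set_lebesgue_integral lborel (cimg c)
        (\<lambda>z. complex_of_real (\<rho> c (cinv c z)) * \<alpha> c z frame))"

definition volume_form ::
  "('x, 'n::{finite,linorder}) chart set \<Rightarrow> ('x, 'n) dform \<Rightarrow> bool" where
  "volume_form A \<mu> \<longleftrightarrow> is_form A (2 * CARD('n)) \<mu> \<and> real_form \<mu> \<and>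
     (\<forall>c\<in>A. \<forall>z\<in>cimg c. 0 < Re (\<mu> c z frame))"


section \<open>Holomorphic Courant algebroids\<close>

text \<open>The anchor is given by its coordinates: \<open>anchor Q c x u\<close> represents the (1,0)-vector
  with components \<open>anchor Q c x u $ j\<close> along the coordinate fields of the chart \<open>c\<close>. The bracket
  takes as first argument the open set over which its arguments are sections.\<close>

record ('x, 'q, 'r::finite) vector_bundle =
  fib :: "'x \<Rightarrow> 'q set"
  vadd :: "'x \<Rightarrow> 'q \<Rightarrow> 'q \<Rightarrow> 'q"
  vscale :: "'x \<Rightarrow> complex \<Rightarrow> 'q \<Rightarrow> 'q"
  trivs :: "('x set \<times> ('x \<Rightarrow> 'q \<Rightarrow> complex^'r)) set"

record ('x, 'n::finite, 'q, 'r::finite) courant = "('x, 'q, 'r) vector_bundle" +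
  pairing :: "'x \<Rightarrow> 'q \<Rightarrow> 'q \<Rightarrow> complex"
  anchor :: "('x, 'n) chart \<Rightarrow> 'x \<Rightarrow> 'q \<Rightarrow> complex^'n"
  brack :: "'x set \<Rightarrow> ('x \<Rightarrow> 'q) \<Rightarrow> ('x \<Rightarrow> 'q) \<Rightarrow> 'x \<Rightarrow> 'q"

definition holomorphic_bundle ::
  "('x::topological_space, 'n::finite) chart set \<Rightarrow> ('x, 'q, 'r::finite, 'z) vector_bundle_scheme \<Rightarrow> bool" where
  "holomorphic_bundle A E \<longleftrightarrow>
     (\<Union>t\<in>trivs E. fst t) = UNIV \<and>
     (\<forall>(W, \<phi>)\<in>trivs E. open W \<and> (\<forall>x\<in>W. bij_betw (\<phi> x) (fib E x) UNIV \<and>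
        (\<forall>u\<in>fib E x. \<forall>v\<in>fib E x. vadd E x u v \<in> fib E x \<and> \<phi> x (vadd E x u v) = \<phi> x u + \<phi> x v) \<and>
        (\<forall>a. \<forall>u\<in>fib E x. vscale E x a u \<in> fib E x \<and> \<phi> x (vscale E x a u) = a *s \<phi> x u))) \<and>
     (\<forall>(W, \<phi>)\<in>trivs E. \<forall>(W', \<phi>')\<in>trivs E. \<forall>e.
        vec_holo_fun A (W \<inter> W') (\<lambda>x. \<phi>' x (inv_into (fib E x) (\<phi> x) e)))"

definition holo_section ::
  "('x, 'n::finite) chart set \<Rightarrow> ('x, 'q, 'r::finite, 'z) vector_bundle_scheme \<Rightarrow> 'x set \<Rightarrow> ('x \<Rightarrow> 'q) \<Rightarrow> bool" where
  "holo_section A E U s \<longleftrightarrow> (\<forall>x\<in>U. s x \<in> fib E x) \<and>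
     (\<forall>(W, \<phi>)\<in>trivs E. vec_holo_fun A (U \<inter> W) (\<lambda>x. \<phi> x (s x)))"

definition smooth_section ::
  "('x, 'n::finite) chart set \<Rightarrow> ('x, 'q, 'r::finite, 'z) vector_bundle_scheme \<Rightarrow> 'x set \<Rightarrow> ('x \<Rightarrow> 'q) \<Rightarrow> bool" where
  "smooth_section A E U s \<longleftrightarrow> (\<forall>x\<in>U. s x \<in> fib E x) \<and>
     (\<forall>(W, \<phi>)\<in>trivs E. smooth_fun A (U \<inter> W) (\<lambda>x. \<phi> x (s x)))"

definition anchor_field ::
  "('x, 'n::finite, 'q, 'r::finite) courant \<Rightarrow> ('x, 'n) chart \<Rightarrow> ('x \<Rightarrow> 'q) \<Rightarrow> complex^'n \<Rightarrow> complex^'n" where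
  "anchor_field Q c s z = anchor Q c (cinv c z) (s (cinv c z))"

definition lie_bracket ::
  "(complex^'n \<Rightarrow> complex^'n) \<Rightarrow> (complex^'n \<Rightarrow> complex^'n) \<Rightarrow> complex^'n \<Rightarrow> complex^'n" where
  "lie_bracket V W z = frechet_derivative W (at z) (V z) - frechet_derivative V (at z) (W z)"

text \<open>The derivative at \<open>x\<close> of a holomorphic function \<open>g\<close> along the vector \<open>v\<close> in the chart \<open>c\<close>.\<close>

definition deriv_along ::
  "('x, 'n) chart \<Rightarrow> 'x \<Rightarrow> complex^'n \<Rightarrow> ('x \<Rightarrow> complex) \<Rightarrow> complex" where
  "deriv_along c x v g = frechet_derivative (g \<circ> cinv c) (at (cmap c x)) v"

text \<open>In the nondegeneracy condition, \<open>u + u = u\<close> expresses that \<open>u\<close> is the zero of the fibre.\<close>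

definition holomorphic_pairing ::
  "('x::topological_space, 'n::finite) chart set \<Rightarrow> ('x, 'n, 'q, 'r::finite) courant \<Rightarrow> bool" where
  "holomorphic_pairing A Q \<longleftrightarrow>
     (\<forall>x. \<forall>u\<in>fib Q x. \<forall>v\<in>fib Q x. pairing Q x u v = pairing Q x v u) \<and>
     (\<forall>x. \<forall>u\<in>fib Q x. \<forall>v\<in>fib Q x. \<forall>w\<in>fib Q x.
        pairing Q x (vadd Q x u v) w = pairing Q x u w + pairing Q x v w) \<and>
     (\<forall>x a. \<forall>u\<in>fib Q x. \<forall>w\<in>fib Q x. pairing Q x (vscale Q x a u) w = a * pairing Q x u w) \<and>
     (\<forall>x. \<forall>u\<in>fib Q x. (\<forall>v\<in>fib Q x. pairing Q x u v = 0) \<longrightarrow> vadd Q x u u = u) \<and>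
     (\<forall>U u v. open U \<longrightarrow> holo_section A Q U u \<longrightarrow> holo_section A Q U v \<longrightarrow>
        holo_fun A U (\<lambda>x. pairing Q x (u x) (v x)))"

definition holomorphic_anchor ::
  "('x::topological_space, 'n::finite) chart set \<Rightarrow> ('x, 'n, 'q, 'r::finite) courant \<Rightarrow> bool" where
  "holomorphic_anchor A Q \<longleftrightarrow>
     (\<forall>c\<in>A. \<forall>x\<in>cdom c. \<forall>u\<in>fib Q x. \<forall>v\<in>fib Q x.
        anchor Q c x (vadd Q x u v) = anchor Q c x u + anchor Q c x v) \<and>
     (\<forall>c\<in>A. \<forall>x\<in>cdom c. \<forall>a. \<forall>u\<in>fib Q x. anchor Q c x (vscale Q x a u) = a *s anchor Q c x u) \<and>
     (\<forall>c\<in>A. \<forall>c'\<in>A. \<forall>x\<in>cdom c \<inter> cdom c'. \<forall>u\<in>fib Q x.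
        anchor Q c' x u = jac c c' (cmap c x) (anchor Q c x u)) \<and>
     (\<forall>U u. open U \<longrightarrow> holo_section A Q U u \<longrightarrow>
        (\<forall>c\<in>A. vec_holo_on (cmap c ` (U \<inter> cdom c)) (anchor_field Q c u)))"

definition sheaf_bracket ::
  "('x::topological_space, 'n::finite) chart set \<Rightarrow> ('x, 'n, 'q, 'r::finite) courant \<Rightarrow> bool" where
  "sheaf_bracket A Q \<longleftrightarrow>
     (\<forall>U u v. open U \<longrightarrow> holo_section A Q U u \<longrightarrow> holo_section A Q U v \<longrightarrow>
        holo_section A Q U (brack Q U u v)) \<and>
     (\<forall>U V u v u' v'. open U \<longrightarrow> open V \<longrightarrow> V \<subseteq> U \<longrightarrow>
        holo_section A Q U u \<longrightarrow> holo_section A Q U v \<longrightarrow> (\<forall>x\<in>V. u' x = u x \<and> v' x = v x) \<longrightarrow>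
        (\<forall>x\<in>V. brack Q V u' v' x = brack Q U u v x)) \<and>
     (\<forall>U u v w. open U \<longrightarrow> holo_section A Q U u \<longrightarrow> holo_section A Q U v \<longrightarrow> holo_section A Q U w \<longrightarrow>
        (\<forall>x\<in>U. brack Q U (\<lambda>y. vadd Q y (u y) (v y)) w x =
                  vadd Q x (brack Q U u w x) (brack Q U v w x) \<and>
                brack Q U w (\<lambda>y. vadd Q y (u y) (v y)) x =
                  vadd Q x (brack Q U w u x) (brack Q U w v x))) \<and>
     (\<forall>U u v a. open U \<longrightarrow> holo_section A Q U u \<longrightarrow> holo_section A Q U v \<longrightarrow>
        (\<forall>x\<in>U. brack Q U (\<lambda>y. vscale Q y a (u y)) v x = vscale Q x a (brack Q U u v x) \<and>
                brack Q U u (\<lambda>y. vscale Q y a (v y)) x = vscale Q x a (brack Q U u v x)))"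

text \<open>The five conditions on the bracket are the Jacobi identity, compatibility with the anchor,
  the Leibniz rule, invariance of the pairing, and \<open>[u,v] + [v,u] = D \<langle>u,v\<rangle>\<close>. Here \<open>D g\<close> is the
  section corresponding to \<open>dg\<close> under the dual of the anchor and the pairing, i.e.
  \<open>\<langle>D g, w\<rangle> = \<pi>(w) g\<close> for all \<open>w\<close>.\<close>

definition holomorphic_courant_algebroid ::
  "('x::topological_space, 'n::finite) chart set \<Rightarrow> ('x, 'n, 'q, 'r::finite) courant \<Rightarrow> bool" where
  "holomorphic_courant_algebroid A Q \<longleftrightarrow>
     holomorphic_bundle A Q \<and> holomorphic_pairing A Q \<and> holomorphic_anchor A Q \<and> sheaf_bracket A Q \<and>
     (\<forall>U u v w. open U \<longrightarrow> holo_section A Q U u \<longrightarrow> holo_section A Q U v \<longrightarrow> holo_section A Q U w \<longrightarrow>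
        (\<forall>x\<in>U. brack Q U u (brack Q U v w) x =
           vadd Q x (brack Q U (brack Q U u v) w x) (brack Q U v (brack Q U u w) x))) \<and>
     (\<forall>U u v. open U \<longrightarrow> holo_section A Q U u \<longrightarrow> holo_section A Q U v \<longrightarrow>
        (\<forall>c\<in>A. \<forall>x\<in>U \<inter> cdom c. anchor Q c x (brack Q U u v x) =
           lie_bracket (anchor_field Q c u) (anchor_field Q c v) (cmap c x))) \<and>
     (\<forall>U u v g. open U \<longrightarrow> holo_section A Q U u \<longrightarrow> holo_section A Q U v \<longrightarrow> holo_fun A U g \<longrightarrow>
        (\<forall>c\<in>A. \<forall>x\<in>U \<inter> cdom c. brack Q U u (\<lambda>y. vscale Q y (g y) (v y)) x =
           vadd Q x (vscale Q x (deriv_along c x (anchor Q c x (u x)) g) (v x))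
                    (vscale Q x (g x) (brack Q U u v x)))) \<and>
     (\<forall>U u v w. open U \<longrightarrow> holo_section A Q U u \<longrightarrow> holo_section A Q U v \<longrightarrow> holo_section A Q U w \<longrightarrow>
        (\<forall>c\<in>A. \<forall>x\<in>U \<inter> cdom c.
           deriv_along c x (anchor Q c x (u x)) (\<lambda>y. pairing Q y (v y) (w y)) =
           pairing Q x (brack Q U u v x) (w x) + pairing Q x (v x) (brack Q U u w x))) \<and>
     (\<forall>U u v. open U \<longrightarrow> holo_section A Q U u \<longrightarrow> holo_section A Q U v \<longrightarrow>
        (\<forall>c\<in>A. \<forall>x\<in>U \<inter> cdom c. \<forall>w\<in>fib Q x.
           pairing Q x (vadd Q x (brack Q U u v x) (brack Q U v u x)) w =
           deriv_along c x (anchor Q c x w) (\<lambda>y. pairing Q y (u y) (v y))))"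

definition cdot :: "complex^'n \<Rightarrow> complex^'n::finite \<Rightarrow> complex" where
  "cdot \<xi> v = (\<Sum>j\<in>UNIV. \<xi> $ j * v $ j)"

text \<open>Exactness of \<open>0 \<rightarrow> T*X \<rightarrow> Q \<rightarrow> TX \<rightarrow> 0\<close> on each fibre, the first map being the dual of the
  anchor composed with the identification of \<open>Q\<close> and its dual. It is injective as soon as the
  anchor is surjective.\<close>

definition exact_courant_algebroid ::
  "('x::topological_space, 'n::finite) chart set \<Rightarrow> ('x, 'n, 'q, 'r::finite) courant \<Rightarrow> bool" where
  "exact_courant_algebroid A Q \<longleftrightarrow> holomorphic_courant_algebroid A Q \<and>
     (\<forall>c\<in>A. \<forall>x\<in>cdom c. anchor Q c x ` fib Q x = UNIV \<and>
        {u \<in> fib Q x. anchor Q c x u = 0} =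
        {u \<in> fib Q x. \<exists>\<xi>. \<forall>w\<in>fib Q x. pairing Q x u w = cdot \<xi> (anchor Q c x w)})"


section \<open>Isomorphism classes of exact Courant algebroids\<close>

definition covector_form :: "(complex^'n \<Rightarrow> complex^'n::finite) \<Rightarrow> 'n lform" where
  "covector_form \<xi> z vs = (if length vs = 1 then cdot (\<xi> z) (vs ! 0) else 0)"

text \<open>Contraction with the (1,0)-part \<open>(v - \<i> J v) / 2\<close> of a real tangent vector.\<close>

definition contract10 ::
  "complex^'n \<Rightarrow> ((complex^'n) list \<Rightarrow> complex) \<Rightarrow> (complex^'n) list \<Rightarrow> complex" where
  "contract10 v \<beta> vs = (\<beta> (v # vs) - \<i> * \<beta> ((\<i> *s v) # vs)) / 2"

definition local_section ::
  "(('x, 'n) chart \<Rightarrow> 'x \<Rightarrow> 'q \<Rightarrow> 'b) \<Rightarrow> ('x, 'n) chart \<Rightarrow> ('x \<Rightarrow> 'q) \<Rightarrow> complex^'n \<Rightarrow> 'b" where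
  "local_section \<psi> c s z = \<psi> c (cinv c z) (s (cinv c z))"

text \<open>For \<open>H = H30 + H21\<close> closed, with parts of type (3,0) and (2,1), the Courant algebroid \<open>Q_H\<close> is
  the smooth bundle of pairs \<open>V + \<xi>\<close> of a (1,0)-vector and a (1,0)-form, with

  \<^item> the Dolbeault operator sending \<open>V + \<xi>\<close> to \<open>\<partial>bar V + \<partial>bar \<xi> + i_V H21\<close>,
  \<^item> the pairing \<open>\<langle>V + \<xi>, W + \<eta>\<rangle> = (\<xi>(W) + \<eta>(V)) / 2\<close>,
  \<^item> the projection to \<open>V\<close> as anchor,
  \<^item> the bracket \<open>[V,W] + \<partial>(\<eta>(V)) + i_V \<partial>\<eta> - i_W \<partial>\<xi> + i_V i_W H30\<close> on holomorphic sections.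

  An isomorphism of \<open>Q\<close> with \<open>Q_H\<close> is a smooth bundle isomorphism over the identity that preserves
  all this structure. It is given by maps \<open>\<psi>V\<close> and \<open>\<psi>F\<close> into the coordinates of the vector part and
  of the form part.\<close>

definition iso_to_twisted ::
  "('x::topological_space, 'n::finite) chart set \<Rightarrow> ('x, 'n, 'q, 'r::finite) courant \<Rightarrow>
   ('x, 'n) dform \<Rightarrow> ('x, 'n) dform \<Rightarrow>
   (('x, 'n) chart \<Rightarrow> 'x \<Rightarrow> 'q \<Rightarrow> complex^'n) \<Rightarrow> (('x, 'n) chart \<Rightarrow> 'x \<Rightarrow> 'q \<Rightarrow> complex^'n) \<Rightarrow> bool" where
  "iso_to_twisted A Q H30 H21 \<psi>V \<psi>F \<longleftrightarrow>
     (\<comment> \<open>fibrewise linear isomorphism\<close>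
      \<forall>c\<in>A. \<forall>x\<in>cdom c. bij_betw (\<lambda>u. (\<psi>V c x u, \<psi>F c x u)) (fib Q x) UNIV \<and>
        (\<forall>u\<in>fib Q x. \<forall>v\<in>fib Q x.
           \<psi>V c x (vadd Q x u v) = \<psi>V c x u + \<psi>V c x v \<and>
           \<psi>F c x (vadd Q x u v) = \<psi>F c x u + \<psi>F c x v) \<and>
        (\<forall>a. \<forall>u\<in>fib Q x.
           \<psi>V c x (vscale Q x a u) = a *s \<psi>V c x u \<and> \<psi>F c x (vscale Q x a u) = a *s \<psi>F c x u)) \<and>
     (\<comment> \<open>change of charts for vectors and covectors\<close>
      \<forall>c\<in>A. \<forall>c'\<in>A. \<forall>x\<in>cdom c \<inter> cdom c'. \<forall>u\<in>fib Q x.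
        \<psi>V c' x u = jac c c' (cmap c x) (\<psi>V c x u) \<and>
        (\<forall>v. cdot (\<psi>F c' x u) (jac c c' (cmap c x) v) = cdot (\<psi>F c x u) v)) \<and>
     (\<comment> \<open>smoothness\<close>
      \<forall>c\<in>A. \<forall>(W, \<phi>)\<in>trivs Q. \<forall>e.
        smooth_on (cmap c ` (W \<inter> cdom c))
          (local_section \<psi>V c (\<lambda>x. inv_into (fib Q x) (\<phi> x) e)) \<and>
        smooth_on (cmap c ` (W \<inter> cdom c))
          (local_section \<psi>F c (\<lambda>x. inv_into (fib Q x) (\<phi> x) e))) \<and>
     (\<comment> \<open>anchor and pairing\<close>
      \<forall>c\<in>A. \<forall>x\<in>cdom c. \<forall>u\<in>fib Q x. \<psi>V c x u = anchor Q c x u \<and>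
        (\<forall>v\<in>fib Q x. pairing Q x u v =
           (cdot (\<psi>F c x u) (\<psi>V c x v) + cdot (\<psi>F c x v) (\<psi>V c x u)) / 2)) \<and>
     (\<comment> \<open>holomorphic structure\<close>
      \<forall>U s. open U \<longrightarrow> smooth_section A Q U s \<longrightarrow>
        (holo_section A Q U s \<longleftrightarrow>
         (\<forall>c\<in>A. vec_holo_on (cmap c ` (U \<inter> cdom c)) (local_section \<psi>V c s) \<and>
           (\<forall>z\<in>cmap c ` (U \<inter> cdom c). \<forall>a b.
              local_delbar (covector_form (local_section \<psi>F c s)) z [a, b] +
              contract10 (local_section \<psi>V c s z) (H21 c z) [a, b] = 0)))) \<and>
     (\<comment> \<open>bracket\<close>
      \<forall>U u v. open U \<longrightarrow> holo_section A Q U u \<longrightarrow> holo_section A Q U v \<longrightarrow>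
        (\<forall>c\<in>A. \<forall>z\<in>cmap c ` (U \<inter> cdom c).
           let V = local_section \<psi>V c u; \<xi> = local_section \<psi>F c u;
               W = local_section \<psi>V c v; \<eta> = local_section \<psi>F c v
           in local_section \<psi>V c (brack Q U u v) z = lie_bracket V W z \<and>
              (\<forall>b. cdot (local_section \<psi>F c (brack Q U u v) z) b =
                 dir_del (\<lambda>w. cdot (\<eta> w) (V w)) z b
                 + contract10 (V z) (local_del (covector_form \<eta>) z) [b]
                 - contract10 (W z) (local_del (covector_form \<xi>) z) [b]
                 + contract10 (V z) (contract10 (W z) (H30 c z)) [b])))"

text \<open>\<open>[Q] = [H]\<close> in \<open>{H \<in> \<Omega>^{3,0} \<oplus> \<Omega>^{2,1}. dH = 0} / d \<Omega>^{2,0}\<close>.\<close>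

definition courant_class_is ::
  "('x::topological_space, 'n::finite) chart set \<Rightarrow> ('x, 'n, 'q, 'r::finite) courant \<Rightarrow>
   ('x, 'n) dform \<Rightarrow> bool" where
  "courant_class_is A Q H \<longleftrightarrow>
     (\<exists>H30 H21 B \<psi>V \<psi>F. form_of_type A 3 0 H30 \<and> form_of_type A 2 1 H21 \<and>
        ext_d (form_add H30 H21) = form_zero \<and> iso_to_twisted A Q H30 H21 \<psi>V \<psi>F \<and>
        form_of_type A 2 0 B \<and> H = form_add (form_add H30 H21) (ext_d B))"

definition B_set ::
  "('x::topological_space, 'n::finite) chart set \<Rightarrow> ('x, 'n, 'q, 'r::finite) courant \<Rightarrow>
   ('x, 'n) dform set" where
  "B_set A Q = {\<tau>. form_of_type A 1 1 \<tau> \<and> real_form \<tau> \<and> ext_d (ext_dc \<tau>) = form_zero \<and>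
     courant_class_is A Q (form_scale (2 * \<i>) (del \<tau>))}"

definition bott_chern ::
  "('x::topological_space, 'n::finite) chart set \<Rightarrow> ('x, 'n, 'q, 'r::finite) courant \<Rightarrow> bool" where
  "bott_chern A Q \<longleftrightarrow> (\<exists>\<tau>. form_of_type A 1 1 \<tau> \<and> real_form \<tau> \<and>
     courant_class_is A Q (form_scale (2 * \<i>) (del \<tau>)))"


section \<open>Aeppli classes, hermitian metrics and the dilaton functional\<close>

definition aeppli_zero :: "('x, 'n::finite) chart set \<Rightarrow> ('x, 'n) dform \<Rightarrow> bool" where
  "aeppli_zero A \<tau> \<longleftrightarrow> (\<exists>\<alpha> \<beta>. form_of_type A 0 1 \<alpha> \<and> form_of_type A 1 0 \<beta> \<and>
     \<tau> = form_add (del \<alpha>) (delbar \<beta>))"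

definition aeppli_classes ::
  "('x::topological_space, 'n::finite) chart set \<Rightarrow> ('x, 'n, 'q, 'r::finite) courant \<Rightarrow>
   ('x, 'n) dform set set" where
  "aeppli_classes A Q = B_set A Q //
     {(\<tau>, \<tau>'). \<tau> \<in> B_set A Q \<and> \<tau>' \<in> B_set A Q \<and> aeppli_zero A (form_diff \<tau> \<tau>')}"

text \<open>The associated metric is \<open>\<omega>(\<cdot>, J \<cdot>)\<close>.\<close>

definition positive_form :: "('x, 'n::finite) chart set \<Rightarrow> ('x, 'n) dform \<Rightarrow> bool" where
  "positive_form A \<omega> \<longleftrightarrow> (\<forall>c\<in>A. \<forall>z\<in>cimg c. \<forall>v. v \<noteq> 0 \<longrightarrow> 0 < Re (\<omega> c z [v, \<i> *s v]))"

definition B_plus ::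
  "('x::topological_space, 'n::finite) chart set \<Rightarrow> ('x, 'n) dform set \<Rightarrow> ('x, 'n) dform set" where
  "B_plus A \<sigma> = {\<omega> \<in> \<sigma>. positive_form A \<omega>}"

definition positive_class ::
  "('x::topological_space, 'n::finite) chart set \<Rightarrow> ('x, 'n) dform set \<Rightarrow> bool" where
  "positive_class A \<sigma> \<longleftrightarrow> B_plus A \<sigma> \<noteq> {}"

definition dilaton :: "('x, 'n::finite) dform \<Rightarrow> ('x, 'n) chart set \<Rightarrow> ('x, 'n) dform \<Rightarrow> 'x \<Rightarrow> real" where
  "dilaton \<mu> A \<omega> = (THE f. \<forall>c\<in>A. \<forall>z\<in>cimg c. \<forall>vs.
     top_power \<omega> c z vs = fun_mult (\<lambda>x. exp (2 * f x)) \<mu> c z vs)"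

definition is_solution ::
  "('x, 'n::finite) dform \<Rightarrow> ('x, 'n) chart set \<Rightarrow> ('x, 'n) dform \<Rightarrow> bool" where
  "is_solution \<mu> A \<omega> \<longleftrightarrow>
     ext_d (fun_mult (\<lambda>x. exp (- dilaton \<mu> A \<omega> x)) (wedge_power \<omega> (CARD('n) - 1))) = form_zero \<and>
     ext_d (ext_dc \<omega>) = form_zero"

text \<open>The integrand is a real form, so taking the real part only adjusts the type.\<close>

definition dilaton_functional ::
  "('x::topological_space, 'n::{finite,linorder}) dform \<Rightarrow> ('x, 'n) chart set \<Rightarrow>
   ('x, 'n) dform \<Rightarrow> real" where
  "dilaton_functional \<mu> A \<omega> =
     Re (form_integral A (fun_mult (\<lambda>x. exp (- dilaton \<mu> A \<omega> x)) (top_power \<omega>)))"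

end

theory Submission
  imports Defs "HOL-Complex_Analysis.Cauchy_Integral_Formula"
begin

text \<open>
  Let \<open>n = 2\<close> and \<open>\<omega>\<^sup>2 / 2 = exp(2f) \<mu>\<close>, so that \<open>M(\<omega>) = \<integral> exp(f) \<mu>\<close>. A solution \<open>\<omega>\<^sub>0\<close> with dilaton function \<open>f\<^sub>0\<close> provides the
  closed form \<open>\<Omega> = exp(-f\<^sub>0) \<omega>\<^sub>0\<close>, which calibrates \<open>M\<close>.

  At a point, the real \<open>(1,1)\<close>-forms are a Lorentzian space for the wedge product and the positive
  forms lie in one time cone. The reversed Cauchy--Schwarz inequality
  (\<open>reversed_cauchy_schwarz\<close>, \<open>volume_density_le_mixed\<close>) reads \<open>\<omega> \<and> \<Omega> \<ge> 2 exp(f) \<mu>\<close>, with equality exactly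
  for \<open>\<omega> = exp(f - f\<^sub>0) \<omega>\<^sub>0\<close>. Since \<open>\<Omega>\<close> is closed and of type \<open>(1,1)\<close>, the integral of \<open>\<omega> \<and> \<Omega>\<close> depends only on
  the Aeppli class of \<open>\<omega>\<close> (\<open>aeppli_pairing\<close>); its value at \<open>\<omega>\<^sub>0\<close> is \<open>2 M(\<omega>\<^sub>0)\<close>. Hence \<open>M(\<omega>) \<le> M(\<omega>\<^sub>0)\<close> on the whole
  class (\<open>functional_le_solution\<close>).

  If \<open>\<omega>\<close> is a solution as well, the roles may be exchanged, so equality holds and \<open>\<omega> = \<omega>\<^sub>0 + u \<Omega>\<close> with
  \<open>u = exp(f) - exp(f\<^sub>0)\<close>. Both metrics are pluriclosed, so \<open>dd\<^sup>cu \<and> \<Omega> = dd\<^sup>c(u \<Omega>) = 0\<close>. Integrating \<open>d(u d\<^sup>cu) \<and> \<Omega>\<close>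
  gives \<open>\<integral> du \<and> d\<^sup>cu \<and> \<Omega> = 0\<close>, where the integrand is nonnegative, and so \<open>du = 0\<close>
  (\<open>pluriclosed_conformal_factor\<close>). Now \<open>u \<Omega>\<close> is closed, and its pairing with the Aeppli-trivial form
  \<open>\<omega> - \<omega>\<^sub>0 = u \<Omega>\<close> is \<open>\<integral> u\<^sup>2 \<Omega>\<^sup>2 = 0\<close>. Thus \<open>u = 0\<close> (\<open>solution_unique\<close>).

  Everything global rests on Stokes' theorem in the form \<open>\<integral> d\<alpha> \<and> \<Psi> = 0\<close> for a 1-form \<open>\<alpha>\<close> and a closed
  2-form \<open>\<Psi>\<close> (\<open>integral_exact_wedge_closed\<close>). The integral is defined by an arbitrary partition of
  unity, so partitions of unity have to exist (\<open>partition_of_unity_exists\<close>); their smoothness in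
  overlapping charts uses that holomorphic maps of several variables are smooth
  (\<open>holo_on_imp_smooth_on\<close>), by Cauchy's formula. Passing from one chart to another is the change of
  variables formula, with the Jacobian identified by the fact that the determinant is the only
  alternating multilinear function of the rows (\<open>alternating_eq_det\<close>).
\<close>

section \<open>Smooth functions\<close>

lemma Ck_on_Suc_has_derivative:
  assumes "Ck_on (Suc k) S f" "z \<in> S"
  shows "(f has_derivative frechet_derivative f (at z)) (at z)"
  using assms by (simp add: frechet_derivative_works)

text \<open>The congruence hypothesis breaks a circle: congruence at level \<open>k + 1\<close> follows from this rule and
  congruence at level \<open>k\<close>.\<close>

lemma Ck_on_SucI:
  fixes f :: "'a::euclidean_space \<Rightarrow> 'b::real_normed_vector"
  assumes "open S"
    and "\<And>z. z \<in> S \<Longrightarrow> (f has_derivative D z) (at z)"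
    and "\<And>v. Ck_on k S (\<lambda>z. D z v)"
    and cong: "\<And>g h :: 'a \<Rightarrow> 'b. Ck_on k S g \<Longrightarrow> (\<And>z. z \<in> S \<Longrightarrow> g z = h z) \<Longrightarrow> Ck_on k S h"
  shows "Ck_on (Suc k) S f"
proof -
  have "frechet_derivative f (at z) = D z" if "z \<in> S" for z
    using assms(2)[OF that] frechet_derivative_at by metis
  moreover have "f differentiable (at z)" if "z \<in> S" for z
    using assms(2)[OF that] differentiableI by blast
  ultimately show ?thesis
    using cong[OF assms(3)] by simp
qed

lemma Ck_on_cong:
  assumes "open S" "Ck_on k S f" "\<And>z. z \<in> S \<Longrightarrow> f z = g z"
  shows "Ck_on k S g"
  using assms(2,3)
proof (induction k arbitrary: f g)
  case 0
  then show ?case using continuous_on_cong by (metis Ck_on.simps(1))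
next
  case (Suc k)
  have "(g has_derivative frechet_derivative f (at z)) (at z)" if "z \<in> S" for z
    using has_derivative_transform_within_open[OF Ck_on_Suc_has_derivative[OF Suc.prems(1) that] assms(1) that]
      Suc.prems(2) by blast
  then show ?case
    by (rule Ck_on_SucI[OF assms(1)]) (use Suc in auto)
qed

text \<open>Any witness \<open>D\<close> of the derivative may stand in for the Frechet derivative of the definition.\<close>

lemma Ck_on_intro_Suc:
  assumes "open S"
    and "\<And>z. z \<in> S \<Longrightarrow> (f has_derivative D z) (at z)"
    and "\<And>v. Ck_on k S (\<lambda>z. D z v)"
  shows "Ck_on (Suc k) S f"
  by (rule Ck_on_SucI[OF assms]; (assumption | rule Ck_on_cong[OF assms(1)]))

lemma Ck_on_0_if_Suc: "Ck_on (Suc k) S f \<Longrightarrow> Ck_on 0 S f"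
  by (auto intro!: continuous_at_imp_continuous_on differentiable_imp_continuous_within)

lemma Ck_on_Suc_imp: "Ck_on (Suc k) S f \<Longrightarrow> Ck_on k S f"
proof (induction k arbitrary: f)
  case 0
  then show ?case by (rule Ck_on_0_if_Suc)
next
  case (Suc k)
  have "Ck_on k S (\<lambda>z. frechet_derivative f (at z) v)" for v
    using Suc.prems by (intro Suc.IH) simp
  then show ?case using Suc.prems by simp
qed

lemma Ck_on_bounded_linear:
  assumes L: "bounded_linear L" and "open S"
  shows "Ck_on k S f \<Longrightarrow> Ck_on k S (\<lambda>z. L (f z))"
proof (induction k arbitrary: f)
  case 0
  then show ?case using bounded_linear.continuous_on[OF L] by simp
next
  case (Suc k)
  show ?case
  proof (rule Ck_on_intro_Suc[OF \<open>open S\<close>])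
    show "((\<lambda>z. L (f z)) has_derivative (\<lambda>v. L (frechet_derivative f (at z) v))) (at z)" if "z \<in> S" for z
      using bounded_linear.has_derivative[OF L Ck_on_Suc_has_derivative[OF Suc.prems that]] .
    show "Ck_on k S (\<lambda>z. L (frechet_derivative f (at z) v))" for v
      using Suc by simp
  qed
qed

lemma Ck_on_const: "Ck_on k S (\<lambda>z. a)"
  by (induction k arbitrary: a) (auto simp: frechet_derivative_const)

lemma Ck_on_linear:
  assumes L: "bounded_linear L" and "open S"
  shows "Ck_on k S L"
proof (cases k)
  case 0
  then show ?thesis using bounded_linear.continuous_on[OF L continuous_on_id] by simp
next
  case (Suc m)
  show ?thesis unfolding Suc
    by (rule Ck_on_intro_Suc[OF \<open>open S\<close> bounded_linear_imp_has_derivative[OF L]]) (rule Ck_on_const)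
qed

lemma Ck_on_add:
  assumes "open S"
  shows "Ck_on k S f \<Longrightarrow> Ck_on k S g \<Longrightarrow> Ck_on k S (\<lambda>z. f z + g z)"
proof (induction k arbitrary: f g)
  case 0
  then show ?case by (auto intro: continuous_on_add)
next
  case (Suc k)
  show ?case
  proof (rule Ck_on_intro_Suc[OF \<open>open S\<close>])
    show "((\<lambda>z. f z + g z) has_derivative
        (\<lambda>v. frechet_derivative f (at z) v + frechet_derivative g (at z) v)) (at z)" if "z \<in> S" for z
      using Ck_on_Suc_has_derivative[OF Suc.prems(1) that] Ck_on_Suc_has_derivative[OF Suc.prems(2) that]
      by (rule has_derivative_add)
    show "Ck_on k S (\<lambda>z. frechet_derivative f (at z) v + frechet_derivative g (at z) v)" for v
      using Suc by simp
  qed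
qed

lemma Ck_on_sum:
  assumes "open S" "\<And>i. i \<in> I \<Longrightarrow> Ck_on k S (f i)"
  shows "Ck_on k S (\<lambda>z. \<Sum>i\<in>I. f i z)"
  using assms(2) by (induction I rule: infinite_finite_induct) (auto intro: Ck_on_const Ck_on_add[OF assms(1)])

lemma Ck_on_bilinear:
  assumes B: "bounded_bilinear B" and "open S"
  shows "Ck_on k S f \<Longrightarrow> Ck_on k S g \<Longrightarrow> Ck_on k S (\<lambda>z. B (f z) (g z))"
proof (induction k arbitrary: f g)
  case 0
  then show ?case using bounded_bilinear.continuous_on[OF B] by simp
next
  case (Suc k)
  show ?case
  proof (rule Ck_on_intro_Suc[OF \<open>open S\<close>])
    show "((\<lambda>z. B (f z) (g z)) has_derivative
        (\<lambda>v. B (f z) (frechet_derivative g (at z) v) + B (frechet_derivative f (at z) v) (g z))) (at z)"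
      if "z \<in> S" for z
      using bounded_bilinear.FDERIV[OF B Ck_on_Suc_has_derivative[OF Suc.prems(1) that]
          Ck_on_Suc_has_derivative[OF Suc.prems(2) that]] .
    show "Ck_on k S (\<lambda>z. B (f z) (frechet_derivative g (at z) v) + B (frechet_derivative f (at z) v) (g z))" for v
      using Suc.prems Suc.IH Ck_on_Suc_imp[OF Suc.prems(1)] Ck_on_Suc_imp[OF Suc.prems(2)]
      by (intro Ck_on_add[OF \<open>open S\<close>]) auto
  qed
qed

text \<open>Expanding the inner derivative in a basis turns the chain rule into a sum of products of an inner
  derivative with a composition one order lower, so the induction closes.\<close>

lemma Ck_on_compose:
  fixes g :: "'a::euclidean_space \<Rightarrow> 'b::euclidean_space"
  assumes "open S" "open T" "g ` S \<subseteq> T"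
  shows "Ck_on k T f \<Longrightarrow> Ck_on k S g \<Longrightarrow> Ck_on k S (\<lambda>z. f (g z))"
proof (induction k arbitrary: f)
  case 0
  then show ?case using assms(3) continuous_on_compose2 by auto
next
  case (Suc k)
  let ?f' = "\<lambda>y. frechet_derivative f (at y)" and ?g' = "\<lambda>y. frechet_derivative g (at y)"
  show ?case
  proof (rule Ck_on_intro_Suc[OF \<open>open S\<close>])
    fix z assume z: "z \<in> S"
    then have gz: "g z \<in> T" using assms(3) by blast
    have df: "(f has_derivative ?f' (g z)) (at (g z))"
      by (rule Ck_on_Suc_has_derivative[OF Suc.prems(1) gz])
    have chain: "((\<lambda>z. f (g z)) has_derivative (\<lambda>v. ?f' (g z) (?g' z v))) (at z)"
      using has_derivative_compose[OF Ck_on_Suc_has_derivative[OF Suc.prems(2) z] df] .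
    have expand: "?f' (g z) w = (\<Sum>b\<in>Basis. (w \<bullet> b) *\<^sub>R ?f' (g z) b)" for w
    proof -
      have lin: "linear (?f' (g z))" using has_derivative_linear[OF df] .
      have "?f' (g z) (\<Sum>b\<in>Basis. (w \<bullet> b) *\<^sub>R b) = (\<Sum>b\<in>Basis. (w \<bullet> b) *\<^sub>R ?f' (g z) b)"
        by (simp only: linear_sum[OF lin] linear_scale[OF lin])
      then show ?thesis by (simp only: euclidean_representation)
    qed
    show "((\<lambda>z. f (g z)) has_derivative
        (\<lambda>v. \<Sum>b\<in>Basis. (?g' z v \<bullet> b) *\<^sub>R ?f' (g z) b)) (at z)"
      by (rule has_derivative_eq_rhs[OF chain]) (rule ext, rule expand)
  next
    fix v
    show "Ck_on k S (\<lambda>z. \<Sum>b\<in>Basis. (?g' z v \<bullet> b) *\<^sub>R ?f' (g z) b)"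
    proof (intro Ck_on_sum[OF \<open>open S\<close>] Ck_on_bilinear[OF bounded_bilinear_scaleR \<open>open S\<close>])
      fix b :: 'b
      show "Ck_on k S (\<lambda>z. ?g' z v \<bullet> b)"
        using Suc.prems(2) by (intro Ck_on_bounded_linear[OF bounded_linear_inner_left \<open>open S\<close>]) simp
      show "Ck_on k S (\<lambda>z. ?f' (g z) b)"
        using Suc.prems(1) Ck_on_Suc_imp[OF Suc.prems(2)] by (intro Suc.IH) auto
    qed
  qed
qed

lemma smooth_on_cong:
  assumes "open S" "smooth_on S f" "\<And>z. z \<in> S \<Longrightarrow> f z = g z"
  shows "smooth_on S g"
  unfolding smooth_on_def
proof
  fix k
  from assms(2) have "Ck_on k S f" unfolding smooth_on_def ..
  then show "Ck_on k S g" by (rule Ck_on_cong[OF assms(1) _ assms(3)])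
qed

lemma smooth_on_Ck: "smooth_on S f \<Longrightarrow> Ck_on k S f"
  by (simp add: smooth_on_def)

lemma smooth_on_continuous: "smooth_on S f \<Longrightarrow> continuous_on S f"
  using smooth_on_Ck[of S f 0] by simp

lemma smooth_on_has_derivative:
  "smooth_on S f \<Longrightarrow> z \<in> S \<Longrightarrow> (f has_derivative frechet_derivative f (at z)) (at z)"
  by (rule Ck_on_Suc_has_derivative[OF smooth_on_Ck])

lemma smooth_on_derivative: "smooth_on S f \<Longrightarrow> smooth_on S (\<lambda>z. frechet_derivative f (at z) v)"
  unfolding smooth_on_def using Ck_on.simps(2)[of _ S f] by metis

lemma smooth_on_const: "smooth_on S (\<lambda>z. a)"
  by (simp add: smooth_on_def Ck_on_const)

lemma smooth_on_bounded_linear: "bounded_linear L \<Longrightarrow> open S \<Longrightarrow> smooth_on S f \<Longrightarrow> smooth_on S (\<lambda>z. L (f z))"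
  by (simp add: smooth_on_def Ck_on_bounded_linear)

lemma smooth_on_add: "open S \<Longrightarrow> smooth_on S f \<Longrightarrow> smooth_on S g \<Longrightarrow> smooth_on S (\<lambda>z. f z + g z)"
  by (simp add: smooth_on_def Ck_on_add)

lemma smooth_on_sum:
  "open S \<Longrightarrow> (\<And>i. i \<in> I \<Longrightarrow> smooth_on S (f i)) \<Longrightarrow> smooth_on S (\<lambda>z. \<Sum>i\<in>I. f i z)"
  by (simp add: smooth_on_def Ck_on_sum)

lemma smooth_on_bilinear:
  "bounded_bilinear B \<Longrightarrow> open S \<Longrightarrow> smooth_on S f \<Longrightarrow> smooth_on S g \<Longrightarrow> smooth_on S (\<lambda>z. B (f z) (g z))"
  by (simp add: smooth_on_def Ck_on_bilinear)

lemma smooth_on_mult: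
  fixes f g :: "'a::euclidean_space \<Rightarrow> 'b::real_normed_algebra"
  shows "open S \<Longrightarrow> smooth_on S f \<Longrightarrow> smooth_on S g \<Longrightarrow> smooth_on S (\<lambda>z. f z * g z)"
  by (rule smooth_on_bilinear[OF bounded_bilinear_mult])

lemma smooth_on_diff:
  assumes "open S" "smooth_on S f" "smooth_on S g"
  shows "smooth_on S (\<lambda>z. f z - g z)"
  using smooth_on_add[OF assms(1,2) smooth_on_bounded_linear[OF bounded_linear_minus[OF bounded_linear_ident] assms(1,3)]]
  by simp

lemma smooth_on_compose:
  fixes g :: "'a::euclidean_space \<Rightarrow> 'b::euclidean_space"
  shows "open S \<Longrightarrow> open T \<Longrightarrow> g ` S \<subseteq> T \<Longrightarrow> smooth_on T f \<Longrightarrow> smooth_on S g \<Longrightarrow> smooth_on S (\<lambda>z. f (g z))"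
  by (simp add: smooth_on_def Ck_on_compose)

lemma smooth_on_of_real: "open S \<Longrightarrow> smooth_on S f \<Longrightarrow> smooth_on S (\<lambda>z. complex_of_real (f z))"
  by (rule smooth_on_bounded_linear[OF bounded_linear_of_real])

text \<open>Real powers cover quotients and the exponentials of the dilaton function, and they are closed under
  differentiation.\<close>

lemma Ck_on_powr: "Ck_on k {0<..} (\<lambda>x::real. x powr a)"
proof (induction k arbitrary: a)
  case 0
  show ?case by (auto intro!: continuous_intros)
next
  case (Suc k)
  show ?case
  proof (rule Ck_on_intro_Suc)
    show "((\<lambda>x. x powr a) has_derivative (\<lambda>v. v * (a * z powr (a - 1)))) (at z)" if "z \<in> {0<..}" for z :: real
      using that has_real_derivative_powr[of z a]
      by (simp add: has_field_derivative_def mult.commute[of _ "a * _"])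
    show "Ck_on k {0<..} (\<lambda>z::real. v * (a * z powr (a - 1)))" for v
      using Suc by (intro Ck_on_bilinear[OF bounded_bilinear_mult] Ck_on_const) auto
  qed auto
qed

lemma smooth_on_powr:
  fixes f :: "'a::euclidean_space \<Rightarrow> real"
  assumes "open S" "smooth_on S f" "\<And>z. z \<in> S \<Longrightarrow> 0 < f z"
  shows "smooth_on S (\<lambda>z. f z powr a)"
  by (rule smooth_on_compose[of S "{0<..}" f "\<lambda>x. x powr a"])
    (use assms in \<open>auto simp: smooth_on_def[of "{0<..}"] Ck_on_powr\<close>)

text \<open>The functions \<open>t^(-m) exp(-1/t)\<close>, extended by 0. They form a family closed under differentiation, which is why the
  index \<open>m\<close> is kept; \<open>flat 0\<close> is the usual building block of bump functions.\<close>

definition flat :: "nat \<Rightarrow> real \<Rightarrow> real" where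
  "flat m t = (if 0 < t then exp (- inverse t) * inverse t ^ m else 0)"

lemma flat_tendsto_0: "(flat m \<longlongrightarrow> 0) (at 0)"
proof -
  have "((\<lambda>s::real. s ^ m / exp s) \<longlongrightarrow> 0) at_top"
    by (rule tendsto_power_div_exp_0)
  then have "((\<lambda>t::real. inverse t ^ m / exp (inverse t)) \<longlongrightarrow> 0) (at_right 0)"
    using filterlim_compose filterlim_inverse_at_top_right by blast
  then have R: "(flat m \<longlongrightarrow> 0) (at_right 0)"
  proof (rule Lim_transform_eventually)
    show "\<forall>\<^sub>F x in at_right 0. inverse x ^ m / exp (inverse x) = flat m x"
      by (rule eventually_at_right_less[THEN eventually_mono])
        (auto simp: flat_def exp_minus divide_simps)
  qed
  have "(flat m \<longlongrightarrow> 0) (at_left 0)"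
  proof (rule tendsto_eventually)
    show "\<forall>\<^sub>F x in at_left 0. flat m x = 0"
      using eventually_at_left_real[of "-1" "0::real"]
      by (auto elim!: eventually_mono simp: flat_def)
  qed
  with R show ?thesis by (simp add: filterlim_split_at_real)
qed

text \<open>At 0 the difference quotient of \<open>flat m\<close> is \<open>flat (m + 1)\<close>, which tends to 0.\<close>

lemma flat_has_derivative:
  "(flat m has_real_derivative (flat (m + 2) t - real m * flat (m + 1) t)) (at t)"
proof -
  consider "t < 0" | "t = 0" | "t > 0" by linarith
  then show ?thesis
  proof cases
    case 1
    have "((\<lambda>t. 0) has_real_derivative 0) (at t)" by simp
    then have "(flat m has_real_derivative 0) (at t)"
      by (rule has_field_derivative_transform_within_open[of _ _ _ "{..<0}"]) (use 1 in \<open>auto simp: flat_def\<close>)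
    then show ?thesis using 1 by (simp add: flat_def)
  next
    case 2
    have "((\<lambda>h. flat m h / h) \<longlongrightarrow> 0) (at 0)"
      by (rule Lim_transform_eventually[OF flat_tendsto_0[of "Suc m"]])
        (auto simp: eventually_at_filter flat_def divide_simps)
    then show ?thesis using 2 by (simp add: DERIV_def flat_def)
  next
    case 3
    let ?s = "inverse t"
    have p: "real m * ?s ^ (m - Suc 0) * ?s\<^sup>2 = real m * ?s ^ (m + 1)"
      by (cases m) (auto simp: power2_eq_square)
    have "((\<lambda>t. exp (- inverse t) * inverse t ^ m) has_real_derivative
       (exp (- ?s) * ?s\<^sup>2 * ?s ^ m - exp (- ?s) * (real m * ?s ^ (m - Suc 0) * ?s\<^sup>2))) (at t)"
      using 3 by (auto intro!: derivative_eq_intros simp: power2_eq_square)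
    then have "((\<lambda>t. exp (- inverse t) * inverse t ^ m) has_real_derivative
       (flat (m + 2) t - real m * flat (m + 1) t)) (at t)"
      using 3 unfolding p by (simp add: flat_def power2_eq_square mult_ac)
    then show ?thesis
      by (rule has_field_derivative_transform_within_open[of _ _ _ "{0<..}"]) (use 3 in \<open>auto simp: flat_def\<close>)
  qed
qed

lemma smooth_on_flat: "smooth_on UNIV (flat m)"
proof -
  have "Ck_on k UNIV (flat m)" for k
  proof (induction k arbitrary: m)
    case 0
    show ?case
      by (auto intro!: continuous_at_imp_continuous_on DERIV_isCont[OF flat_has_derivative])
  next
    case (Suc k)
    show ?case
    proof (rule Ck_on_intro_Suc)
      show "(flat m has_derivative (\<lambda>v. v * (flat (m + 2) z - real m * flat (m + 1) z))) (at z)" for z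
        using flat_has_derivative[of m z] unfolding has_field_derivative_def
      by (rule has_derivative_eq_rhs) (simp add: fun_eq_iff)
      show "Ck_on k UNIV (\<lambda>z. v * (flat (m + 2) z - real m * flat (m + 1) z))" for v
        using Ck_on_add[OF open_UNIV Suc.IH[of "m + 2"] Ck_on_bilinear[OF bounded_bilinear_mult open_UNIV
            Ck_on_const[of k UNIV "- real m"] Suc.IH[of "m + 1"]]]
        by (intro Ck_on_bilinear[OF bounded_bilinear_mult] Ck_on_const) auto
    qed auto
  qed
  then show ?thesis by (simp add: smooth_on_def)
qed

lemma smooth_bump_on_ball:
  fixes a :: "'a::euclidean_space"
  shows "smooth_on UNIV (\<lambda>z. flat 0 (r\<^sup>2 - (z - a) \<bullet> (z - a)))"
proof (rule smooth_on_compose[OF open_UNIV open_UNIV _ smooth_on_flat])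
  have "smooth_on UNIV (\<lambda>z::'a. z)"
    by (simp add: smooth_on_def Ck_on_linear[OF bounded_linear_ident])
  then have "smooth_on UNIV (\<lambda>z::'a. z - a)"
    by (intro smooth_on_diff smooth_on_const) auto
  then show "smooth_on UNIV (\<lambda>z. r\<^sup>2 - (z - a) \<bullet> (z - a))"
    by (intro smooth_on_diff[OF open_UNIV smooth_on_const] smooth_on_bilinear[OF bounded_bilinear_inner open_UNIV])
qed auto

section \<open>Holomorphic functions of several variables\<close>

lemma norm_vector_smult: "norm (a *s v) = cmod a * norm v" for v :: "complex^'n"
  by (simp add: norm_vec_def L2_set_def norm_mult power_mult_distrib sum_distrib_left[symmetric] real_sqrt_mult)

lemma bounded_linear_smult_left: "bounded_linear (\<lambda>a. a *s v)" for v :: "complex^'n"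
proof (rule bounded_linear_intro)
  show "norm (a *s v) \<le> norm a * norm v" for a by (simp add: norm_vector_smult)
qed (auto simp: vec_eq_iff distrib_right)

lemma holo_on_has_derivative:
  assumes "holo_on S f" "z \<in> S"
  shows "(f has_derivative frechet_derivative f (at z)) (at z)"
    and "frechet_derivative f (at z) (a *s v) = a * frechet_derivative f (at z) v"
proof -
  obtain L where L: "(f has_derivative L) (at z)" "\<And>a v. L (a *s v) = a * L v"
    using assms unfolding holo_on_def by blast
  then have "frechet_derivative f (at z) = L" using frechet_derivative_at by metis
  with L show "(f has_derivative frechet_derivative f (at z)) (at z)"
    and "frechet_derivative f (at z) (a *s v) = a * frechet_derivative f (at z) v" by auto
qed

text \<open>Cauchy's formula on the complex line through \<open>z\<close> in the direction \<open>v\<close>. On the circle \<open>\<gamma>(t)\<close> of radius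
  \<open>r\<close> the kernel \<open>\<gamma>' / (2\<pi>i \<gamma>\<^sup>2)\<close> is \<open>1 / \<gamma>\<close>.\<close>

lemma holo_on_directional_derivative_integral:
  fixes f :: "complex^'n \<Rightarrow> complex"
  assumes holo: "holo_on S f" and r: "0 < r"
    and sub: "\<And>a. cmod a \<le> r \<Longrightarrow> z + a *s v \<in> S"
  shows "((\<lambda>t. f (z + (of_real r * exp (2 * of_real pi * \<i> * of_real t)) *s v)
      / (of_real r * exp (2 * of_real pi * \<i> * of_real t))) has_integral frechet_derivative f (at z) v) {0..1}"
proof -
  let ?F = "\<lambda>a. f (z + a *s v)"
  let ?f' = "\<lambda>y. frechet_derivative f (at y)"
  have D: "(?F has_field_derivative ?f' (z + a *s v) v) (at a)" if "cmod a \<le> r" for a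
  proof -
    have "((\<lambda>a. z + a *s v) has_derivative (\<lambda>b. b *s v)) (at a)"
      using has_derivative_add[OF has_derivative_const bounded_linear_imp_has_derivative[OF bounded_linear_smult_left]]
      by simp
    from has_derivative_compose[OF this holo_on_has_derivative(1)[OF holo sub[OF that]]]
    show ?thesis
      by (simp add: has_field_derivative_def holo_on_has_derivative(2)[OF holo sub[OF that]] mult.commute[of _ "?f' _ v"])
  qed
  have cont: "continuous_on (cball 0 r) ?F"
    by (auto intro!: continuous_at_imp_continuous_on DERIV_isCont[OF D])
  have hol: "?F holomorphic_on ball 0 r"
    unfolding holomorphic_on_open[OF open_ball]
  proof
    fix a :: complex assume "a \<in> ball 0 r"
    then show "\<exists>f'. (?F has_field_derivative f') (at a)" using D[of a] by auto
  qed
  have der: "deriv ?F 0 = ?f' z v"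
    using DERIV_imp_deriv[OF D[of 0]] r by simp
  have "((\<lambda>u. ?F u / (u - 0) ^ Suc 1) has_contour_integral (2 * pi * \<i>) / fact 1 * (deriv ^^ 1) ?F 0)
      (circlepath 0 r)"
    by (rule Cauchy_has_contour_integral_higher_derivative_circlepath[OF cont hol]) (use r in simp)
  then have "((\<lambda>u. ?F u / u\<^sup>2) has_contour_integral (2 * pi * \<i>) * ?f' z v) (circlepath 0 r)"
    by (simp add: der power2_eq_square)
  then have "((\<lambda>t. ?F (circlepath 0 r t) / (circlepath 0 r t)\<^sup>2 *
      vector_derivative (circlepath 0 r) (at t within {0..1})) has_integral (2 * pi * \<i>) * ?f' z v) {0..1}"
    by (simp add: has_contour_integral_def)
  then have "((\<lambda>t. ?F (circlepath 0 r t) / (circlepath 0 r t)\<^sup>2 *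
      (2 * pi * \<i> * r * exp (2 * of_real pi * \<i> * t))) has_integral (2 * pi * \<i>) * ?f' z v) {0..1}"
    by (rule has_integral_eq[rotated]) (simp add: vector_derivative_circlepath01)
  then have "((\<lambda>t. 1 / (2 * pi * \<i>) * (?F (circlepath 0 r t) / (circlepath 0 r t)\<^sup>2 *
      (2 * pi * \<i> * r * exp (2 * of_real pi * \<i> * t)))) has_integral 1 / (2 * pi * \<i>) * ((2 * pi * \<i>) * ?f' z v)) {0..1}"
    by (rule has_integral_mult_right)
  moreover have "1 / (2 * pi * \<i>) * ((2 * pi * \<i>) * ?f' z v) = ?f' z v" by simp
  moreover have "1 / (2 * pi * \<i>) * (?F (circlepath 0 r t) / (circlepath 0 r t)\<^sup>2 *
      (2 * pi * \<i> * r * exp (2 * of_real pi * \<i> * t))) =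
    f (z + (of_real r * exp (2 * of_real pi * \<i> * of_real t)) *s v)
      / (of_real r * exp (2 * of_real pi * \<i> * of_real t))" for t
    using r by (simp add: circlepath power2_eq_square field_simps)
  ultimately show ?thesis by (simp only:)
qed

text \<open>One circle serves all base points near \<open>z0\<close>, so the directional derivative becomes an integral
  depending on a parameter.\<close>

lemma holo_on_local_derivative_integral:
  fixes f :: "complex^'n \<Rightarrow> complex"
  assumes holo: "holo_on S f" and S: "open S" and z0: "z0 \<in> S"
  obtains \<delta> \<gamma> where "0 < \<delta>" "continuous_on {0..1} \<gamma>" "\<And>t. \<gamma> t \<noteq> 0" "ball z0 \<delta> \<subseteq> S"
    "\<And>z t. z \<in> ball z0 \<delta> \<Longrightarrow> z + \<gamma> t *s v \<in> S"
    "\<And>z. z \<in> ball z0 \<delta> \<Longrightarrow> ((\<lambda>t. f (z + \<gamma> t *s v) / \<gamma> t) has_integral frechet_derivative f (at z) v) {0..1::real}"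
proof -
  obtain e where e: "0 < e" "ball z0 e \<subseteq> S" using S z0 open_contains_ball by blast
  \<comment> \<open>The radius keeps the circles inside the ball around \<open>z0\<close>; adding 1 admits \<open>v = 0\<close>.\<close>
  define r where "r = e / 2 / (norm v + 1)"
  define \<gamma> where "\<gamma> = (\<lambda>t. of_real r * exp (2 * of_real pi * \<i> * complex_of_real t))"
  have nv: "0 < norm v + 1" using norm_ge_zero[of v] by linarith
  have r: "0 < r" "r * norm v < e / 2"
    using e nv by (auto simp: r_def field_simps)
  have sub: "z + a *s v \<in> S" if "z \<in> ball z0 (e/2)" "cmod a \<le> r" for z a
  proof -
    have "norm (a *s v) < e / 2"
      using r(2) mult_right_mono[OF that(2) norm_ge_zero[of v]] by (simp add: norm_vector_smult)
    then have "z + a *s v \<in> ball z0 e"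
      using that(1) norm_triangle_ineq[of "z - z0" "a *s v"]
      by (simp add: dist_norm norm_minus_commute algebra_simps)
    then show ?thesis using e by blast
  qed
  have n: "cmod (\<gamma> t) \<le> r" for t using r by (simp add: \<gamma>_def norm_mult)
  show thesis
  proof (rule that[of "e/2" \<gamma>])
    show "continuous_on {0..1} \<gamma>" unfolding \<gamma>_def by (intro continuous_intros)
    show "((\<lambda>t. f (z + \<gamma> t *s v) / \<gamma> t) has_integral frechet_derivative f (at z) v) {0..1}"
      if "z \<in> ball z0 (e/2)" for z
      unfolding \<gamma>_def by (rule holo_on_directional_derivative_integral[OF holo r(1) sub[OF that]])
    show "ball z0 (e/2) \<subseteq> S" using e by auto
  qed (use e r n sub in \<open>auto simp: \<gamma>_def\<close>)
qed

lemma continuous_on_translate_smult: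
  fixes v :: "complex^'n"
  assumes "continuous_on {0..1::real} \<gamma>"
  shows "continuous_on (U \<times> {0..1}) (\<lambda>p. \<gamma> (snd p))"
    and "continuous_on (U \<times> {0..1}) (\<lambda>p. fst p + \<gamma> (snd p) *s v)"
proof -
  show *: "continuous_on (U \<times> {0..1}) (\<lambda>p. \<gamma> (snd p))"
    by (rule continuous_on_compose2[OF assms continuous_on_snd[OF continuous_on_id]]) auto
  show "continuous_on (U \<times> {0..1}) (\<lambda>p. fst p + \<gamma> (snd p) *s v)"
    by (rule continuous_on_add[OF continuous_on_fst[OF continuous_on_id]
          bounded_linear.continuous_on[OF bounded_linear_smult_left *]])
qed

text \<open>Continuity of the derivative has to come first: differentiation under the integral sign requires
  it.\<close>

lemma holo_on_continuous_derivative: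
  fixes f :: "complex^'n \<Rightarrow> complex"
  assumes holo: "holo_on S f" and S: "open S"
  shows "continuous_on S (\<lambda>z. frechet_derivative f (at z) v)"
proof (rule continuous_at_imp_continuous_on, rule ballI)
  fix z0 assume "z0 \<in> S"
  then obtain \<delta> \<gamma> where
    *: "0 < \<delta>" "continuous_on {0..1} \<gamma>" "\<And>t. \<gamma> t \<noteq> 0" and "ball z0 \<delta> \<subseteq> S" and
    **: "\<And>z t. z \<in> ball z0 \<delta> \<Longrightarrow> z + \<gamma> t *s v \<in> S"
    "\<And>z. z \<in> ball z0 \<delta> \<Longrightarrow> ((\<lambda>t. f (z + \<gamma> t *s v) / \<gamma> t) has_integral frechet_derivative f (at z) v) {0..1::real}"
    by (rule holo_on_local_derivative_integral[OF holo S, where v = v]) (rule that)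
  have cf: "continuous_on S f"
    by (auto intro!: continuous_at_imp_continuous_on has_derivative_continuous holo_on_has_derivative(1)[OF holo])
  have "continuous_on (ball z0 \<delta> \<times> cbox 0 1) (\<lambda>(z, t). f (z + \<gamma> t *s v) / \<gamma> t)"
    using *(2,3) **(1) unfolding split_beta box_real
    by (intro continuous_on_divide continuous_on_compose2[OF cf continuous_on_translate_smult(2)]
        continuous_on_translate_smult(1)) auto
  then have "continuous_on (ball z0 \<delta>) (\<lambda>z. integral (cbox 0 1) (\<lambda>t. f (z + \<gamma> t *s v) / \<gamma> t))"
    by (rule integral_continuous_on_param)
  then have "continuous_on (ball z0 \<delta>) (\<lambda>z. frechet_derivative f (at z) v)"
    by (rule continuous_on_eq) (use **(2) in \<open>auto intro!: integral_unique\<close>)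
  then show "isCont (\<lambda>z. frechet_derivative f (at z) v) z0"
    using *(1) by (simp add: continuous_on_eq_continuous_at)
qed

text \<open>Directional derivatives of a holomorphic function of several variables are again
  holomorphic: they are Cauchy integrals over a small circle, and the integral may be
  differentiated with respect to the base point.\<close>

lemma holo_on_derivative:
  fixes f :: "complex^'n \<Rightarrow> complex"
  assumes holo: "holo_on S f" and S: "open S"
  shows "holo_on S (\<lambda>z. frechet_derivative f (at z) v)"
  unfolding holo_on_def
proof
  fix z0 assume z0: "z0 \<in> S"
  let ?f' = "\<lambda>y. frechet_derivative f (at y)"
  from z0 obtain \<delta> \<gamma> where
    *: "0 < \<delta>" "continuous_on {0..1} \<gamma>" "\<And>t. \<gamma> t \<noteq> 0" and "ball z0 \<delta> \<subseteq> S" and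
    **: "\<And>z t. z \<in> ball z0 \<delta> \<Longrightarrow> z + \<gamma> t *s v \<in> S"
    "\<And>z. z \<in> ball z0 \<delta> \<Longrightarrow> ((\<lambda>t. f (z + \<gamma> t *s v) / \<gamma> t) has_integral ?f' z v) {0..1::real}"
    by (rule holo_on_local_derivative_integral[OF holo S, where v = v]) (rule that)
  define D where "D = (\<lambda>z t. Blinfun (\<lambda>w. ?f' (z + \<gamma> t *s v) w / \<gamma> t))"
  have bl: "bounded_linear (\<lambda>w. ?f' (z + \<gamma> t *s v) w / \<gamma> t)" if "z \<in> ball z0 \<delta>" for z t
    using has_derivative_bounded_linear[OF holo_on_has_derivative(1)[OF holo **(1)[OF that]]]
    by (simp add: divide_inverse bounded_linear_compose[OF bounded_linear_mult_left])
  have D: "blinfun_apply (D z t) w = ?f' (z + \<gamma> t *s v) w / \<gamma> t" if "z \<in> ball z0 \<delta>" for z t w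
    using bl[OF that] by (simp add: D_def bounded_linear_Blinfun_apply)
  have contD: "continuous_on (ball z0 \<delta> \<times> cbox 0 1) (\<lambda>(z, t). D z t)"
  proof (rule continuous_on_blinfun_componentwise)
    fix i :: "complex^'n"
    have "continuous_on (ball z0 \<delta> \<times> cbox 0 1) (\<lambda>p. ?f' (fst p + \<gamma> (snd p) *s v) i / \<gamma> (snd p))"
      using *(2,3) **(1) unfolding box_real
      by (intro continuous_on_divide continuous_on_compose2[OF holo_on_continuous_derivative[OF holo S]
            continuous_on_translate_smult(2)] continuous_on_translate_smult(1)) auto
    then show "continuous_on (ball z0 \<delta> \<times> cbox 0 1) (\<lambda>x. blinfun_apply (case x of (z, t) \<Rightarrow> D z t) i)"
      by (rule continuous_on_eq) (auto simp: D)
  qed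
  have "((\<lambda>z. integral (cbox 0 1) (\<lambda>t. f (z + \<gamma> t *s v) / \<gamma> t)) has_derivative
      blinfun_apply (integral (cbox 0 1) (D z0))) (at z0 within ball z0 \<delta>)"
  proof (rule leibniz_rule[OF _ _ contD])
    fix z t assume z: "z \<in> ball z0 \<delta>"
    have "((\<lambda>z. z + \<gamma> t *s v) has_derivative (\<lambda>w. w)) (at z)"
      by (auto intro!: derivative_eq_intros)
    from has_derivative_compose[OF this holo_on_has_derivative(1)[OF holo **(1)[OF z]]]
    have "((\<lambda>z. f (z + \<gamma> t *s v) / \<gamma> t) has_derivative (\<lambda>w. ?f' (z + \<gamma> t *s v) w / \<gamma> t)) (at z)"
      unfolding divide_inverse by (rule has_derivative_mult_left)
    then have "((\<lambda>z. f (z + \<gamma> t *s v) / \<gamma> t) has_derivative blinfun_apply (D z t)) (at z)"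
      by (rule has_derivative_eq_rhs) (simp add: fun_eq_iff D[OF z])
    then show "((\<lambda>z. f (z + \<gamma> t *s v) / \<gamma> t) has_derivative blinfun_apply (D z t)) (at z within ball z0 \<delta>)"
      by (rule has_derivative_at_withinI)
  qed (use *(1) **(2) in \<open>auto\<close>)
  then have "((\<lambda>z. integral (cbox 0 1) (\<lambda>t. f (z + \<gamma> t *s v) / \<gamma> t)) has_derivative
      blinfun_apply (integral (cbox 0 1) (D z0))) (at z0)"
    using *(1) at_within_open[of z0 "ball z0 \<delta>"] by simp
  then have der: "((\<lambda>z. ?f' z v) has_derivative blinfun_apply (integral (cbox 0 1) (D z0))) (at z0)"
    by (rule has_derivative_transform_within_open[of _ _ _ _ "ball z0 \<delta>"])
      (use *(1) **(2) in \<open>auto intro!: integral_unique\<close>)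
  have "continuous_on (cbox 0 1) (\<lambda>t. (\<lambda>(z, t). D z t) (z0, t))"
    by (rule continuous_on_compose2[OF contD]) (use *(1) in \<open>auto intro!: continuous_intros\<close>)
  then have "continuous_on (cbox 0 1) (D z0)" by simp
  then have "D z0 integrable_on cbox 0 1" by (rule integrable_continuous)
  then have app: "blinfun_apply (integral (cbox 0 1) (D z0)) w = integral (cbox 0 1) (\<lambda>t. ?f' (z0 + \<gamma> t *s v) w / \<gamma> t)" for w
    using *(1) by (simp add: blinfun_apply_integral D)
  have "blinfun_apply (integral (cbox 0 1) (D z0)) (a *s w) = a * blinfun_apply (integral (cbox 0 1) (D z0)) w" for a w
  proof -
    have "?f' (z0 + \<gamma> t *s v) (a *s w) / \<gamma> t = a * (?f' (z0 + \<gamma> t *s v) w / \<gamma> t)" for t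
      using *(1) holo_on_has_derivative(2)[OF holo **(1), of z0] by simp
    then show ?thesis unfolding app by (simp only: integral_mult_right)
  qed
  with der show "\<exists>L. ((\<lambda>z. ?f' z v) has_derivative L) (at z0) \<and> (\<forall>a v. L (a *s v) = a * L v)"
    by blast
qed

lemma holo_on_imp_smooth_on:
  fixes f :: "complex^'n \<Rightarrow> complex"
  assumes "open S" "holo_on S f"
  shows "smooth_on S f"
proof -
  have "Ck_on k S f" if "holo_on S f" for k and f :: "complex^'n \<Rightarrow> complex"
    using that
  proof (induction k arbitrary: f)
    case 0
    then show ?case
      by (auto intro!: continuous_at_imp_continuous_on has_derivative_continuous holo_on_has_derivative(1))
  next
    case (Suc k)
    show ?case
      by (rule Ck_on_intro_Suc[OF assms(1) holo_on_has_derivative(1)[OF Suc.prems] Suc.IH[OF holo_on_derivative[OF Suc.prems assms(1)]]])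
  qed
  then show ?thesis using assms(2) by (simp add: smooth_on_def)
qed

lemma smooth_on_vec:
  fixes f :: "'a::euclidean_space \<Rightarrow> complex^'n"
  assumes "open S" "\<And>i. smooth_on S (\<lambda>z. f z $ i)"
  shows "smooth_on S f"
proof -
  have "bounded_linear (axis i :: complex \<Rightarrow> complex^'n)" for i
    unfolding linear_conv_bounded_linear[symmetric] by (rule linearI) (auto simp: axis_def vec_eq_iff)
  then have "smooth_on S (\<lambda>z. \<Sum>i\<in>UNIV. axis i (f z $ i))"
    by (intro smooth_on_sum[OF assms(1)] smooth_on_bounded_linear[OF _ assms(1,2)])
  then show ?thesis
    by (rule smooth_on_cong[OF assms(1)]) (simp add: vec_eq_iff axis_def if_distrib sum.delta cong: if_cong)
qed

lemma vec_holo_on_imp_smooth_on: "open S \<Longrightarrow> vec_holo_on S f \<Longrightarrow> smooth_on S f"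
  by (intro smooth_on_vec holo_on_imp_smooth_on) (auto simp: vec_holo_on_def)

lemma vec_holo_on_has_derivative:
  assumes "open S" "vec_holo_on S f" "z \<in> S"
  shows "(f has_derivative frechet_derivative f (at z)) (at z)"
    and "frechet_derivative f (at z) (a *s v) = a *s frechet_derivative f (at z) v"
proof -
  show D: "(f has_derivative frechet_derivative f (at z)) (at z)"
    by (rule smooth_on_has_derivative[OF vec_holo_on_imp_smooth_on[OF assms(1,2)] assms(3)])
  have "frechet_derivative f (at z) (a *s v) $ k = a * frechet_derivative f (at z) v $ k" for k
  proof -
    have h: "holo_on S (\<lambda>z. f z $ k)" using assms(2) by (simp add: vec_holo_on_def)
    have "((\<lambda>z. f z $ k) has_derivative (\<lambda>v. frechet_derivative f (at z) v $ k)) (at z)"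
      by (rule bounded_linear.has_derivative[OF bounded_linear_vec_nth D])
    then have "(\<lambda>v. frechet_derivative f (at z) v $ k) = frechet_derivative (\<lambda>z. f z $ k) (at z)"
      by (rule frechet_derivative_at)
    then show ?thesis using holo_on_has_derivative(2)[OF h assms(3)] by metis
  qed
  then show "frechet_derivative f (at z) (a *s v) = a *s frechet_derivative f (at z) v"
    by (simp add: vec_eq_iff)
qed

section \<open>Smooth partitions of unity\<close>

lemma Ck_on_Un:
  assumes "open S" "open T"
  shows "Ck_on k S f \<Longrightarrow> Ck_on k T f \<Longrightarrow> Ck_on k (S \<union> T) f"
proof (induction k arbitrary: f)
  case 0
  then show ?case using continuous_on_open_Un[OF assms] by simp
next
  case (Suc k)
  then show ?case by (simp add: ball_Un)
qed

lemma smooth_on_Un: "open S \<Longrightarrow> open T \<Longrightarrow> smooth_on S f \<Longrightarrow> smooth_on T f \<Longrightarrow> smooth_on (S \<union> T) f"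
  by (simp add: smooth_on_def Ck_on_Un)

locale atlas =
  fixes A :: "('x::t2_space, 'n::finite) chart set"
  assumes atlas: "holomorphic_atlas A" and compact_UNIV: "compact (UNIV :: 'x set)"
begin

lemma charts_cover: "\<exists>c\<in>A. x \<in> cdom c"
  using atlas unfolding holomorphic_atlas_def by blast

lemma open_cdom: "c \<in> A \<Longrightarrow> open (cdom c)"
  and open_cimg: "c \<in> A \<Longrightarrow> open (cimg c)"
  and chart_homeomorphism: "c \<in> A \<Longrightarrow> homeomorphism (cdom c) (cimg c) (cmap c) (cinv c)"
  using atlas unfolding holomorphic_atlas_def by blast+

lemma transition_holo: "c \<in> A \<Longrightarrow> c' \<in> A \<Longrightarrow> vec_holo_on (cmap c ` (cdom c \<inter> cdom c')) (transition c c')"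
  using atlas unfolding holomorphic_atlas_def by blast

lemma cinv_cmap: "c \<in> A \<Longrightarrow> x \<in> cdom c \<Longrightarrow> cinv c (cmap c x) = x"
  and cmap_cinv: "c \<in> A \<Longrightarrow> z \<in> cimg c \<Longrightarrow> cmap c (cinv c z) = z"
  and cmap_in_cimg: "x \<in> cdom c \<Longrightarrow> cmap c x \<in> cimg c"
  and cinv_in_cdom: "c \<in> A \<Longrightarrow> z \<in> cimg c \<Longrightarrow> cinv c z \<in> cdom c"
  using chart_homeomorphism[of c] unfolding homeomorphism_def cimg_def by blast+

lemma chart_image_eq: "c \<in> A \<Longrightarrow> cmap c ` (U \<inter> cdom c) = {z \<in> cimg c. cinv c z \<in> U}"
  by (auto simp: cinv_cmap cmap_in_cimg cinv_in_cdom) (metis IntI cinv_in_cdom cmap_cinv image_eqI)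

lemma open_chart_image: "c \<in> A \<Longrightarrow> open U \<Longrightarrow> open {z \<in> cimg c. cinv c z \<in> U}"
proof -
  assume c: "c \<in> A" and "open U"
  then have "open (cimg c \<inter> cinv c -` U)"
    using chart_homeomorphism[OF c] open_cimg[OF c] by (intro continuous_open_preimage) (simp_all add: homeomorphism_def)
  then show ?thesis by (simp add: vimage_def Int_def)
qed

lemma smooth_fun_iff: "smooth_fun A UNIV f \<longleftrightarrow> (\<forall>c\<in>A. smooth_on (cimg c) (\<lambda>z. f (cinv c z)))"
  by (simp add: smooth_fun_def cimg_def o_def)

lemma smooth_fun_imp_continuous:
  assumes "smooth_fun A UNIV f"
  shows "continuous_on UNIV f"
proof (rule continuous_at_imp_continuous_on, rule ballI)
  fix x
  obtain c where c: "c \<in> A" "x \<in> cdom c" using charts_cover by blast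
  have "continuous_on (cdom c) (\<lambda>y. f (cinv c (cmap c y)))"
  proof (rule continuous_on_compose2[of "cimg c" "\<lambda>z. f (cinv c z)"])
    show "continuous_on (cimg c) (\<lambda>z. f (cinv c z))"
      using assms c smooth_on_continuous by (auto simp: smooth_fun_iff)
    show "continuous_on (cdom c) (cmap c)"
      using chart_homeomorphism[OF c(1)] by (simp add: homeomorphism_def)
  qed (auto intro: cmap_in_cimg)
  then have "continuous_on (cdom c) f"
    by (rule continuous_on_eq) (simp add: cinv_cmap[OF c(1)])
  then show "isCont f x" using continuous_on_eq_continuous_at[OF open_cdom[OF c(1)]] c(2) by blast
qed

text \<open>A bump function on a coordinate ball, extended by 0. The closed coordinate ball is compact, hence
  closed in the Hausdorff space, and the two open sets on which the function is obviously smooth cover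
  the manifold.\<close>

lemma chart_bump_function:
  assumes c: "c \<in> A" and x: "x \<in> cdom c"
  obtains b :: "'x \<Rightarrow> real" and U where "smooth_fun A UNIV b" "\<And>y. 0 \<le> b y" "closure {y. b y \<noteq> 0} \<subseteq> cdom c"
    "open U" "x \<in> U" "\<And>y. y \<in> U \<Longrightarrow> 0 < b y"
proof -
  let ?a = "cmap c x"
  obtain e where e: "0 < e" "cball ?a e \<subseteq> cimg c"
    using open_cimg[OF c] cmap_in_cimg[OF x] open_contains_cball by blast
  define K where "K = cinv c ` cball ?a e"
  have "continuous_on (cball ?a e) (cinv c)"
    using chart_homeomorphism[OF c] e(2) by (auto simp: homeomorphism_def intro: continuous_on_subset)
  then have "compact K" unfolding K_def by (intro compact_continuous_image) auto
  then have closed: "closed K" by (rule compact_imp_closed)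
  have KD: "K \<subseteq> cdom c" using e(2) by (auto simp: K_def intro!: cinv_in_cdom[OF c])
  let ?\<beta> = "\<lambda>z. flat 0 (e\<^sup>2 - (z - ?a) \<bullet> (z - ?a))"
  have pos: "0 < ?\<beta> z \<longleftrightarrow> z \<in> ball ?a e" for z
    using e(1) by (simp add: flat_def dist_norm norm_minus_commute power2_norm_eq_inner[symmetric] abs_le_square_iff not_less power2_le_iff_abs_le)
      (smt (verit, ccfv_SIG) norm_ge_zero power_mono_iff pos2)
  define b where "b = (\<lambda>y. if y \<in> cdom c then ?\<beta> (cmap c y) else 0)"
  have nn: "0 \<le> ?\<beta> z" for z by (simp add: flat_def)
  have bK: "y \<in> K" if "b y \<noteq> 0" for y
  proof -
    have y: "y \<in> cdom c" "0 < ?\<beta> (cmap c y)" using that nn by (auto simp: b_def less_le split: if_splits)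
    then have "cmap c y \<in> cball ?a e" using pos by auto
    then show ?thesis unfolding K_def using cinv_cmap[OF c y(1)] by force
  qed
  have "smooth_on (cimg c') (\<lambda>z. b (cinv c' z))" if c': "c' \<in> A" for c'
  proof -
    let ?V = "{z \<in> cimg c'. cinv c' z \<in> cdom c}" and ?W = "{z \<in> cimg c'. cinv c' z \<in> - K}"
    have o: "open ?V" "open ?W"
      using open_chart_image[OF c' open_cdom[OF c]] open_chart_image[OF c' open_Compl[OF closed]] by auto
    have "vec_holo_on ?V (transition c' c)"
      using transition_holo[OF c' c] chart_image_eq[OF c', of "cdom c"] by (simp add: Int_commute)
    then have "smooth_on ?V (\<lambda>z. ?\<beta> (transition c' c z))"
      by (intro smooth_on_compose[OF o(1) open_UNIV subset_UNIV smooth_bump_on_ball] vec_holo_on_imp_smooth_on[OF o(1)])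
    then have 1: "smooth_on ?V (\<lambda>z. b (cinv c' z))"
      by (rule smooth_on_cong[OF o(1)]) (simp add: b_def transition_def)
    have 2: "smooth_on ?W (\<lambda>z. b (cinv c' z))"
      by (rule smooth_on_cong[OF o(2) smooth_on_const[of _ 0]]) (use bK in auto)
    have "?V \<union> ?W = cimg c'" using KD by auto
    with smooth_on_Un[OF o 1 2] show ?thesis by simp
  qed
  then have "smooth_fun A UNIV b" by (simp add: smooth_fun_iff)
  moreover have "0 \<le> b y" for y by (simp add: b_def nn)
  moreover have "closure {y. b y \<noteq> 0} \<subseteq> cdom c"
    using closure_minimal[OF _ closed, of "{y. b y \<noteq> 0}"] bK KD by blast
  moreover have "open (cdom c \<inter> cmap c -` ball ?a e)"
    using chart_homeomorphism[OF c] open_cdom[OF c]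
    by (intro continuous_open_preimage) (auto simp: homeomorphism_def)
  moreover have "x \<in> cdom c \<inter> cmap c -` ball ?a e" using x e(1) by simp
  moreover have "0 < b y" if "y \<in> cdom c \<inter> cmap c -` ball ?a e" for y
    using that pos by (simp add: b_def)
  ultimately show thesis by (rule that)
qed

text \<open>Several of the finitely many bump functions may belong to one chart; they are added up, because a
  partition of unity is indexed by charts here.\<close>

lemma partition_of_unity_exists: "\<exists>F \<rho>. partition_of_unity A F \<rho>"
proof -
  define P where "P = (\<lambda>x (c, b :: 'x \<Rightarrow> real, U). c \<in> A \<and> smooth_fun A UNIV b \<and> (\<forall>y. 0 \<le> b y) \<and>
    closure {y. b y \<noteq> 0} \<subseteq> cdom c \<and> open U \<and> x \<in> U \<and> (\<forall>y\<in>U. 0 < b y))"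
  have "\<exists>t. P x t" for x
  proof -
    obtain c where c: "c \<in> A" "x \<in> cdom c" using charts_cover by blast
    obtain b :: "'x \<Rightarrow> real" and U where "smooth_fun A UNIV b" "\<And>y. 0 \<le> b y" "closure {y. b y \<noteq> 0} \<subseteq> cdom c"
      "open U" "x \<in> U" "\<And>y. y \<in> U \<Longrightarrow> (0::real) < b y"
      by (rule chart_bump_function[OF c]) (rule that)
    then have "P x (c, b, U)" using c(1) by (simp add: P_def)
    then show ?thesis by blast
  qed
  then obtain t where t: "\<And>x. P x (t x)" by metis
  define c b U where "c = (\<lambda>x. fst (t x))" and "b = (\<lambda>x. fst (snd (t x)))" and "U = (\<lambda>x. snd (snd (t x)))"
  have t': "c x \<in> A \<and> smooth_fun A UNIV (b x) \<and> (\<forall>y. 0 \<le> b x y) \<and>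
    closure {y. b x y \<noteq> 0} \<subseteq> cdom (c x) \<and> open (U x) \<and> x \<in> U x \<and> (\<forall>y\<in>U x. 0 < b x y)" for x
    using t[of x] by (simp add: P_def c_def b_def U_def split_beta)
  have cA: "\<And>x. c x \<in> A" and bs: "\<And>x. smooth_fun A UNIV (b x)" and b0: "\<And>x y. 0 \<le> b x y"
    and bc: "\<And>x. closure {y. b x y \<noteq> 0} \<subseteq> cdom (c x)"
    and U: "\<And>x. open (U x)" "\<And>x. x \<in> U x" "\<And>x y. y \<in> U x \<Longrightarrow> 0 < b x y"
    using t' by blast+
  obtain X where X: "finite X" "(\<Union>x\<in>X. U x) = UNIV"
  proof -
    have "UNIV \<subseteq> (\<Union>x\<in>UNIV. U x)" using U(2) by blast
    from compactE_image[OF compact_UNIV _ this] U(1) obtain X where "finite X" "UNIV \<subseteq> (\<Union>x\<in>X. U x)" by metis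
    then show thesis using that by blast
  qed
  define s where "s = (\<lambda>y. \<Sum>x\<in>X. b x y)"
  have s: "0 < s y" for y
  proof -
    obtain x where "x \<in> X" "y \<in> U x" using X(2) by blast
    then show ?thesis unfolding s_def using U(3) b0 X(1) by (intro sum_pos2[of X x]) auto
  qed
  define \<rho> where "\<rho> = (\<lambda>d y. (\<Sum>x\<in>{x\<in>X. c x = d}. b x y) * s y powr - 1)"
  have "partition_of_unity A (c ` X) \<rho>"
    unfolding partition_of_unity_def
  proof (intro conjI ballI allI)
    show "finite (c ` X)" "c ` X \<subseteq> A" using X cA by auto
    show "0 \<le> \<rho> d x" for d x by (simp add: \<rho>_def sum_nonneg b0)
    have "(\<Sum>d\<in>c ` X. \<rho> d x) = s x * s x powr - 1" for x
      unfolding \<rho>_def s_def sum_distrib_right[symmetric]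
      using sum.image_gen[OF X(1), of "\<lambda>y. b y x" c] by simp
    then show "(\<Sum>d\<in>c ` X. \<rho> d x) = 1" for x using s[of x] by (simp add: powr_minus)
  next
    fix d
    show "smooth_fun A UNIV (\<rho> d)"
      unfolding smooth_fun_iff
    proof
      fix e assume e: "e \<in> A"
      have *: "smooth_on (cimg e) (\<lambda>z. \<Sum>x\<in>Y. b x (cinv e z))" for Y
        by (rule smooth_on_sum[OF open_cimg[OF e]]) (use bs e in \<open>auto simp: smooth_fun_iff\<close>)
      show "smooth_on (cimg e) (\<lambda>z. \<rho> d (cinv e z))"
        unfolding \<rho>_def
        by (intro smooth_on_mult[OF open_cimg[OF e] *] smooth_on_powr[OF open_cimg[OF e]] s)
          (use *[of X] in \<open>simp add: s_def\<close>)
    qed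
    let ?Y = "{x\<in>X. c x = d}"
    have "closure {x. \<rho> d x \<noteq> 0} \<subseteq> (\<Union>x\<in>?Y. closure {y. b x y \<noteq> 0})"
    proof (rule closure_minimal)
      show "{x. \<rho> d x \<noteq> 0} \<subseteq> (\<Union>x\<in>?Y. closure {y. b x y \<noteq> 0})"
      proof
        fix y assume "y \<in> {x. \<rho> d x \<noteq> 0}"
        then have "(\<Sum>x\<in>?Y. b x y) \<noteq> 0" by (auto simp: \<rho>_def)
        then obtain x where "x \<in> ?Y" "b x y \<noteq> 0" by (meson sum.neutral)
        then show "y \<in> (\<Union>x\<in>?Y. closure {y. b x y \<noteq> 0})" using closure_subset by fast
      qed
    qed (use X(1) in auto)
    then show "closure {x. \<rho> d x \<noteq> 0} \<subseteq> cdom d" using bc by fastforce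
  qed
  then show ?thesis by blast
qed

end

section \<open>Determinants and the change of variables\<close>

definition row_multilinear :: "(real^'n^'n \<Rightarrow> 'b::real_vector) \<Rightarrow> bool" where
  "row_multilinear F \<longleftrightarrow> (\<forall>A i. linear (\<lambda>v. F (\<chi> k. if k = i then v else A $ k)))"

definition row_alternating :: "(real^'n^'n \<Rightarrow> 'b::real_vector) \<Rightarrow> bool" where
  "row_alternating F \<longleftrightarrow> (\<forall>A i j. i \<noteq> j \<longrightarrow> A $ i = A $ j \<longrightarrow> F A = 0)"

lemma row_multilinearD:
  "row_multilinear F \<Longrightarrow> linear (\<lambda>v. F (\<chi> k. if k = i then v else A $ k))"
  by (simp add: row_multilinear_def)

text \<open>Expand \<open>F\<close> with the sum of two rows in both places.\<close>

lemma row_alternating_swap: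
  fixes F :: "real^'n^'n \<Rightarrow> 'b::real_vector"
  assumes lin: "row_multilinear F" and alt: "row_alternating F" and "m \<noteq> n"
  shows "F (\<chi> i. A $ Transposition.transpose m n i) = - F A"
proof -
  define G where "G = (\<lambda>u v. F (\<chi> k. if k = m then u else if k = n then v else A $ k))"
  have e1: "G w v = F (\<chi> k. if k = m then w else (\<chi> k. if k = n then v else A $ k) $ k)" for w v
    unfolding G_def by (intro arg_cong[of _ _ F]) (auto simp: vec_eq_iff)
  have add1: "G (u + u') v = G u v + G u' v" for u u' v
    unfolding e1 by (rule linear_add[OF row_multilinearD[OF lin]])
  have e2: "G u w = F (\<chi> k. if k = n then w else (\<chi> k. if k = m then u else A $ k) $ k)" for u w
    unfolding G_def using \<open>m \<noteq> n\<close> by (intro arg_cong[of _ _ F]) (auto simp: vec_eq_iff)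
  have add2: "G u (v + v') = G u v + G u v'" for u v v'
    unfolding e2 by (rule linear_add[OF row_multilinearD[OF lin]])
  have alt': "G u u = 0" for u
    unfolding G_def by (rule alt[unfolded row_alternating_def, rule_format, OF \<open>m \<noteq> n\<close>]) simp
  have "0 = G (A $ m + A $ n) (A $ m + A $ n)" by (simp add: alt')
  also have "\<dots> = G (A $ m) (A $ n) + G (A $ n) (A $ m)"
    by (simp only: add1 add2) (simp add: alt')
  finally have "G (A $ n) (A $ m) = - G (A $ m) (A $ n)" by (simp add: eq_neg_iff_add_eq_0 add.commute)
  moreover have "(\<chi> k. if k = m then A $ m else if k = n then A $ n else A $ k) = A"
    by (auto simp: vec_eq_iff)
  moreover have "(\<chi> k. if k = m then A $ n else if k = n then A $ m else A $ k) =
      (\<chi> i. A $ Transposition.transpose m n i)"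
    by (auto simp: vec_eq_iff Transposition.transpose_def)
  ultimately show ?thesis by (simp add: G_def)
qed

lemma row_multilinear_diagonal:
  fixes F :: "real^'n^'n \<Rightarrow> 'b::real_vector"
  assumes lin: "row_multilinear F" and diag: "\<And>i j. i \<noteq> j \<Longrightarrow> A $ i $ j = 0"
  shows "F A = (\<Prod>i\<in>UNIV. A $ i $ i) *\<^sub>R F (mat 1)"
proof -
  define B where "B = (\<lambda>K. \<chi> k. if k \<in> K then A $ k $ k *\<^sub>R axis k 1 else (axis k 1 :: real^'n))"
  have "F (B K) = (\<Prod>i\<in>K. A $ i $ i) *\<^sub>R F (B {})" if "finite K" for K
    using that
  proof induction
    case (insert x K)
    have 1: "B (insert x K) = (\<chi> k. if k = x then A $ x $ x *\<^sub>R axis x 1 else B K $ k)"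
      and 2: "B K = (\<chi> k. if k = x then axis x 1 else B K $ k)"
      using insert(2) by (auto simp: B_def vec_eq_iff)
    have "F (B (insert x K)) = A $ x $ x *\<^sub>R F (B K)"
      using row_multilinearD[OF lin, where A = "B K" and i = x, THEN linear_scale, of "A $ x $ x" "axis x 1"] 1 2
      by simp
    then show ?case using insert by simp
  qed simp
  from this[of UNIV] have "F (B UNIV) = (\<Prod>i\<in>UNIV. A $ i $ i) *\<^sub>R F (B {})" by simp
  moreover have "B UNIV = A" using diag by (auto simp: B_def vec_eq_iff axis_def)
  moreover have "B {} = mat 1" by (auto simp: B_def vec_eq_iff axis_def mat_def)
  ultimately show ?thesis by simp
qed

text \<open>The determinant is the only alternating multilinear function of the rows, up to a factor.
  Column operations on the argument turn \<open>F\<close> into another alternating function, so the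
  induction runs over all \<open>F\<close> at once.\<close>

lemma alternating_eq_det:
  fixes F :: "real^'n^'n \<Rightarrow> 'b::real_vector"
  assumes "row_multilinear F" "row_alternating F"
  shows "F A = det A *\<^sub>R F (mat 1)"
proof -
  have "\<forall>F :: real^'n^'n \<Rightarrow> 'b. row_multilinear F \<longrightarrow> row_alternating F \<longrightarrow> F A = det A *\<^sub>R F (mat 1)"
  proof (induction A rule: induct_matrix_row_operations)
    case (1 A i)
    note zero_row = 1
    have "F A = 0" if "row_multilinear F" for F :: "real^'n^'n \<Rightarrow> 'b"
    proof -
      have "A = (\<chi> k. if k = i then 0 else A $ k)" using zero_row by (auto simp: vec_eq_iff row_def)
      then show ?thesis
        using row_multilinearD[OF that, where A = A and i = i, THEN linear_0] by simp
    qed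
    moreover have "det A = 0" using det_zero_row(1)[OF zero_row] .
    ultimately show ?case by simp
  next
    case (2 A)
    then show ?case using row_multilinear_diagonal[of _ A] det_diagonal[of A] by auto
  next
    case (3 A m n)
    note swap_cols = 3
    let ?t = "Transposition.transpose m n"
    show ?case
    proof (intro allI impI)
      fix F :: "real^'n^'n \<Rightarrow> 'b" assume F: "row_multilinear F" "row_alternating F"
      define G where "G = (\<lambda>M :: real^'n^'n. F (\<chi> i j. M $ i $ ?t j))"
      have "row_multilinear G"
        unfolding row_multilinear_def G_def
      proof (intro allI)
        fix B :: "real^'n^'n" and i
        let ?P = "\<lambda>v :: real^'n. \<chi> j. v $ ?t j"
        have eq: "(\<chi> k j. (\<chi> k. if k = i then v else B $ k) $ k $ ?t j) =
            (\<chi> k. if k = i then ?P v else (\<chi> k. ?P (B $ k)) $ k)" for v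
          by (auto simp: vec_eq_iff)
        have "linear ?P" by (rule linearI) (auto simp: vec_eq_iff)
        from linear_compose[OF this row_multilinearD[OF F(1), where A = "\<chi> k. ?P (B $ k)" and i = i]]
        show "linear (\<lambda>v. F (\<chi> k j. (\<chi> k. if k = i then v else B $ k) $ k $ ?t j))"
          unfolding eq o_def .
      qed
      moreover have "row_alternating G"
        using F(2) unfolding row_alternating_def G_def by (auto simp: vec_eq_iff)
      ultimately have "G A = det A *\<^sub>R G (mat 1)" using swap_cols(1) by blast
      moreover have "G (mat 1) = - F (mat 1)"
      proof -
        have "(\<chi> i j. (mat 1 :: real^'n^'n) $ i $ ?t j) = (\<chi> i. mat 1 $ ?t i)"
          by (auto simp: vec_eq_iff mat_def Transposition.transpose_def)
        then show ?thesis using row_alternating_swap[OF F swap_cols(2), of "mat 1"] by (simp add: G_def)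
      qed
      moreover have "det (\<chi> i j. A $ i $ ?t j) = - det A"
        using swap_cols(2) by (simp add: det_permute_columns permutes_swap_id sign_swap_id)
      ultimately show "F (\<chi> i j. A $ i $ ?t j) = det (\<chi> i j. A $ i $ ?t j) *\<^sub>R F (mat 1)"
        by (simp add: G_def)
    qed
  next
    case (4 A m n c)
    note row_op = 4
    show ?case
    proof (intro allI impI)
      fix F :: "real^'n^'n \<Rightarrow> 'b" assume F: "row_multilinear F" "row_alternating F"
      let ?L = "\<lambda>v. F (\<chi> k. if k = m then v else A $ k)"
      have lin: "linear ?L" using F(1) unfolding row_multilinear_def by blast
      have row: "row k A = A $ k" for k by (simp add: row_def)
      have "?L (A $ n) = 0"
        by (rule F(2)[unfolded row_alternating_def, rule_format, OF row_op(2)]) (use row_op(2) in simp)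
      then have "?L (row m A + c *\<^sub>R row n A) = ?L (A $ m)"
        unfolding row by (simp add: linear_add[OF lin] linear_scale[OF lin])
      moreover have "(\<chi> k. if k = m then A $ m else A $ k) = A" by (auto simp: vec_eq_iff)
      moreover have "det (\<chi> i. if i = m then row m A + c *\<^sub>R row n A else row i A) = det A"
        using det_row_operation[OF row_op(2), of A c] unfolding scalar_mult_eq_scaleR .
      moreover have "(\<chi> i. if i = m then row m A + c *\<^sub>R row n A else row i A) =
          (\<chi> i. if i = m then row m A + c *\<^sub>R row n A else A $ i)"
        by (auto simp: vec_eq_iff row_def)
      ultimately show "F (\<chi> i. if i = m then row m A + c *\<^sub>R row n A else row i A) =
          det (\<chi> i. if i = m then row m A + c *\<^sub>R row n A else row i A) *\<^sub>R F (mat 1)"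
        using row_op(1) F by simp
    qed
  qed
  then show ?thesis using assms by blast
qed

definition real4_to_complex2 :: "real^4 \<Rightarrow> complex^2" where
  "real4_to_complex2 x = (\<chi> i. if i = 2 then Complex (x $ 1) (x $ 2) else Complex (x $ 3) (x $ 4))"

definition complex2_to_real4 :: "complex^2 \<Rightarrow> real^4" where
  "complex2_to_real4 z = (\<chi> i. if i = 1 then Re (z $ 2) else if i = 2 then Im (z $ 2)
     else if i = 3 then Re (z $ 1) else Im (z $ 1))"

lemma real4_complex2_inverse:
  "real4_to_complex2 (complex2_to_real4 z) = z" "complex2_to_real4 (real4_to_complex2 x) = x"
  by (auto simp: real4_to_complex2_def complex2_to_real4_def vec_eq_iff forall_2 forall_4)

lemma bounded_linear_real4_to_complex2: "bounded_linear real4_to_complex2"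
  unfolding linear_conv_bounded_linear[symmetric]
  by (rule linearI) (auto simp: real4_to_complex2_def vec_eq_iff complex_eq_iff)

lemma bounded_linear_complex2_to_real4: "bounded_linear complex2_to_real4"
  unfolding linear_conv_bounded_linear[symmetric]
  by (rule linearI) (auto simp: complex2_to_real4_def vec_eq_iff)

text \<open>In the type \<open>2\<close> the numeral 2 equals 0, so the index 2 comes first.\<close>

lemma frame_2: "frame = [axis 2 1, axis 2 \<i>, axis 1 1, axis (1::2) \<i>]"
proof -
  have "(2::2) = 0" by simp
  moreover have "(0::2) < 1" by (simp add: less_bit0_def bit0.Rep_0 bit0.Rep_1)
  ultimately have "(2::2) < 1" by metis
  then have "sorted_list_of_set (UNIV :: 2 set) = [2, 1]"
    unfolding UNIV_2 by (intro sorted_list_of_set.sorted_key_list_of_set_unique[THEN iffD1]) auto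
  then show ?thesis by (simp add: frame_def)
qed

lemma real4_to_complex2_axis:
  "real4_to_complex2 (axis 1 1) = axis 2 1" "real4_to_complex2 (axis 2 1) = axis 2 \<i>"
  "real4_to_complex2 (axis 3 1) = axis 1 1" "real4_to_complex2 (axis 4 1) = axis 1 \<i>"
  by (auto simp: real4_to_complex2_def axis_def vec_eq_iff complex_eq_iff forall_2)

lemma lborel_distr_real4: "distr lborel borel real4_to_complex2 = lborel"
proof (rule lborel_eqI[symmetric])
  have meas: "real4_to_complex2 \<in> borel_measurable borel"
    using bounded_linear.continuous_on[OF bounded_linear_real4_to_complex2 continuous_on_id]
    by (rule borel_measurable_continuous_onI)
  fix l u :: "complex^2" assume le: "\<And>b. b \<in> Basis \<Longrightarrow> l \<bullet> b \<le> u \<bullet> b"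
  have B2: "(Basis :: (complex^2) set) = {axis 1 1, axis 1 \<i>, axis 2 1, axis 2 \<i>}"
    by (auto simp: Basis_vec_def Basis_complex_def UNIV_2)
  have B4: "(Basis :: (real^4) set) = {axis 1 1, axis 2 1, axis 3 1, axis 4 1}"
    by (auto simp: Basis_vec_def UNIV_4)
  have eq: "real4_to_complex2 -` box l u = box (complex2_to_real4 l) (complex2_to_real4 u)"
    by (auto simp: box_def B2 B4 inner_axis real4_to_complex2_def complex2_to_real4_def)
  have "emeasure (distr lborel borel real4_to_complex2) (box l u) =
      emeasure lborel (box (complex2_to_real4 l) (complex2_to_real4 u))"
    using meas by (simp add: emeasure_distr eq)
  also have "\<dots> = (\<Prod>b\<in>Basis. (complex2_to_real4 u - complex2_to_real4 l) \<bullet> b)"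
    using le[of "axis 1 1"] le[of "axis 1 \<i>"] le[of "axis 2 1"] le[of "axis 2 \<i>"]
    by (subst emeasure_lborel_box) (auto simp: B2 B4 inner_axis complex2_to_real4_def)
  also have "(\<Prod>b\<in>Basis. (complex2_to_real4 u - complex2_to_real4 l) \<bullet> b) = (\<Prod>b\<in>Basis. (u - l) \<bullet> b)"
    by (simp add: B2 B4 inner_axis complex2_to_real4_def axis_eq_axis)
  finally show "emeasure (distr lborel borel real4_to_complex2) (box l u) = ennreal (\<Prod>b\<in>Basis. (u - l) \<bullet> b)" .
qed simp

text \<open>Transfer to \<open>real^4\<close>, where the change of variables theorem and the determinant live.\<close>

lemma set_integral_real4:
  fixes f :: "complex^2 \<Rightarrow> complex"
  assumes S: "open S" and f: "continuous_on S f"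
  defines "S' \<equiv> real4_to_complex2 -` S"
  shows "set_integrable lborel S f \<longleftrightarrow> (\<lambda>x. f (real4_to_complex2 x)) absolutely_integrable_on S'"
    and "set_integrable lborel S f \<Longrightarrow> set_lebesgue_integral lborel S f = integral S' (\<lambda>x. f (real4_to_complex2 x))"
proof -
  let ?T = real4_to_complex2
  have meas: "?T \<in> borel_measurable borel"
    using bounded_linear.continuous_on[OF bounded_linear_real4_to_complex2 continuous_on_id]
    by (rule borel_measurable_continuous_onI)
  have mf: "(\<lambda>x. indicator S x *\<^sub>R f x) \<in> borel_measurable borel"
    by (rule borel_measurable_continuous_on_indicator) (use S f in auto)
  have ind: "indicator S (?T x) *\<^sub>R f (?T x) = indicator S' x *\<^sub>R f (?T x)" for x
    by (simp add: S'_def indicator_def)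
  have mf': "(\<lambda>x. indicator S' x *\<^sub>R f (?T x)) \<in> borel_measurable borel"
    using measurable_compose[OF meas mf] by (simp add: ind)
  show 1: "set_integrable lborel S f \<longleftrightarrow> (\<lambda>x. f (?T x)) absolutely_integrable_on S'"
  proof -
    have "set_integrable lborel S f \<longleftrightarrow> integrable (distr lborel borel ?T) (\<lambda>x. indicator S x *\<^sub>R f x)"
      by (simp add: set_integrable_def lborel_distr_real4)
    also have "\<dots> \<longleftrightarrow> integrable lborel (\<lambda>x. indicator S' x *\<^sub>R f (?T x))"
      by (subst integrable_distr_eq) (use meas mf in \<open>auto simp: ind\<close>)
    also have "\<dots> \<longleftrightarrow> integrable lebesgue (\<lambda>x. indicator S' x *\<^sub>R f (?T x))"
      by (subst integrable_completion) (use mf' in auto)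
    finally show ?thesis by (simp add: set_integrable_def)
  qed
  assume "set_integrable lborel S f"
  then have int: "(\<lambda>x. f (?T x)) absolutely_integrable_on S'" using 1 by simp
  have "set_lebesgue_integral lborel S f = integral\<^sup>L (distr lborel borel ?T) (\<lambda>x. indicator S x *\<^sub>R f x)"
    by (simp add: set_lebesgue_integral_def lborel_distr_real4)
  also have "\<dots> = integral\<^sup>L lborel (\<lambda>x. indicator S' x *\<^sub>R f (?T x))"
    by (subst integral_distr) (use meas mf in \<open>auto simp: ind\<close>)
  also have "\<dots> = integral\<^sup>L lebesgue (\<lambda>x. indicator S' x *\<^sub>R f (?T x))"
    by (subst integral_completion) (use mf' in auto)
  also have "\<dots> = integral S' (\<lambda>x. f (?T x))"
    using set_lebesgue_integral_eq_integral(2)[OF int] by (simp add: set_lebesgue_integral_def)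
  finally show "set_lebesgue_integral lborel S f = integral S' (\<lambda>x. f (?T x))" .
qed

text \<open>The real and imaginary parts are handled together as a vector in \<open>real^2\<close>.\<close>

lemma complex_change_of_variables:
  fixes f :: "real^'m::{finite,wellorder} \<Rightarrow> complex"
  assumes S: "S \<in> sets lebesgue"
    and der: "\<And>x. x \<in> S \<Longrightarrow> (g has_derivative g' x) (at x within S)" and inj: "inj_on g S"
    and int: "(\<lambda>x. \<bar>det (matrix (g' x))\<bar> *\<^sub>R f (g x)) absolutely_integrable_on S"
  shows "f absolutely_integrable_on g ` S"
    and "integral (g ` S) f = integral S (\<lambda>x. \<bar>det (matrix (g' x))\<bar> *\<^sub>R f (g x))"
proof -
  define L :: "complex \<Rightarrow> real^2" where "L = (\<lambda>c. \<chi> i. if i = 1 then Re c else Im c)"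
  define L' :: "real^2 \<Rightarrow> complex" where "L' = (\<lambda>v. Complex (v $ 1) (v $ 2))"
  have L: "bounded_linear L" and L': "bounded_linear L'"
    unfolding linear_conv_bounded_linear[symmetric]
    by (rule linearI; auto simp: L_def L'_def vec_eq_iff complex_eq_iff)+
  have inv: "L' (L c) = c" for c by (simp add: L_def L'_def)
  have 1: "(\<lambda>x. \<bar>det (matrix (g' x))\<bar> *\<^sub>R L (f (g x))) absolutely_integrable_on S"
    using absolutely_integrable_linear[OF int L] by (simp add: o_def linear_simps[OF L])
  then have 2: "(\<lambda>y. L (f y)) absolutely_integrable_on g ` S"
    and 3: "integral (g ` S) (\<lambda>y. L (f y)) = integral S (\<lambda>x. \<bar>det (matrix (g' x))\<bar> *\<^sub>R L (f (g x)))"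
    using has_absolute_integral_change_of_variables[OF S der inj, of "\<lambda>y. L (f y)"] by auto
  from absolutely_integrable_linear[OF 2 L'] show 4: "f absolutely_integrable_on g ` S"
    by (simp add: o_def inv)
  have "integral (g ` S) f = L' (integral (g ` S) (\<lambda>y. L (f y)))"
    using integral_linear[OF set_lebesgue_integral_eq_integral(1)[OF 2] L'] by (simp add: o_def inv)
  also have "\<dots> = L' (L (integral S (\<lambda>x. \<bar>det (matrix (g' x))\<bar> *\<^sub>R f (g x))))"
    unfolding 3 using integral_linear[OF set_lebesgue_integral_eq_integral(1)[OF int] L]
    by (simp add: o_def linear_simps[OF L])
  finally show "integral (g ` S) f = integral S (\<lambda>x. \<bar>det (matrix (g' x))\<bar> *\<^sub>R f (g x))" by (simp add: inv)
qed

text \<open>Read on \<open>real^4\<close>, a 4-form is an alternating function of the rows of a matrix.\<close>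

lemma alternating_form_det:
  fixes a :: "(complex^2) list \<Rightarrow> complex" and L :: "complex^2 \<Rightarrow> complex^2"
  assumes a: "alternating_multilinear 4 a" and L: "linear L"
  shows "a (map L frame) = det (matrix (\<lambda>x. complex2_to_real4 (L (real4_to_complex2 x)))) *\<^sub>R a frame"
proof -
  let ?T = real4_to_complex2
  define F where "F = (\<lambda>M :: real^4^4. a [?T (M $ 1), ?T (M $ 2), ?T (M $ 3), ?T (M $ 4)])"
  have linT: "linear ?T" using bounded_linear_real4_to_complex2 by (simp add: linear_conv_bounded_linear)
  have lin: "linear (\<lambda>v. a (vs[i := v]))" if "length vs = 4" "i < 4" for vs i
    using a that unfolding alternating_multilinear_def by blast
  have alt: "a vs = 0" if "length vs = 4" "i < j" "j < 4" "vs ! i = vs ! j" for vs i j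
    using a that unfolding alternating_multilinear_def by blast
  have "linear (\<lambda>v. F (\<chi> k. if k = i then v else A $ k))" for A i
  proof -
    let ?vs = "[?T (A $ 1), ?T (A $ 2), ?T (A $ 3), ?T (A $ 4)]"
    have "\<exists>p<4. \<forall>v. F (\<chi> k. if k = i then v else A $ k) = a (?vs[p := ?T v])"
      using exhaust_4[of i] by (elim disjE; simp add: F_def)
        (force intro: exI[of _ "0::nat"] exI[of _ "1::nat"] exI[of _ "2::nat"] exI[of _ "3::nat"] simp: numeral_2_eq_2 numeral_3_eq_3)+
    then obtain p where p: "p < 4" "\<And>v. F (\<chi> k. if k = i then v else A $ k) = a (?vs[p := ?T v])" by blast
    have "linear ((\<lambda>v. a (?vs[p := v])) \<circ> ?T)"
      by (rule linear_compose[OF linT lin]) (use p(1) in auto)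
    then show ?thesis by (simp add: p(2) o_def)
  qed
  then have "row_multilinear F" by (simp add: row_multilinear_def)
  moreover have "row_alternating F"
    unfolding row_alternating_def
  proof (intro allI impI)
    fix A :: "real^4^4" and i j assume ij: "i \<noteq> j" "A $ i = A $ j"
    let ?vs = "[?T (A $ 1), ?T (A $ 2), ?T (A $ 3), ?T (A $ 4)]"
    have "\<exists>p q. p < q \<and> q < 4 \<and> ?vs ! p = ?vs ! q"
    proof -
      have "(0::nat) < 1" "(1::nat) < 4" by auto
      then show ?thesis using exhaust_4[of i] exhaust_4[of j] ij
        by (elim disjE; simp)
          (rule exI[of _ "0::nat"] exI[of _ "1::nat"] exI[of _ "2::nat"],
            rule exI[of _ "1::nat"] exI[of _ "2::nat"] exI[of _ "3::nat"], simp add: numeral_2_eq_2 numeral_3_eq_3; fail)+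
    qed
    then show "F A = 0" unfolding F_def using alt[of ?vs] by auto
  qed
  ultimately have det: "F A = det A *\<^sub>R F (mat 1)" for A by (rule alternating_eq_det)
  have row: "(mat 1 :: real^4^4) $ k = axis k 1" for k by (simp add: mat_def axis_def vec_eq_iff)
  have F1: "F (mat 1) = a frame"
    by (simp add: F_def frame_2 row real4_to_complex2_axis)
  let ?g = "\<lambda>x. complex2_to_real4 (L (?T x))"
  have "?T (transpose (matrix ?g) $ k) = L (?T (axis k 1))" for k
  proof -
    have "transpose (matrix ?g) $ k = ?g (axis k 1)"
      by (simp add: transpose_def matrix_def vec_eq_iff)
    then show ?thesis by (simp add: real4_complex2_inverse)
  qed
  then have "F (transpose (matrix ?g)) = a (map L frame)"
    by (simp add: F_def frame_2 real4_to_complex2_axis)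
  then show ?thesis using det[of "transpose (matrix ?g)"] F1 by simp
qed

text \<open>Change of variables for densities that transform like 4-forms. The form \<open>m'\<close> plays the role
  of a volume form and fixes the sign of the Jacobian.\<close>

lemma change_of_variables_forms:
  fixes \<phi> :: "complex^2 \<Rightarrow> complex^2" and a b :: "complex^2 \<Rightarrow> (complex^2) list \<Rightarrow> complex"
  assumes S: "open S" "open (\<phi> ` S)" and inj: "inj_on \<phi> S"
    and der: "\<And>z. z \<in> S \<Longrightarrow> (\<phi> has_derivative \<phi>' z) (at z)"
    and b: "\<And>z. z \<in> S \<Longrightarrow> alternating_multilinear 4 (b (\<phi> z))"
    and trans: "\<And>z. z \<in> S \<Longrightarrow> b (\<phi> z) (map (\<phi>' z) frame) = a z frame"
    and m': "\<And>z. z \<in> S \<Longrightarrow> alternating_multilinear 4 (m' (\<phi> z))"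
    and mtrans: "\<And>z. z \<in> S \<Longrightarrow> m' (\<phi> z) (map (\<phi>' z) frame) = complex_of_real (m z)"
    and pos: "\<And>z. z \<in> S \<Longrightarrow> 0 < m z" "\<And>z. z \<in> S \<Longrightarrow> 0 < Re (m' (\<phi> z) frame)"
    and cont: "continuous_on S (\<lambda>z. a z frame)" "continuous_on (\<phi> ` S) (\<lambda>w. b w frame)"
    and int: "set_integrable lborel S (\<lambda>z. a z frame)"
  shows "set_lebesgue_integral lborel (\<phi> ` S) (\<lambda>w. b w frame) = set_lebesgue_integral lborel S (\<lambda>z. a z frame)"
proof -
  let ?T = real4_to_complex2 and ?R = complex2_to_real4
  define S4 where "S4 = ?T -` S"
  define g where "g = (\<lambda>x. ?R (\<phi> (?T x)))"
  define g' where "g' = (\<lambda>x v. ?R (\<phi>' (?T x) (?T v)))"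
  have cT: "continuous_on UNIV ?T"
    using bounded_linear.continuous_on[OF bounded_linear_real4_to_complex2 continuous_on_id] .
  have lin: "linear (\<phi>' z)" if "z \<in> S" for z using der[OF that] has_derivative_linear by blast
  have open4: "open S4" unfolding S4_def using cT S(1) by (simp add: continuous_open_vimage continuous_on_eq_continuous_at open_vimage)
  have dg: "(g has_derivative g' x) (at x within S4)" if "x \<in> S4" for x
  proof -
    have "(\<phi> has_derivative \<phi>' (?T x)) (at (?T x))" using der that by (simp add: S4_def)
    from has_derivative_compose[OF bounded_linear_imp_has_derivative[OF bounded_linear_real4_to_complex2] this]
    have "((\<lambda>x. \<phi> (?T x)) has_derivative (\<lambda>v. \<phi>' (?T x) (?T v))) (at x)" .
    from bounded_linear.has_derivative[OF bounded_linear_complex2_to_real4 this]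
    show ?thesis unfolding g_def g'_def by (rule has_derivative_at_withinI)
  qed
  have ig: "inj_on g S4"
    using inj unfolding inj_on_def g_def S4_def by (metis real4_complex2_inverse vimageD)
  have im: "g ` S4 = ?T -` (\<phi> ` S)"
  proof (intro equalityI subsetI)
    fix x assume "x \<in> ?T -` (\<phi> ` S)"
    then obtain z where "z \<in> S" "?T x = \<phi> z" by auto
    then show "x \<in> g ` S4"
      unfolding g_def S4_def by (intro image_eqI[of _ _ "?R z"]) (auto simp: real4_complex2_inverse dest: sym)
  qed (auto simp: g_def S4_def real4_complex2_inverse)
  have J: "\<bar>det (matrix (g' x))\<bar> *\<^sub>R b (\<phi> (?T x)) frame = a (?T x) frame" if "x \<in> S4" for x
  proof -
    let ?z = "?T x"
    have z: "?z \<in> S" using that by (simp add: S4_def)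
    have "det (matrix (g' x)) *\<^sub>R m' (\<phi> ?z) frame = complex_of_real (m ?z)"
      using alternating_form_det[OF m'[OF z] lin[OF z]] mtrans[OF z] by (simp add: g'_def)
    then have "det (matrix (g' x)) * Re (m' (\<phi> ?z) frame) = m ?z" by (metis Re_complex_of_real scaleR_complex.simps(1))
    then have "0 < det (matrix (g' x))" using pos[OF z] by (metis zero_less_mult_pos2)
    then show ?thesis using alternating_form_det[OF b[OF z] lin[OF z]] trans[OF z] by (simp add: g'_def)
  qed
  have Tg: "?T (g x) = \<phi> (?T x)" for x by (simp add: g_def real4_complex2_inverse)
  have "(\<lambda>x. a (?T x) frame) absolutely_integrable_on S4"
    using int set_integral_real4(1)[OF S(1) cont(1)] by (simp add: S4_def)
  then have int4: "(\<lambda>x. \<bar>det (matrix (g' x))\<bar> *\<^sub>R b (?T (g x)) frame) absolutely_integrable_on S4"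
    unfolding Tg by (subst set_integrable_cong[OF refl refl J])
  have S4: "S4 \<in> sets lebesgue" using open4 by (simp add: borel_open sets_completionI_sets)
  note cv = complex_change_of_variables[OF S4 dg ig int4]
  have "set_integrable lborel (\<phi> ` S) (\<lambda>w. b w frame)"
    using set_integral_real4(1)[OF S(2) cont(2)] cv(1) by (simp add: im)
  then have "set_lebesgue_integral lborel (\<phi> ` S) (\<lambda>w. b w frame) = integral (g ` S4) (\<lambda>x. b (?T x) frame)"
    using set_integral_real4(2)[OF S(2) cont(2)] by (simp add: im)
  also have "\<dots> = integral S4 (\<lambda>x. \<bar>det (matrix (g' x))\<bar> *\<^sub>R b (\<phi> (?T x)) frame)"
    using cv(2) by (simp add: Tg)
  also have "\<dots> = integral S4 (\<lambda>x. a (?T x) frame)"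
    by (rule integral_cong) (rule J)
  also have "\<dots> = set_lebesgue_integral lborel S (\<lambda>z. a z frame)"
    using set_integral_real4(2)[OF S(1) cont(1) int] by (simp add: S4_def)
  finally show ?thesis .
qed

section \<open>Wedge products of 2-forms\<close>

lemma sum_permutations_4:
  fixes f :: "nat \<Rightarrow> nat \<Rightarrow> nat \<Rightarrow> nat \<Rightarrow> complex"
  shows "(\<Sum>s | s permutes {..<4::nat}. of_int (sign s) * f (s 0) (s 1) (s 2) (s 3)) =
    f 0 1 2 3 - f 0 1 3 2 - f 0 2 1 3 + f 0 2 3 1 + f 0 3 1 2 - f 0 3 2 1
    - f 1 0 2 3 + f 1 0 3 2 + f 1 2 0 3 - f 1 2 3 0 - f 1 3 0 2 + f 1 3 2 0
    + f 2 0 1 3 - f 2 0 3 1 - f 2 1 0 3 + f 2 1 3 0 + f 2 3 0 1 - f 2 3 1 0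
    - f 3 0 1 2 + f 3 0 2 1 + f 3 1 0 2 - f 3 1 2 0 - f 3 2 0 1 + f 3 2 1 0"
proof -
  have set: "{..<4::nat} = insert 0 (insert 1 (insert 2 {3}))" by auto
  have f: "finite {1, 2, 3::nat}" "0 \<notin> {1, 2, 3::nat}" "finite {2, 3::nat}" "1 \<notin> {2, 3::nat}"
    "finite {3::nat}" "2 \<notin> {3::nat}" by auto
  show ?thesis
    unfolding set sum_over_permutations_insert[OF f(1,2)] sum_over_permutations_insert[OF f(3,4)]
      sum_over_permutations_insert[OF f(5,6)] permutes_sing
    by (simp add: sign_swap_id permutation_swap_id permutation_compose sign_compose sign_id Transposition.transpose_def)
qed

lemma sum_permutations_2:
  fixes f :: "nat \<Rightarrow> nat \<Rightarrow> complex"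
  shows "(\<Sum>s | s permutes {..<2::nat}. of_int (sign s) * f (s 0) (s 1)) = f 0 1 - f 1 0"
proof -
  have set: "{..<2::nat} = insert 0 {1}" by auto
  have f: "finite {1::nat}" "0 \<notin> {1::nat}" by auto
  show ?thesis
    unfolding set sum_over_permutations_insert[OF f] permutes_sing
    by (simp add: sign_swap_id sign_id Transposition.transpose_def)
qed

lemma alternating_1:
  fixes a :: "(complex^'n) list \<Rightarrow> complex"
  assumes "alternating_multilinear 1 a"
  shows "linear (\<lambda>v. a [v])"
proof -
  have "linear (\<lambda>v. a ([0][0 := v]))"
    using assms unfolding alternating_multilinear_def by (metis length_Cons list.size(3) One_nat_def zero_less_one)
  then show ?thesis by simp
qed

lemma alternating_2:
  fixes a :: "(complex^'n) list \<Rightarrow> complex"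
  assumes "alternating_multilinear 2 a"
  shows "linear (\<lambda>v. a [v, w])" "linear (\<lambda>w. a [v, w])" "a [v, v] = 0" "a [w, v] = - a [v, w]"
proof -
  have l: "length [v, w] = 2" for v w :: "complex^'n" by simp
  have lin: "linear (\<lambda>u. a ([v, w][i := u]))" if "i < 2" for v w i
    using assms that unfolding alternating_multilinear_def using l by blast
  show 1: "linear (\<lambda>v. a [v, w])" for w using lin[of 0 w w] by simp
  show 2: "linear (\<lambda>w. a [v, w])" for v using lin[of 1 v v] by simp
  have alt: "a vs = 0" if "length vs = 2" "vs ! 0 = vs ! 1" for vs
    using assms that unfolding alternating_multilinear_def by (metis one_less_numeral_iff semiring_norm(76) zero_less_one)
  then show 3: "a [v, v] = 0" for v by simp
  have "a [v + w, v + w] = a [v, v] + a [v, w] + (a [w, v] + a [w, w])"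
    by (simp only: linear_add[OF 1] linear_add[OF 2]) simp
  then show "a [w, v] = - a [v, w]" using 3 by (simp add: eq_neg_iff_add_eq_0 add.commute)
qed

lemma alternating_2I:
  fixes a :: "(complex^'n) list \<Rightarrow> complex"
  assumes "\<And>w. linear (\<lambda>v. a [v, w])" "\<And>v. linear (\<lambda>w. a [v, w])" "\<And>v. a [v, v] = 0"
  shows "alternating_multilinear 2 a"
  unfolding alternating_multilinear_def
proof (intro conjI allI impI)
  fix vs :: "(complex^'n) list" and i :: nat assume "length vs = 2" "i < 2"
  then obtain v w where "vs = [v, w]" by (auto simp: length_Suc_conv numeral_2_eq_2)
  moreover have "i = 0 \<or> i = 1" using \<open>i < 2\<close> by auto
  ultimately show "linear (\<lambda>u. a (vs[i := u]))" using assms(1,2) by auto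
next
  fix vs :: "(complex^'n) list" and i j :: nat assume "length vs = 2" "i < j" "j < 2" "vs ! i = vs ! j"
  then have "i = 0" "j = 1" by auto
  moreover obtain v w where "vs = [v, w]" using \<open>length vs = 2\<close> by (auto simp: length_Suc_conv numeral_2_eq_2)
  ultimately show "a vs = 0" using assms(3) \<open>vs ! i = vs ! j\<close> by auto
qed

text \<open>The wedge product of two 2-forms, as the sum over the six shuffles.\<close>

definition wedge22 :: "((complex^'n) list \<Rightarrow> complex) \<Rightarrow> ((complex^'n) list \<Rightarrow> complex) \<Rightarrow> (complex^'n) list \<Rightarrow> complex" where
  "wedge22 a b vs =
     a [vs ! 0, vs ! 1] * b [vs ! 2, vs ! 3] - a [vs ! 0, vs ! 2] * b [vs ! 1, vs ! 3]
   + a [vs ! 0, vs ! 3] * b [vs ! 1, vs ! 2] + a [vs ! 1, vs ! 2] * b [vs ! 0, vs ! 3]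
   - a [vs ! 1, vs ! 3] * b [vs ! 0, vs ! 2] + a [vs ! 2, vs ! 3] * b [vs ! 0, vs ! 1]"

text \<open>The 24 permutations fall into six classes of four equal terms, which the factor \<open>2! 2!\<close> removes.\<close>

lemma wedge_2_2:
  fixes \<alpha> \<beta> :: "('x, 'n::finite) dform"
  assumes a: "alternating_multilinear 2 (\<alpha> c z)" and b: "alternating_multilinear 2 (\<beta> c z)" and vs: "length vs = 4"
  shows "wedge 2 2 \<alpha> \<beta> c z vs = wedge22 (\<alpha> c z) (\<beta> c z) vs"
proof -
  obtain p q r s where vs': "vs = [p, q, r, s]" using vs by (auto simp: length_Suc_conv numeral_eq_Suc)
  have nth: "vs ! 0 = p" "vs ! 1 = q" "vs ! 2 = r" "vs ! 3 = s" by (auto simp: vs' numeral_eq_Suc)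
  have m: "map (\<lambda>i. vs ! s i) [0..<2] = [vs ! s 0, vs ! s 1]"
    "map (\<lambda>i. vs ! s i) [2..<4] = [vs ! s 2, vs ! s 3]" for s
    by (simp_all add: upt_rec)
  have "wedge 2 2 \<alpha> \<beta> c z vs = (\<Sum>s | s permutes {..<4}. of_int (sign s) *
        (\<alpha> c z [vs ! s 0, vs ! s 1] * \<beta> c z [vs ! s 2, vs ! s 3])) / 4"
    using vs by (simp add: wedge_def m mult.assoc fact_numeral)
  also have "\<dots> = wedge22 (\<alpha> c z) (\<beta> c z) vs"
    unfolding sum_permutations_4[of "\<lambda>i j k l. \<alpha> c z [vs ! i, vs ! j] * \<beta> c z [vs ! k, vs ! l]"]
      wedge22_def nth
    by (simp add: alternating_2(4)[OF a, where w = q and v = p]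
      alternating_2(4)[OF a, where w = r and v = p]
      alternating_2(4)[OF a, where w = r and v = q]
      alternating_2(4)[OF a, where w = s and v = p]
      alternating_2(4)[OF a, where w = s and v = q]
      alternating_2(4)[OF a, where w = s and v = r]
      alternating_2(4)[OF b, where w = q and v = p]
      alternating_2(4)[OF b, where w = r and v = p]
      alternating_2(4)[OF b, where w = r and v = q]
      alternating_2(4)[OF b, where w = s and v = p]
      alternating_2(4)[OF b, where w = s and v = q]
      alternating_2(4)[OF b, where w = s and v = r])
  finally show ?thesis .
qed

lemma less_4_nat: "(i::nat) < 4 \<Longrightarrow> i = 0 \<or> i = 1 \<or> i = 2 \<or> i = 3"
  by auto

lemma wedge22_alternating:
  fixes a b :: "(complex^'n) list \<Rightarrow> complex"
  assumes a: "alternating_multilinear 2 a" and b: "alternating_multilinear 2 b"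
  shows "alternating_multilinear 4 (wedge22 a b)"
  unfolding alternating_multilinear_def
proof (intro conjI allI impI)
  fix vs :: "(complex^'n) list" and i :: nat assume "length vs = 4" "i < 4"
  then obtain p q r s where vs: "vs = [p, q, r, s]" by (auto simp: length_Suc_conv numeral_eq_Suc)
  have mult: "linear (\<lambda>u. f u * k)" "linear (\<lambda>u. k * f u)" if "linear f" for f :: "complex^'n \<Rightarrow> complex" and k
    using linear_compose[OF that, of "\<lambda>x. x * k"] linear_compose[OF that, of "\<lambda>x. k * x"]
    by (auto simp: o_def linear_conv_bounded_linear bounded_linear_mult_left bounded_linear_mult_right)
  have "linear (\<lambda>u. wedge22 a b [u, q, r, s])" "linear (\<lambda>u. wedge22 a b [p, u, r, s])"
    "linear (\<lambda>u. wedge22 a b [p, q, u, s])" "linear (\<lambda>u. wedge22 a b [p, q, r, u])"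
    unfolding wedge22_def by (simp; intro linear_compose_add linear_compose_sub mult alternating_2[OF a] alternating_2[OF b])+
  then show "linear (\<lambda>u. wedge22 a b (vs[i := u]))"
    using less_4_nat[OF \<open>i < 4\<close>] vs by (auto simp: numeral_eq_Suc)
next
  fix vs :: "(complex^'n) list" and i j :: nat assume *: "length vs = 4" "i < j" "j < 4" "vs ! i = vs ! j"
  then obtain p q r s where vs: "vs = [p, q, r, s]" by (auto simp: length_Suc_conv numeral_eq_Suc)
  have nth: "vs ! 0 = p" "vs ! 1 = q" "vs ! Suc 0 = q" "vs ! 2 = r" "vs ! 3 = s" by (auto simp: vs numeral_eq_Suc)
  consider "i = 0" "j = 1" | "i = 0" "j = 2" | "i = 0" "j = 3" | "i = 1" "j = 2" | "i = 1" "j = 3" | "i = 2" "j = 3"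
    using *(2,3) less_4_nat[of i] less_4_nat[of j] by fastforce
  then show "wedge22 a b vs = 0"
    using *(4) unfolding wedge22_def nth
    by cases (simp_all add: nth alternating_2(3)[OF a] alternating_2(3)[OF b]
      alternating_2(4)[OF a, where w = q and v = p]
      alternating_2(4)[OF a, where w = r and v = p]
      alternating_2(4)[OF a, where w = r and v = q]
      alternating_2(4)[OF a, where w = s and v = p]
      alternating_2(4)[OF a, where w = s and v = q]
      alternating_2(4)[OF a, where w = s and v = r]
      alternating_2(4)[OF b, where w = q and v = p]
      alternating_2(4)[OF b, where w = r and v = p]
      alternating_2(4)[OF b, where w = r and v = q]
      alternating_2(4)[OF b, where w = s and v = p]
      alternating_2(4)[OF b, where w = s and v = q]
      alternating_2(4)[OF b, where w = s and v = r])
qed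

text \<open>By translation invariance the difference quotients have integral 0, and they converge
  boundedly to the directional derivative.\<close>

lemma integral_directional_derivative:
  fixes g :: "'a::euclidean_space \<Rightarrow> complex"
  assumes K: "compact K" and D: "\<And>z. (g has_derivative D z) (at z)" and cont: "continuous_on UNIV (\<lambda>z. D z v)"
    and zero: "\<And>z. z \<notin> K \<Longrightarrow> g z = 0"
  shows "integral\<^sup>L lborel (\<lambda>z. D z v) = 0"
proof -
  have lin: "linear (D z)" for z using D has_derivative_linear by blast
  have Dzero: "D z v = 0" if "z \<notin> K" for z
  proof -
    have "((\<lambda>z. 0) has_derivative (\<lambda>v. 0)) (at z)" by simp
    then have "(g has_derivative (\<lambda>v. 0)) (at z)"
      by (rule has_derivative_transform_within_open[of _ _ _ _ "- K"])
        (use that zero K compact_imp_closed in \<open>auto simp: open_Compl\<close>)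
    then show ?thesis using has_derivative_unique[OF D] by metis
  qed
  have "compact ((\<lambda>z. D z v) ` K)" using cont K by (intro compact_continuous_image) (auto intro: continuous_on_subset)
  then obtain C where C: "\<And>z. z \<in> K \<Longrightarrow> norm (D z v) \<le> C" "0 \<le> C"
    using compact_imp_bounded bounded_pos by (metis imageI less_imp_le)
  then have C': "norm (D z v) \<le> C" for z using Dzero by (cases "z \<in> K") auto
  define t where "t = (\<lambda>n. inverse (real (Suc n)))"
  define q where "q = (\<lambda>n z. inverse (t n) *\<^sub>R (g (z + t n *\<^sub>R v) - g z))"
  have t: "0 < t n" "t n \<le> 1" for n by (auto simp: t_def field_simps)
  have cg: "continuous_on UNIV g"
    by (intro continuous_at_imp_continuous_on ballI has_derivative_continuous[OF D])
  have ig: "integrable lborel g"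
  proof -
    have "integrable lborel (\<lambda>z. indicator K z *\<^sub>R g z)"
      by (rule borel_integrable_compact[OF K]) (use cg continuous_on_subset in blast)
    moreover have "(\<lambda>z. indicator K z *\<^sub>R g z) = g" using zero by (auto simp: indicator_def fun_eq_iff)
    ultimately show ?thesis by simp
  qed
  have plus: "distr lborel borel (\<lambda>z. w + z) = (lborel :: 'a measure)" for w
    by (rule lborel_distr_plus)
  have shift: "integrable lborel (\<lambda>z. g (w + z))" "integral\<^sup>L lborel (\<lambda>z. g (w + z)) = integral\<^sup>L lborel g" for w
  proof -
    have m: "(\<lambda>z. w + z) \<in> measurable lborel borel" "g \<in> borel_measurable borel"
      using ig by (auto simp: borel_measurable_integrable)
    show "integrable lborel (\<lambda>z. g (w + z))"
      using integrable_distr_eq[OF m] ig unfolding plus by simp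
    show "integral\<^sup>L lborel (\<lambda>z. g (w + z)) = integral\<^sup>L lborel g"
      using integral_distr[OF m] unfolding plus by simp
  qed
  have iq: "integral\<^sup>L lborel (q n) = 0" for n
    using shift[of "t n *\<^sub>R v"] ig unfolding q_def by (simp add: add.commute Bochner_Integration.integral_diff)
  \<comment> \<open>All difference quotients with steps in \<open>{0..1}\<close> are supported in \<open>K'\<close>, which dominates them.\<close>
  define K' where "K' = (\<lambda>(x, s). x - s *\<^sub>R v) ` (K \<times> {0..1::real})"
  have "compact K'" unfolding K'_def split_beta
    by (intro compact_continuous_image compact_Times K compact_Icc continuous_intros)
  have line: "((\<lambda>s. g (z + s *\<^sub>R v)) has_derivative (\<lambda>h. h *\<^sub>R D (z + s *\<^sub>R v) v)) (at s)" for z s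
  proof -
    have "((\<lambda>s. z + s *\<^sub>R v) has_derivative (\<lambda>h. h *\<^sub>R v)) (at s)" by (auto intro!: derivative_eq_intros)
    from has_derivative_compose[OF this D] show ?thesis by (simp add: linear_scale[OF lin])
  qed
  have bound: "norm (q n z) \<le> C * indicator K' z" for n z
  proof (cases "z \<in> K'")
    case True
    have "norm (g (z + t n *\<^sub>R v) - g (z + 0 *\<^sub>R v)) \<le> C * norm (t n - 0)"
    proof (rule differentiable_bound[of UNIV "\<lambda>s. g (z + s *\<^sub>R v)" "\<lambda>s h. h *\<^sub>R D (z + s *\<^sub>R v) v"])
      show "onorm (\<lambda>h. h *\<^sub>R D (z + s *\<^sub>R v) v) \<le> C" for s
        by (rule onorm_le) (use C' in \<open>simp add: mult.commute[of C] mult_left_mono\<close>)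
    qed (use line in auto)
    then have "norm (g (z + t n *\<^sub>R v) - g z) \<le> C * t n" using t(1)[of n] by simp
    then have "inverse (t n) * norm (g (z + t n *\<^sub>R v) - g z) \<le> C" using t(1)[of n] by (simp add: divide_simps)
    then show ?thesis using t(1)[of n] True by (simp add: q_def)
  next
    case False
    have "z \<notin> K" using False unfolding K'_def by (force intro: image_eqI[of _ _ "(z, 0)"])
    moreover have "z + t n *\<^sub>R v \<notin> K"
    proof
      assume "z + t n *\<^sub>R v \<in> K"
      then have "z \<in> K'" unfolding K'_def using t[of n] by (intro image_eqI[of _ _ "(z + t n *\<^sub>R v, t n)"]) auto
      with False show False ..
    qed
    ultimately show ?thesis using zero False by (simp add: q_def)
  qed
  have lim: "(\<lambda>n. q n z) \<longlonglongrightarrow> D z v" for z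
  proof -
    have "((\<lambda>s. ((g (z + s *\<^sub>R v) - g (z + 0 *\<^sub>R v)) - (s - 0) *\<^sub>R D (z + 0 *\<^sub>R v) v) /\<^sub>R norm (s - 0)) \<longlongrightarrow> 0) (at 0)"
      using line[of z 0] unfolding has_derivative_at_within by simp
    moreover have "filterlim t (at 0) sequentially"
      unfolding filterlim_at using LIMSEQ_inverse_real_of_nat t(1) by (auto simp: t_def[abs_def] less_imp_neq[symmetric])
    ultimately have "(\<lambda>n. ((g (z + t n *\<^sub>R v) - g (z + 0 *\<^sub>R v)) - (t n - 0) *\<^sub>R D (z + 0 *\<^sub>R v) v) /\<^sub>R norm (t n - 0)) \<longlonglongrightarrow> 0"
      by (rule filterlim_compose)
    moreover have "((g (z + t n *\<^sub>R v) - g (z + 0 *\<^sub>R v)) - (t n - 0) *\<^sub>R D (z + 0 *\<^sub>R v) v) /\<^sub>R norm (t n - 0) = q n z - D z v" for n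
      using t(1)[of n] by (simp add: q_def scaleR_diff_right)
    ultimately have "(\<lambda>n. q n z - D z v) \<longlonglongrightarrow> 0" by simp
    then show ?thesis by (rule LIM_zero_cancel)
  qed
  have "(\<lambda>n. integral\<^sup>L lborel (q n)) \<longlonglongrightarrow> integral\<^sup>L lborel (\<lambda>z. D z v)"
  proof (rule integral_dominated_convergence[where w = "\<lambda>z. C * indicator K' z"])
    show "(\<lambda>z. D z v) \<in> borel_measurable lborel"
      using cont by (simp add: borel_measurable_continuous_onI)
    show "q n \<in> borel_measurable lborel" for n
    proof -
      have "continuous_on UNIV (q n)"
        unfolding q_def by (intro continuous_intros continuous_on_compose2[OF cg]) auto
      then show ?thesis by (simp add: borel_measurable_continuous_onI)
    qed
    show "integrable lborel (\<lambda>z. C * indicator K' z)"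
      using \<open>compact K'\<close> by (intro integrable_mult_right integrable_real_indicator) (auto simp: emeasure_compact_finite[unfolded infinity_ennreal_def] borel_compact)
  qed (use lim bound in auto)
  then show ?thesis using iq by (simp add: LIMSEQ_const_iff)
qed

lemma integral_directional_derivative_on:
  fixes g :: "'a::euclidean_space \<Rightarrow> complex"
  assumes U: "open U" and K: "compact K" "K \<subseteq> U" and g: "Ck_on 1 U g" and zero: "\<And>z. z \<in> U \<Longrightarrow> z \<notin> K \<Longrightarrow> g z = 0"
  shows "set_integrable lborel U (\<lambda>z. frechet_derivative g (at z) v)"
    and "set_lebesgue_integral lborel U (\<lambda>z. frechet_derivative g (at z) v) = 0"
proof -
  let ?g' = "\<lambda>z. frechet_derivative g (at z)"
  define h where "h = (\<lambda>z. if z \<in> U then g z else 0)"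
  define D where "D = (\<lambda>z. if z \<in> U then ?g' z else (\<lambda>v. 0))"
  have oK: "open (- K)" using K by (simp add: compact_imp_closed open_Compl)
  have Dh: "(h has_derivative D z) (at z)" for z
  proof (cases "z \<in> U")
    case True
    have "(g has_derivative ?g' z) (at z)" using Ck_on_Suc_has_derivative[of 0 U g z] g True by simp
    then have "(h has_derivative ?g' z) (at z)"
      by (rule has_derivative_transform_within_open[OF _ U True]) (simp add: h_def)
    then show ?thesis using True by (simp add: D_def)
  next
    case False
    have "((\<lambda>z. 0) has_derivative (\<lambda>v. 0)) (at z)" by simp
    then have "(h has_derivative (\<lambda>v. 0)) (at z)"
      by (rule has_derivative_transform_within_open[OF _ oK]) (use False K zero in \<open>auto simp: h_def\<close>)
    then show ?thesis using False by (simp add: D_def)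
  qed
  have D0: "D z v = 0" if "z \<notin> K" for z
  proof -
    have "((\<lambda>z. 0) has_derivative (\<lambda>v. 0)) (at z)" by simp
    then have "(h has_derivative (\<lambda>v. 0)) (at z)"
      by (rule has_derivative_transform_within_open[OF _ oK]) (use that K zero in \<open>auto simp: h_def\<close>)
    then show ?thesis using has_derivative_unique[OF Dh] by metis
  qed
  have cU: "continuous_on U (\<lambda>z. ?g' z v)" using g by simp
  have "continuous_on (U \<union> - K) (\<lambda>z. D z v)"
  proof (rule continuous_on_open_Un[OF U oK])
    show "continuous_on U (\<lambda>z. D z v)" by (rule continuous_on_eq[OF cU]) (simp add: D_def)
    show "continuous_on (- K) (\<lambda>z. D z v)" by (rule continuous_on_eq[OF continuous_on_const[of _ 0]]) (simp add: D0)
  qed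
  moreover have "U \<union> - K = UNIV" using K by blast
  ultimately have cont: "continuous_on UNIV (\<lambda>z. D z v)" by simp
  have h0: "h z = 0" if "z \<notin> K" for z using that zero by (simp add: h_def)
  have eq: "(\<lambda>z. indicator U z *\<^sub>R ?g' z v) = (\<lambda>z. D z v)" by (auto simp: D_def)
  show "set_lebesgue_integral lborel U (\<lambda>z. ?g' z v) = 0"
    unfolding set_lebesgue_integral_def eq by (rule integral_directional_derivative[OF K(1) Dh cont h0])
  have "integrable lborel (\<lambda>z. indicator K z *\<^sub>R D z v)"
    by (rule borel_integrable_compact[OF K(1)]) (use cont continuous_on_subset in blast)
  moreover have "(\<lambda>z. indicator K z *\<^sub>R D z v) = (\<lambda>z. D z v)" using D0 by (auto simp: indicator_def fun_eq_iff)
  ultimately show "set_integrable lborel U (\<lambda>z. ?g' z v)" unfolding set_integrable_def eq by simp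
qed

section \<open>Stokes' theorem\<close>

lemma is_form_alternating: "is_form A k \<alpha> \<Longrightarrow> c \<in> A \<Longrightarrow> z \<in> cimg c \<Longrightarrow> alternating_multilinear k (\<alpha> c z)"
  and is_form_smooth: "is_form A k \<alpha> \<Longrightarrow> c \<in> A \<Longrightarrow> length vs = k \<Longrightarrow> smooth_on (cimg c) (\<lambda>z. \<alpha> c z vs)"
  and is_form_outside: "is_form A k \<alpha> \<Longrightarrow> c \<notin> A \<or> z \<notin> cimg c \<or> length vs \<noteq> k \<Longrightarrow> \<alpha> c z vs = 0"
  unfolding is_form_def by blast+

lemma local_d_1: "local_d \<beta> z [v, w] =
    frechet_derivative (\<lambda>y. \<beta> y [w]) (at z) v - frechet_derivative (\<lambda>y. \<beta> y [v]) (at z) w"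
  by (simp add: local_d_def drop_nth_def numeral_2_eq_2)

lemma local_d_2: "local_d \<beta> z [u, v, w] = frechet_derivative (\<lambda>y. \<beta> y [v, w]) (at z) u
    - frechet_derivative (\<lambda>y. \<beta> y [u, w]) (at z) v + frechet_derivative (\<lambda>y. \<beta> y [u, v]) (at z) w"
  by (simp add: local_d_def drop_nth_def numeral_3_eq_3)

lemma wedge22_map:
  assumes "length vs = 4" "\<And>v w. a' [J v, J w] = a [v, w]" "\<And>v w. b' [J v, J w] = b [v, w]"
  shows "wedge22 a' b' (map J vs) = wedge22 a b vs"
  using assms by (simp add: wedge22_def)

text \<open>The wedge product of a 1-form and a 2-form, as the sum over the three shuffles.\<close>

definition wedge12 :: "((complex^'n) list \<Rightarrow> complex) \<Rightarrow> ((complex^'n) list \<Rightarrow> complex) \<Rightarrow> (complex^'n) list \<Rightarrow> complex" where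
  "wedge12 a b vs =
     a [vs ! 0] * b [vs ! 1, vs ! 2] - a [vs ! 1] * b [vs ! 0, vs ! 2] + a [vs ! 2] * b [vs ! 0, vs ! 1]"

lemma local_d_3: "local_d \<beta> z [p, q, r, s] = frechet_derivative (\<lambda>y. \<beta> y [q, r, s]) (at z) p
    - frechet_derivative (\<lambda>y. \<beta> y [p, r, s]) (at z) q + frechet_derivative (\<lambda>y. \<beta> y [p, q, s]) (at z) r
    - frechet_derivative (\<lambda>y. \<beta> y [p, q, r]) (at z) s"
  by (simp add: local_d_def drop_nth_def numeral_eq_Suc)

lemma frechet_derivative_mult:
  fixes f g :: "'a::real_normed_vector \<Rightarrow> complex"
  assumes "f differentiable (at z)" "g differentiable (at z)"
  shows "frechet_derivative (\<lambda>z. f z * g z) (at z) x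
    = f z * frechet_derivative g (at z) x + frechet_derivative f (at z) x * g z"
  using fun_cong[OF frechet_derivative_at[OF has_derivative_mult], of f _ z g _ x] assms
  by (simp add: frechet_derivative_works)

lemma frechet_derivative_add_diff:
  assumes "f differentiable (at z)" "g differentiable (at z)"
  shows "frechet_derivative (\<lambda>z. f z + g z) (at z) x = frechet_derivative f (at z) x + frechet_derivative g (at z) x"
    and "frechet_derivative (\<lambda>z. f z - g z) (at z) x = frechet_derivative f (at z) x - frechet_derivative g (at z) x"
  using fun_cong[OF frechet_derivative_at[OF has_derivative_add], of f _ z g _ x]
    fun_cong[OF frechet_derivative_at[OF has_derivative_diff], of f _ z g _ x] assms
  by (simp_all add: frechet_derivative_works)

lemma frechet_derivative_wedge12:
  fixes \<beta> \<Psi> :: "complex^'n \<Rightarrow> (complex^'n) list \<Rightarrow> complex"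
  assumes "\<And>v. (\<lambda>z. \<beta> z [v]) differentiable (at z)" "\<And>v w. (\<lambda>z. \<Psi> z [v, w]) differentiable (at z)"
  shows "frechet_derivative (\<lambda>z. wedge12 (\<beta> z) (\<Psi> z) [a, b, c]) (at z) x =
      (\<beta> z [a] * frechet_derivative (\<lambda>z. \<Psi> z [b, c]) (at z) x + frechet_derivative (\<lambda>z. \<beta> z [a]) (at z) x * \<Psi> z [b, c])
    - (\<beta> z [b] * frechet_derivative (\<lambda>z. \<Psi> z [a, c]) (at z) x + frechet_derivative (\<lambda>z. \<beta> z [b]) (at z) x * \<Psi> z [a, c])
    + (\<beta> z [c] * frechet_derivative (\<lambda>z. \<Psi> z [a, b]) (at z) x + frechet_derivative (\<lambda>z. \<beta> z [c]) (at z) x * \<Psi> z [a, b])"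
proof -
  have "(\<lambda>z. \<beta> z [a] * \<Psi> z [b, c]) differentiable (at z)" for a b c
    using assms by (intro differentiable_mult)
  then show ?thesis
    by (simp add: wedge12_def numeral_2_eq_2 frechet_derivative_add_diff frechet_derivative_mult assms)
qed

text \<open>\<open>d(\<beta> \<and> \<Psi>) = d\<beta> \<and> \<Psi> - \<beta> \<and> d\<Psi>\<close>, and the last term vanishes.\<close>

lemma local_d_wedge12:
  fixes \<beta> \<Psi> :: "complex^'n \<Rightarrow> (complex^'n) list \<Rightarrow> complex"
  assumes diff: "\<And>v. (\<lambda>z. \<beta> z [v]) differentiable (at z)" "\<And>v w. (\<lambda>z. \<Psi> z [v, w]) differentiable (at z)"
    and closed: "\<And>u v w. local_d \<Psi> z [u, v, w] = 0"
  shows "local_d (\<lambda>z. wedge12 (\<beta> z) (\<Psi> z)) z [p, q, r, s] = wedge22 (local_d \<beta> z) (\<Psi> z) [p, q, r, s]"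
proof -
  let ?d = "\<lambda>x b c. frechet_derivative (\<lambda>z. \<Psi> z [b, c]) (at z) x"
  have c: "?d a b c = ?d b a c - ?d c a b" for a b c
    using closed[of a b c] unfolding local_d_2 by (simp add: algebra_simps)
  show ?thesis
    unfolding local_d_3 wedge22_def local_d_1 frechet_derivative_wedge12[where \<beta> = \<beta> and \<Psi> = \<Psi> and z = z, OF diff]
    by (simp add: numeral_eq_Suc c[where a = p and b = r and c = s] c[where a = p and b = q and c = s]
        c[where a = p and b = q and c = r] c[where a = q and b = r and c = s] algebra_simps)
qed

text \<open>In a chart \<open>d\<beta> \<and> \<Psi> = d(\<beta> \<and> \<Psi>)\<close> for closed \<open>\<Psi>\<close>, and the right-hand side is a
  sum of directional derivatives of compactly supported functions.\<close>

lemma local_stokes: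
  fixes \<beta> \<Psi> :: "complex^'n \<Rightarrow> (complex^'n) list \<Rightarrow> complex"
  assumes U: "open U" and K: "compact K" "K \<subseteq> U"
    and \<beta>: "\<And>v. Ck_on 1 U (\<lambda>z. \<beta> z [v])" and zero: "\<And>z v. z \<in> U \<Longrightarrow> z \<notin> K \<Longrightarrow> \<beta> z [v] = 0"
    and \<Psi>: "\<And>v w. Ck_on 1 U (\<lambda>z. \<Psi> z [v, w])" and closed: "\<And>z u v w. z \<in> U \<Longrightarrow> local_d \<Psi> z [u, v, w] = 0"
    and vs: "length vs = 4"
  shows "set_integrable lborel U (\<lambda>z. wedge22 (local_d \<beta> z) (\<Psi> z) vs)"
    and "set_lebesgue_integral lborel U (\<lambda>z. wedge22 (local_d \<beta> z) (\<Psi> z) vs) = 0"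
proof -
  obtain p q r s where vs': "vs = [p, q, r, s]" using vs by (auto simp: length_Suc_conv numeral_eq_Suc)
  define T where "T = (\<lambda>x a b c z. frechet_derivative (\<lambda>z. wedge12 (\<beta> z) (\<Psi> z) [a, b, c]) (at z) x)"
  have prod: "Ck_on 1 U (\<lambda>z. \<beta> z [a] * \<Psi> z [b, c])" for a b c
    using Ck_on_bilinear[OF bounded_bilinear_mult U \<beta> \<Psi>] .
  have C1: "Ck_on 1 U (\<lambda>z. wedge12 (\<beta> z) (\<Psi> z) [a, b, c])" for a b c
  proof -
    have "Ck_on 1 U (\<lambda>z. (\<beta> z [a] * \<Psi> z [b, c] + (- 1) * (\<beta> z [b] * \<Psi> z [a, c])) + \<beta> z [c] * \<Psi> z [a, b])"
      by (intro Ck_on_add[OF U] prod Ck_on_bilinear[OF bounded_bilinear_mult U Ck_on_const prod])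
    then show ?thesis by (simp add: wedge12_def numeral_2_eq_2)
  qed
  have int: "set_integrable lborel U (T x a b c)" "set_lebesgue_integral lborel U (T x a b c) = 0" for x a b c
    unfolding T_def using integral_directional_derivative_on[OF U K C1] zero by (auto simp: wedge12_def)
  let ?S = "\<lambda>z. T p q r s z - T q p r s z + T r p q s z - T s p q r z"
  have eq: "wedge22 (local_d \<beta> z) (\<Psi> z) vs = ?S z" if z: "z \<in> U" for z
  proof -
    have "(\<lambda>z. \<beta> z [v]) differentiable (at z)" "(\<lambda>z. \<Psi> z [v, w]) differentiable (at z)" for v w
      using \<beta> \<Psi> z by auto
    from local_d_wedge12[where \<beta> = \<beta> and \<Psi> = \<Psi> and z = z, OF this closed[OF z]] show ?thesis unfolding vs' local_d_3 T_def by simp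
  qed
  have intS: "set_integrable lborel U ?S" by (intro set_integral_add(1) set_integral_diff(1) int(1))
  show "set_integrable lborel U (\<lambda>z. wedge22 (local_d \<beta> z) (\<Psi> z) vs)"
  proof -
    have "set_integrable lborel U (\<lambda>z. wedge22 (local_d \<beta> z) (\<Psi> z) vs) \<longleftrightarrow> set_integrable lborel U ?S"
      by (rule set_integrable_cong[OF refl refl eq])
    then show ?thesis using intS by simp
  qed
  have "set_lebesgue_integral lborel U (\<lambda>z. wedge22 (local_d \<beta> z) (\<Psi> z) vs) = set_lebesgue_integral lborel U ?S"
    by (rule set_lebesgue_integral_cong) (use U eq in auto)
  also have "\<dots> = 0"
    by (simp add: set_integral_add set_integral_diff int(1) int(2))
  finally show "set_lebesgue_integral lborel U (\<lambda>z. wedge22 (local_d \<beta> z) (\<Psi> z) vs) = 0" .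
qed

context atlas
begin

definition overlap :: "('x, 'n) chart \<Rightarrow> ('x, 'n) chart \<Rightarrow> (complex^'n) set" where
  "overlap c c' = {z \<in> cimg c. cinv c z \<in> cdom c'}"

lemma overlap_image: "c \<in> A \<Longrightarrow> cmap c ` (cdom c \<inter> cdom c') = overlap c c'"
  using chart_image_eq[of c "cdom c'"] by (simp add: Int_commute overlap_def)

lemma open_overlap: "c \<in> A \<Longrightarrow> c' \<in> A \<Longrightarrow> open (overlap c c')"
  unfolding overlap_def by (intro open_chart_image open_cdom)

lemma transition_overlap:
  assumes "c \<in> A" "c' \<in> A" "z \<in> overlap c c'"
  shows "transition c c' z \<in> overlap c' c" "cinv c' (transition c c' z) = cinv c z"
    "transition c' c (transition c c' z) = z"
  using assms by (auto simp: overlap_def transition_def cmap_in_cimg cinv_cmap cinv_in_cdom cmap_cinv)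

lemma transition_image: "c \<in> A \<Longrightarrow> c' \<in> A \<Longrightarrow> transition c c' ` overlap c c' = overlap c' c"
  using transition_overlap[of c c'] transition_overlap[of c' c] by force

lemma transition_inj: "c \<in> A \<Longrightarrow> c' \<in> A \<Longrightarrow> inj_on (transition c c') (overlap c c')"
  using transition_overlap(3) by (metis inj_onI)

lemma jac_derivative:
  assumes "c \<in> A" "c' \<in> A" "z \<in> overlap c c'"
  shows "(transition c c' has_derivative jac c c' z) (at z)" "jac c c' z (a *s v) = a *s jac c c' z v"
  using vec_holo_on_has_derivative[OF open_overlap[OF assms(1,2)] _ assms(3)]
    transition_holo[OF assms(1,2)] overlap_image[OF assms(1)]
  by (simp_all add: jac_def)

lemma is_form_transition:
  assumes "is_form A k \<alpha>" "c \<in> A" "c' \<in> A" "z \<in> overlap c c'" "length vs = k"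
  shows "\<alpha> c' (transition c c' z) (map (jac c c' z) vs) = \<alpha> c z vs"
  using assms overlap_image[of c c'] unfolding is_form_def by blast

lemma chain_rule_transition:
  assumes "c \<in> A" "c' \<in> A" "z \<in> overlap c c'" "smooth_on (cimg c') (\<lambda>w. g (cinv c' w))"
  shows "frechet_derivative (\<lambda>z. g (cinv c z)) (at z) v
    = frechet_derivative (\<lambda>w. g (cinv c' w)) (at (transition c c' z)) (jac c c' z v)"
proof -
  let ?\<phi> = "transition c c'"
  have "((\<lambda>w. g (cinv c' w)) has_derivative frechet_derivative (\<lambda>w. g (cinv c' w)) (at (?\<phi> z))) (at (?\<phi> z))"
    using smooth_on_has_derivative[OF assms(4)] transition_overlap(1)[OF assms(1-3)] by (simp add: overlap_def)
  from has_derivative_compose[OF jac_derivative(1)[OF assms(1-3)] this]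
  have "((\<lambda>z. g (cinv c z)) has_derivative
      (\<lambda>v. frechet_derivative (\<lambda>w. g (cinv c' w)) (at (?\<phi> z)) (jac c c' z v))) (at z)"
    by (rule has_derivative_transform_within_open[OF _ open_overlap[OF assms(1,2)] assms(3)])
      (simp add: transition_overlap(2)[OF assms(1,2)])
  then show ?thesis using frechet_derivative_at by metis
qed

lemma continuous_on_chart: "c \<in> A \<Longrightarrow> continuous_on UNIV g \<Longrightarrow> continuous_on (cimg c) (\<lambda>z. g (cinv c z))"
  using chart_homeomorphism[of c] by (auto simp: homeomorphism_def intro: continuous_on_compose2)

lemma chart_integrable:
  fixes f :: "complex^'n \<Rightarrow> complex"
  assumes c: "c \<in> A" and f: "continuous_on (cimg c) f" and C: "closed C" "C \<subseteq> cdom c"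
    and zero: "\<And>z. z \<in> cimg c \<Longrightarrow> cinv c z \<notin> C \<Longrightarrow> f z = 0"
  shows "set_integrable lborel (cimg c) f" "compact (cmap c ` C)" "cmap c ` C \<subseteq> cimg c"
    "\<And>z. z \<in> cimg c \<Longrightarrow> z \<notin> cmap c ` C \<Longrightarrow> cinv c z \<notin> C"
proof -
  have "compact C" using compact_Int_closed[OF compact_UNIV C(1)] by simp
  then show K: "compact (cmap c ` C)"
    using chart_homeomorphism[OF c] C(2)
    by (intro compact_continuous_image) (auto simp: homeomorphism_def intro: continuous_on_subset)
  show sub: "cmap c ` C \<subseteq> cimg c" using C(2) by (blast intro: cmap_in_cimg)
  show out: "cinv c z \<notin> C" if "z \<in> cimg c" "z \<notin> cmap c ` C" for z
    using that cmap_cinv[OF c] by (metis imageI)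
  have "integrable lborel (\<lambda>z. indicator (cmap c ` C) z *\<^sub>R f z)"
    by (rule borel_integrable_compact[OF K]) (use f sub continuous_on_subset in blast)
  moreover have "(\<lambda>z. indicator (cmap c ` C) z *\<^sub>R f z) = (\<lambda>z. indicator (cimg c) z *\<^sub>R f z)"
    using zero out sub by (auto simp: indicator_def fun_eq_iff)
  ultimately show "set_integrable lborel (cimg c) f" unfolding set_integrable_def by simp
qed

end

text \<open>The 2-form \<open>dg \<and> \<alpha>\<close>.\<close>

definition dwedge :: "('x \<Rightarrow> real) \<Rightarrow> ('x, 'n::finite) dform \<Rightarrow> ('x, 'n) dform" where
  "dwedge g \<alpha> c z vs =
     frechet_derivative (\<lambda>y. complex_of_real (g (cinv c y))) (at z) (vs ! 0) * \<alpha> c z [vs ! 1]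
   - frechet_derivative (\<lambda>y. complex_of_real (g (cinv c y))) (at z) (vs ! 1) * \<alpha> c z [vs ! 0]"

lemma length_frame_2: "length (frame :: (complex^2) list) = 4"
  by (simp add: frame_2)

lemma alternating_scale: "alternating_multilinear k a \<Longrightarrow> alternating_multilinear k (\<lambda>vs. x * a vs)"
  unfolding alternating_multilinear_def
proof (intro conjI allI impI)
  assume a: "(\<forall>vs i. length vs = k \<longrightarrow> i < k \<longrightarrow> linear (\<lambda>v. a (vs[i := v]))) \<and>
    (\<forall>vs i j. length vs = k \<longrightarrow> i < j \<longrightarrow> j < k \<longrightarrow> vs ! i = vs ! j \<longrightarrow> a vs = 0)"
  show "x * a vs = 0" if "length vs = k" "i < j" "j < k" "vs ! i = vs ! j" for vs i j
    using a that by simp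
  show "linear (\<lambda>v. x * a (vs[i := v]))" if "length vs = k" "i < k" for vs i
  proof -
    have "linear (\<lambda>v. a (vs[i := v]))" using a that by blast
    moreover have "linear (\<lambda>y. x * y)" by (simp add: linear_conv_bounded_linear bounded_linear_mult_right)
    ultimately show ?thesis using linear_compose by (force simp: o_def)
  qed
qed

locale surface = atlas A for A :: "('x::t2_space, 2) chart set" +
  fixes \<mu> :: "('x, 2) dform"
  assumes volume: "volume_form A \<mu>"
begin

text \<open>Continuous 4-forms. The value on the frame determines the form at a point, so continuity and the
  transformation law are imposed on that value only.\<close>

definition top_density :: "('x, 2) dform \<Rightarrow> bool" where
  "top_density \<Theta> \<longleftrightarrow> (\<forall>c\<in>A. continuous_on (cimg c) (\<lambda>z. \<Theta> c z frame)) \<and>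
     (\<forall>c\<in>A. \<forall>z\<in>cimg c. alternating_multilinear 4 (\<Theta> c z)) \<and>
     (\<forall>c\<in>A. \<forall>c'\<in>A. \<forall>z\<in>overlap c c'.
        \<Theta> c' (transition c c' z) (map (jac c c' z) frame) = \<Theta> c z frame)"

lemma is_form_top_density: "is_form A 4 \<Theta> \<Longrightarrow> top_density \<Theta>"
  unfolding top_density_def
  by (intro conjI ballI is_form_transition is_form_alternating smooth_on_continuous is_form_smooth) (simp_all add: length_frame_2)

lemma volume_is_form: "is_form A 4 \<mu>"
  and volume_real: "\<mu> c z vs \<in> \<real>"
  and volume_pos: "c \<in> A \<Longrightarrow> z \<in> cimg c \<Longrightarrow> 0 < Re (\<mu> c z frame)"
  using volume unfolding volume_form_def real_form_def by (simp, blast, blast)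

lemma top_density_mult:
  assumes "continuous_on UNIV \<sigma>" "top_density \<Theta>"
  shows "top_density (\<lambda>c z vs. complex_of_real (\<sigma> (cinv c z)) * \<Theta> c z vs)"
  unfolding top_density_def
proof (intro conjI ballI)
  fix c assume c: "c \<in> A"
  show "continuous_on (cimg c) (\<lambda>z. complex_of_real (\<sigma> (cinv c z)) * \<Theta> c z frame)"
    using assms(2) c unfolding top_density_def
    by (intro continuous_on_mult continuous_on_of_real continuous_on_chart[OF c assms(1)]) blast
  show "alternating_multilinear 4 (\<lambda>vs. complex_of_real (\<sigma> (cinv c z)) * \<Theta> c z vs)" if "z \<in> cimg c" for z
    using assms(2) c that unfolding top_density_def by (intro alternating_scale) blast
next
  fix c c' z assume "c \<in> A" "c' \<in> A" "z \<in> overlap c c'"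
  then show "complex_of_real (\<sigma> (cinv c' (transition c c' z))) * \<Theta> c' (transition c c' z) (map (jac c c' z) frame)
      = complex_of_real (\<sigma> (cinv c z)) * \<Theta> c z frame"
    using assms(2) unfolding top_density_def by (simp add: transition_overlap(2))
qed

text \<open>The volume form makes the Jacobian determinant positive, so no absolute value remains.\<close>

lemma integral_transfer:
  assumes c: "c \<in> A" and c': "c' \<in> A" and \<Theta>: "top_density \<Theta>"
    and out: "\<And>z. z \<in> cimg c \<Longrightarrow> z \<notin> overlap c c' \<Longrightarrow> \<Theta> c z frame = 0"
      "\<And>z. z \<in> cimg c' \<Longrightarrow> z \<notin> overlap c' c \<Longrightarrow> \<Theta> c' z frame = 0"
    and int: "set_integrable lborel (cimg c) (\<lambda>z. \<Theta> c z frame)"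
  shows "set_lebesgue_integral lborel (cimg c) (\<lambda>z. \<Theta> c z frame)
    = set_lebesgue_integral lborel (cimg c') (\<lambda>z. \<Theta> c' z frame)"
proof -
  let ?\<phi> = "transition c c'"
  have sub: "overlap c c' \<subseteq> cimg c" "overlap c' c \<subseteq> cimg c'" by (auto simp: overlap_def)
  have restr: "(\<lambda>z. indicator (cimg c) z *\<^sub>R \<Theta> c z frame) = (\<lambda>z. indicator (overlap c c') z *\<^sub>R \<Theta> c z frame)"
    "(\<lambda>z. indicator (cimg c') z *\<^sub>R \<Theta> c' z frame) = (\<lambda>z. indicator (overlap c' c) z *\<^sub>R \<Theta> c' z frame)"
    using out sub by (auto simp: indicator_def fun_eq_iff)
  have cont: "continuous_on (overlap c c') (\<lambda>z. \<Theta> c z frame)" "continuous_on (overlap c' c) (\<lambda>z. \<Theta> c' z frame)"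
    using \<Theta> c c' sub unfolding top_density_def by (blast intro: continuous_on_subset)+
  note im = transition_image[OF c c']
  have mem: "?\<phi> z \<in> cimg c'" "z \<in> cimg c" if "z \<in> overlap c c'" for z
    using transition_overlap(1)[OF c c' that] that by (auto simp: overlap_def)
  have "set_lebesgue_integral lborel (?\<phi> ` overlap c c') (\<lambda>z. \<Theta> c' z frame)
      = set_lebesgue_integral lborel (overlap c c') (\<lambda>z. \<Theta> c z frame)"
  proof (rule change_of_variables_forms[where \<phi>' = "jac c c'" and m' = "\<mu> c'" and m = "\<lambda>z. Re (\<mu> c z frame)"])
    show "open (overlap c c')" "open (?\<phi> ` overlap c c')" using open_overlap c c' im by auto
    show "inj_on ?\<phi> (overlap c c')" by (rule transition_inj[OF c c'])
    show "set_integrable lborel (overlap c c') (\<lambda>z. \<Theta> c z frame)"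
      using int unfolding set_integrable_def restr .
    show "continuous_on (?\<phi> ` overlap c c') (\<lambda>w. \<Theta> c' w frame)" using cont(2) im by simp
    show "continuous_on (overlap c c') (\<lambda>w. \<Theta> c w frame)" by (rule cont(1))
    fix z assume z: "z \<in> overlap c c'"
    show "(?\<phi> has_derivative jac c c' z) (at z)" by (rule jac_derivative[OF c c' z])
    show "alternating_multilinear 4 (\<Theta> c' (?\<phi> z))" using \<Theta> c' mem[OF z] unfolding top_density_def by blast
    show "\<Theta> c' (?\<phi> z) (map (jac c c' z) frame) = \<Theta> c z frame"
      using \<Theta> c c' z unfolding top_density_def by blast
    show "alternating_multilinear 4 (\<mu> c' (?\<phi> z))" using is_form_alternating[OF volume_is_form c' mem(1)[OF z]] .
    show "\<mu> c' (?\<phi> z) (map (jac c c' z) frame) = complex_of_real (Re (\<mu> c z frame))"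
      using is_form_transition[OF volume_is_form c c' z length_frame_2] volume_real by simp
    show "0 < Re (\<mu> c z frame)" "0 < Re (\<mu> c' (?\<phi> z) frame)"
      using volume_pos c c' mem[OF z] by auto
  qed
  then show ?thesis
    unfolding im set_lebesgue_integral_def restr by simp
qed

lemma smooth_fun_chart_of_real:
  "smooth_fun A UNIV g \<Longrightarrow> c \<in> A \<Longrightarrow> smooth_on (cimg c) (\<lambda>z. complex_of_real (g (cinv c z)))"
  using smooth_on_of_real[OF open_cimg] by (simp add: smooth_fun_iff)

lemma dwedge_alternating:
  assumes g: "smooth_fun A UNIV g" and \<alpha>: "is_form A 1 \<alpha>" and c: "c \<in> A" "z \<in> cimg c"
  shows "alternating_multilinear 2 (dwedge g \<alpha> c z)"
proof (rule alternating_2I)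
  have 1: "linear (\<lambda>v. \<alpha> c z [v])" using alternating_1[OF is_form_alternating[OF \<alpha> c]] .
  have 2: "linear (frechet_derivative (\<lambda>y. complex_of_real (g (cinv c y))) (at z))"
    using smooth_on_has_derivative[OF smooth_fun_chart_of_real[OF g c(1)] c(2)] has_derivative_linear by blast
  have mult: "linear (\<lambda>u. f u * k)" "linear (\<lambda>u. k * f u)" if "linear f" for f :: "complex^2 \<Rightarrow> complex" and k
    using linear_compose[OF that, of "\<lambda>x. x * k"] linear_compose[OF that, of "\<lambda>x. k * x"]
    by (auto simp: o_def linear_conv_bounded_linear bounded_linear_mult_left bounded_linear_mult_right)
  show "linear (\<lambda>v. dwedge g \<alpha> c z [v, w])" "linear (\<lambda>v. dwedge g \<alpha> c z [w, v])" "dwedge g \<alpha> c z [w, w] = 0" for w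
    unfolding dwedge_def by (simp_all add: linear_compose_sub mult 1 2)
qed

lemma dwedge_top_density:
  assumes g: "smooth_fun A UNIV g" and \<alpha>: "is_form A 1 \<alpha>" and \<Psi>: "is_form A 2 \<Psi>"
  shows "top_density (\<lambda>c z. wedge22 (dwedge g \<alpha> c z) (\<Psi> c z))"
  unfolding top_density_def
proof (intro conjI ballI)
  fix c assume c: "c \<in> A"
  have 1: "continuous_on (cimg c) (\<lambda>z. dwedge g \<alpha> c z [v, w])" for v w
    unfolding dwedge_def
    by (intro continuous_on_diff continuous_on_mult smooth_on_continuous smooth_on_derivative
        smooth_fun_chart_of_real[OF g c] is_form_smooth[OF \<alpha> c]) auto
  have 2: "continuous_on (cimg c) (\<lambda>z. \<Psi> c z [v, w])" for v w
    by (intro smooth_on_continuous is_form_smooth[OF \<Psi> c]) auto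
  show "continuous_on (cimg c) (\<lambda>z. wedge22 (dwedge g \<alpha> c z) (\<Psi> c z) frame)"
    unfolding wedge22_def by (intro continuous_on_add continuous_on_diff continuous_on_mult 1 2)
  fix z assume "z \<in> cimg c"
  then show "alternating_multilinear 4 (wedge22 (dwedge g \<alpha> c z) (\<Psi> c z))"
    by (intro wedge22_alternating dwedge_alternating[OF g \<alpha> c] is_form_alternating[OF \<Psi> c])
next
  fix c c' z assume c: "c \<in> A" "c' \<in> A" and z: "z \<in> overlap c c'"
  let ?J = "jac c c' z" and ?z = "transition c c' z"
  show "wedge22 (dwedge g \<alpha> c' ?z) (\<Psi> c' ?z) (map ?J frame) = wedge22 (dwedge g \<alpha> c z) (\<Psi> c z) frame"
  proof (rule wedge22_map[OF length_frame_2])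
    have "\<alpha> c' ?z [?J v] = \<alpha> c z [v]" for v using is_form_transition[OF \<alpha> c z, of "[v]"] by simp
    moreover have "frechet_derivative (\<lambda>y. complex_of_real (g (cinv c' y))) (at ?z) (?J v)
        = frechet_derivative (\<lambda>y. complex_of_real (g (cinv c y))) (at z) v" for v
      using chain_rule_transition[OF c z smooth_fun_chart_of_real[OF g c(2)]] by simp
    ultimately show "dwedge g \<alpha> c' ?z [?J v, ?J w] = dwedge g \<alpha> c z [v, w]" for v w
      by (simp add: dwedge_def)
    show "\<Psi> c' ?z [?J v, ?J w] = \<Psi> c z [v, w]" for v w
      using is_form_transition[OF \<Psi> c z, of "[v, w]"] by simp
  qed
qed

text \<open>All integrals use the same partition of unity, the one chosen in the definition.\<close>

lemma form_integral_partition: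
  obtains F \<rho> where "partition_of_unity A F \<rho>"
    "\<And>\<alpha> :: ('x, 2) dform. form_integral A \<alpha> = (\<Sum>c\<in>F. set_lebesgue_integral lborel (cimg c)
        (\<lambda>z. complex_of_real (\<rho> c (cinv c z)) * \<alpha> c z frame))"
proof -
  let ?p = "SOME (F, \<rho>). partition_of_unity A F \<rho>"
  obtain F \<rho> where p: "?p = (F, \<rho>)" by (cases ?p)
  have "case ?p of (F, \<rho>) \<Rightarrow> partition_of_unity A F \<rho>"
    by (rule someI_ex[of "\<lambda>(F, \<rho>). partition_of_unity A F \<rho>"]) (use partition_of_unity_exists in auto)
  then have 1: "partition_of_unity A F \<rho>" unfolding p by simp
  have 2: "form_integral A \<alpha> = (\<Sum>c\<in>F. set_lebesgue_integral lborel (cimg c)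
        (\<lambda>z. complex_of_real (\<rho> c (cinv c z)) * \<alpha> c z frame))" for \<alpha> :: "('x, 2) dform"
    unfolding form_integral_def p prod.case ..
  show thesis by (rule that[of F \<rho>, OF 1 2])
qed

lemma partition_integrable:
  assumes p: "partition_of_unity A F \<rho>" and c: "c \<in> F" and f: "continuous_on (cimg c) f"
  shows "set_integrable lborel (cimg c) (\<lambda>z. complex_of_real (\<rho> c (cinv c z)) * f z)"
proof (rule chart_integrable)
  have \<rho>: "smooth_fun A UNIV (\<rho> c)" "closure {x. \<rho> c x \<noteq> 0} \<subseteq> cdom c" and cA: "c \<in> A"
    using p c by (auto simp: partition_of_unity_def)
  show "c \<in> A" "closure {x. \<rho> c x \<noteq> 0} \<subseteq> cdom c" by fact+
  show "continuous_on (cimg c) (\<lambda>z. complex_of_real (\<rho> c (cinv c z)) * f z)"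
    by (intro continuous_on_mult f continuous_on_of_real continuous_on_chart[OF cA] smooth_fun_imp_continuous \<rho>)
  show "complex_of_real (\<rho> c (cinv c z)) * f z = 0" if "cinv c z \<notin> closure {x. \<rho> c x \<noteq> 0}" for z
    using that closure_subset[of "{x. \<rho> c x \<noteq> 0}"] by auto
qed simp

end

lemma wedge22_lincomb_left:
  "(\<And>v w. a [v, w] = a1 [v, w] + k * a2 [v, w]) \<Longrightarrow> wedge22 a b vs = wedge22 a1 b vs + k * wedge22 a2 b vs"
  by (simp add: wedge22_def algebra_simps)

lemma set_integral_sum_finite:
  fixes f :: "'i \<Rightarrow> 'a \<Rightarrow> 'b::{banach, second_countable_topology}"
  assumes "\<And>i. i \<in> I \<Longrightarrow> set_integrable M S (f i)"
  shows "set_lebesgue_integral M S (\<lambda>x. \<Sum>i\<in>I. f i x) = (\<Sum>i\<in>I. set_lebesgue_integral M S (f i))"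
  using assms unfolding set_lebesgue_integral_def set_integrable_def scaleR_sum_right
  by (rule Bochner_Integration.integral_sum)

context surface
begin

lemma partition_of_unity_facts:
  assumes "partition_of_unity A F \<rho>"
  shows "finite F" "c \<in> F \<Longrightarrow> c \<in> A" "c \<in> F \<Longrightarrow> smooth_fun A UNIV (\<rho> c)" "c \<in> F \<Longrightarrow> 0 \<le> \<rho> c x"
    "c \<in> F \<Longrightarrow> closure {x. \<rho> c x \<noteq> 0} \<subseteq> cdom c" "(\<Sum>c\<in>F. \<rho> c x) = 1"
    "x \<notin> closure {x. \<rho> c x \<noteq> 0} \<Longrightarrow> \<rho> c x = 0"
  using assms closure_subset[of "{x. \<rho> c x \<noteq> 0}"] unfolding partition_of_unity_def by blast+

lemma derivative_zero_off_support:
  assumes "d \<in> A" "z \<in> cimg d" "cinv d z \<notin> closure {x. g x \<noteq> 0}"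
  shows "frechet_derivative (\<lambda>y. complex_of_real (g (cinv d y))) (at z) v = 0"
proof -
  let ?W = "{y \<in> cimg d. cinv d y \<in> - closure {x. g x \<noteq> 0}}"
  have "open ?W" by (rule open_chart_image[OF assms(1)]) auto
  have "((\<lambda>y. 0) has_derivative (\<lambda>v. 0)) (at z)" by simp
  then have "((\<lambda>y. complex_of_real (g (cinv d y))) has_derivative (\<lambda>v. 0)) (at z)"
  proof (rule has_derivative_transform_within_open[OF _ \<open>open ?W\<close>])
    show "z \<in> ?W" using assms by simp
    show "0 = complex_of_real (g (cinv d y))" if "y \<in> ?W" for y
      using that closure_subset[of "{x. g x \<noteq> 0}"] by auto
  qed
  from fun_cong[OF frechet_derivative_at[OF this], of v] show ?thesis by simp
qed

lemma continuous_on_local_d: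
  assumes \<alpha>: "is_form A 1 \<alpha>" and c: "c \<in> A"
  shows "continuous_on (cimg c) (\<lambda>z. local_d (\<alpha> c) z [v, w])"
  unfolding local_d_1
  by (intro continuous_on_diff smooth_on_continuous smooth_on_derivative is_form_smooth[OF \<alpha> c]) auto

lemma closed_local_d:
  assumes "ext_d \<Psi> = form_zero" "z \<in> cimg c"
  shows "local_d (\<Psi> c) z vs = 0"
  using fun_cong[OF fun_cong[OF fun_cong[OF assms(1), of c], of z], of vs] assms(2)
  by (simp add: ext_d_def form_zero_def)

text \<open>Integrating by parts in the chart \<open>c\<close> moves the derivative onto the cut-off function.\<close>

lemma chart_integration_by_parts:
  assumes p: "partition_of_unity A F \<rho>" and cF: "c \<in> F"
    and \<alpha>: "is_form A 1 \<alpha>" and \<Psi>: "is_form A 2 \<Psi>" and closed: "\<And>c z u v w. c \<in> A \<Longrightarrow> z \<in> cimg c \<Longrightarrow> local_d (\<Psi> c) z [u, v, w] = 0"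
  shows "set_lebesgue_integral lborel (cimg c)
      (\<lambda>z. complex_of_real (\<rho> c (cinv c z)) * wedge22 (local_d (\<alpha> c) z) (\<Psi> c z) frame)
    = - set_lebesgue_integral lborel (cimg c) (\<lambda>z. wedge22 (dwedge (\<rho> c) \<alpha> c z) (\<Psi> c z) frame)"
proof -
  note pf = partition_of_unity_facts[OF p]
  have c: "c \<in> A" and g: "smooth_fun A UNIV (\<rho> c)" using pf(2,3) cF by blast+
  note U = open_cimg[OF c]
  let ?r = "\<lambda>z. complex_of_real (\<rho> c (cinv c z))"
  let ?C = "closure {x. \<rho> c x \<noteq> 0}"
  have sr: "smooth_on (cimg c) ?r" by (rule smooth_fun_chart_of_real[OF g c])
  have sa: "smooth_on (cimg c) (\<lambda>z. \<alpha> c z [v])" for v by (rule is_form_smooth[OF \<alpha> c]) simp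
  define \<beta> where "\<beta> = (\<lambda>z vs. ?r z * \<alpha> c z vs)"
  have \<beta>: "Ck_on 1 (cimg c) (\<lambda>z. \<beta> z [v])" for v
    unfolding \<beta>_def by (rule smooth_on_Ck[OF smooth_on_mult[OF U sr sa]])
  have \<Psi>1: "Ck_on 1 (cimg c) (\<lambda>z. \<Psi> c z [v, w])" for v w
    by (rule smooth_on_Ck[OF is_form_smooth[OF \<Psi> c]]) simp
  note K = chart_integrable(2-4)[OF c continuous_on_const[of _ 0] closed_closure pf(5)[OF cF] refl]
  have zero: "\<beta> z [v] = 0" if "z \<in> cimg c" "z \<notin> cmap c ` ?C" for z v
    using pf(7)[OF K(3)[OF that]] by (simp add: \<beta>_def)
  note st = local_stokes[where \<beta> = \<beta> and \<Psi> = "\<Psi> c", OF U K(1,2) \<beta> zero \<Psi>1 closed[OF c] length_frame_2]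
  have eq: "wedge22 (local_d \<beta> z) (\<Psi> c z) frame = wedge22 (dwedge (\<rho> c) \<alpha> c z) (\<Psi> c z) frame
      + ?r z * wedge22 (local_d (\<alpha> c) z) (\<Psi> c z) frame" if z: "z \<in> cimg c" for z
  proof (rule wedge22_lincomb_left)
    fix v w
    have "?r differentiable (at z)" "(\<lambda>z. \<alpha> c z [v]) differentiable (at z)" for v
      using smooth_on_has_derivative[OF sr z] smooth_on_has_derivative[OF sa z] differentiableI by blast+
    then show "local_d \<beta> z [v, w] = dwedge (\<rho> c) \<alpha> c z [v, w] + ?r z * local_d (\<alpha> c) z [v, w]"
      unfolding local_d_1 \<beta>_def dwedge_def by (simp add: frechet_derivative_mult algebra_simps)
  qed
  have i2: "set_integrable lborel (cimg c) (\<lambda>z. ?r z * wedge22 (local_d (\<alpha> c) z) (\<Psi> c z) frame)"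
    unfolding wedge22_def
    by (intro partition_integrable[OF p cF] continuous_on_add continuous_on_diff continuous_on_mult
        continuous_on_local_d[OF \<alpha> c] smooth_on_continuous is_form_smooth[OF \<Psi> c]) auto
  have "set_integrable lborel (cimg c) (\<lambda>z. wedge22 (local_d \<beta> z) (\<Psi> c z) frame
      - ?r z * wedge22 (local_d (\<alpha> c) z) (\<Psi> c z) frame)"
    by (rule set_integral_diff(1)[OF st(1) i2])
  moreover have "set_integrable lborel (cimg c) (\<lambda>z. wedge22 (local_d \<beta> z) (\<Psi> c z) frame
      - ?r z * wedge22 (local_d (\<alpha> c) z) (\<Psi> c z) frame)
    \<longleftrightarrow> set_integrable lborel (cimg c) (\<lambda>z. wedge22 (dwedge (\<rho> c) \<alpha> c z) (\<Psi> c z) frame)"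
    by (rule set_integrable_cong[OF refl refl]) (simp add: eq)
  ultimately have i1: "set_integrable lborel (cimg c) (\<lambda>z. wedge22 (dwedge (\<rho> c) \<alpha> c z) (\<Psi> c z) frame)" by simp
  have "0 = set_lebesgue_integral lborel (cimg c) (\<lambda>z. wedge22 (local_d \<beta> z) (\<Psi> c z) frame)"
    by (rule st(2)[symmetric])
  also have "\<dots> = set_lebesgue_integral lborel (cimg c) (\<lambda>z. wedge22 (dwedge (\<rho> c) \<alpha> c z) (\<Psi> c z) frame
      + ?r z * wedge22 (local_d (\<alpha> c) z) (\<Psi> c z) frame)"
    by (rule set_lebesgue_integral_cong) (use U eq in auto)
  also have "\<dots> = set_lebesgue_integral lborel (cimg c) (\<lambda>z. wedge22 (dwedge (\<rho> c) \<alpha> c z) (\<Psi> c z) frame)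
      + set_lebesgue_integral lborel (cimg c) (\<lambda>z. ?r z * wedge22 (local_d (\<alpha> c) z) (\<Psi> c z) frame)"
    by (rule set_integral_add(2)[OF i1 i2])
  finally show ?thesis by (simp add: eq_neg_iff_add_eq_0 add.commute)
qed

text \<open>Stokes' theorem for \<open>d\<alpha> \<and> \<Psi> = d(\<alpha> \<and> \<Psi>)\<close>. After integration by parts in each
  chart, inserting the partition of unity once more and changing coordinates produces the
  derivative of \<open>\<Sum>\<rho> = 1\<close>. This uses the transformation law
  of the forms alone, so no second derivatives of the transition maps occur.\<close>

theorem integral_exact_wedge_closed:
  assumes \<alpha>: "is_form A 1 \<alpha>" and \<Psi>: "is_form A 2 \<Psi>" and closed: "\<And>c z u v w. c \<in> A \<Longrightarrow> z \<in> cimg c \<Longrightarrow> local_d (\<Psi> c) z [u, v, w] = 0"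
  shows "form_integral A (\<lambda>c z. wedge22 (local_d (\<alpha> c) z) (\<Psi> c z)) = 0"
proof (rule form_integral_partition)
  fix F \<rho> assume p: "partition_of_unity A F \<rho>"
    and fi: "\<And>\<alpha> :: ('x, 2) dform. form_integral A \<alpha> = (\<Sum>c\<in>F. set_lebesgue_integral lborel (cimg c)
        (\<lambda>z. complex_of_real (\<rho> c (cinv c z)) * \<alpha> c z frame))"
  note pf = partition_of_unity_facts[OF p]
  let ?r = "\<lambda>d c z. complex_of_real (\<rho> d (cinv c z))"
  define \<Theta> where "\<Theta> = (\<lambda>c d z. wedge22 (dwedge (\<rho> c) \<alpha> d z) (\<Psi> d z))"
  have dens: "top_density (\<Theta> c)" if "c \<in> F" for c
    unfolding \<Theta>_def by (rule dwedge_top_density[OF pf(3)[OF that] \<alpha> \<Psi>])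
  have \<Theta>0: "\<Theta> c d z vs = 0" if "d \<in> A" "z \<in> cimg d" "cinv d z \<notin> closure {x. \<rho> c x \<noteq> 0}" for c d z vs
    unfolding \<Theta>_def wedge22_def dwedge_def derivative_zero_off_support[OF that] by simp
  have cont\<Theta>: "continuous_on (cimg d) (\<lambda>z. \<Theta> c d z frame)" if "c \<in> F" "d \<in> A" for c d
    using dens[OF that(1)] that(2) unfolding top_density_def by blast
  have swap: "set_lebesgue_integral lborel (cimg c) (\<lambda>z. ?r d c z * \<Theta> c c z frame)
      = set_lebesgue_integral lborel (cimg d) (\<lambda>z. ?r d d z * \<Theta> c d z frame)"
    and int: "set_integrable lborel (cimg c) (\<lambda>z. ?r d c z * \<Theta> c c z frame)" if c: "c \<in> F" and d: "d \<in> F" for c d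
  proof -
    have A: "c \<in> A" "d \<in> A" using pf(2) c d by blast+
    have cr: "continuous_on UNIV (\<rho> d)" by (rule smooth_fun_imp_continuous[OF pf(3)[OF d]])
    show int: "set_integrable lborel (cimg c) (\<lambda>z. ?r d c z * \<Theta> c c z frame)"
    proof (rule chart_integrable(1)[OF A(1) _ closed_closure pf(5)[OF c]])
      show "continuous_on (cimg c) (\<lambda>z. ?r d c z * \<Theta> c c z frame)"
        by (intro continuous_on_mult continuous_on_of_real continuous_on_chart[OF A(1) cr] cont\<Theta>[OF c A(1)])
    qed (simp add: \<Theta>0[OF A(1)])
    show "set_lebesgue_integral lborel (cimg c) (\<lambda>z. ?r d c z * \<Theta> c c z frame)
      = set_lebesgue_integral lborel (cimg d) (\<lambda>z. ?r d d z * \<Theta> c d z frame)"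
    proof (rule integral_transfer[OF A top_density_mult[OF cr dens[OF c]] _ _ int])
      show "?r d c z * \<Theta> c c z frame = 0" if "z \<in> cimg c" "z \<notin> overlap c d" for z
      proof -
        have "cinv c z \<notin> closure {x. \<rho> d x \<noteq> 0}" using that pf(5)[OF d] by (auto simp: overlap_def)
        then have "\<rho> d (cinv c z) = 0" by (rule pf(7))
        then show ?thesis by simp
      qed
      show "?r d d z * \<Theta> c d z frame = 0" if "z \<in> cimg d" "z \<notin> overlap d c" for z
      proof -
        have "cinv d z \<notin> closure {x. \<rho> c x \<noteq> 0}" using that pf(5)[OF c] by (auto simp: overlap_def)
        then show ?thesis using \<Theta>0[OF A(2) that(1)] by simp
      qed
    qed
  qed
  have split: "set_lebesgue_integral lborel (cimg c) (\<lambda>z. \<Theta> c c z frame)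
      = (\<Sum>d\<in>F. set_lebesgue_integral lborel (cimg d) (\<lambda>z. ?r d d z * \<Theta> c d z frame))" if c: "c \<in> F" for c
  proof -
    have "\<Theta> c c z frame = (\<Sum>d\<in>F. ?r d c z * \<Theta> c c z frame)" for z
      unfolding sum_distrib_right[symmetric] of_real_sum[symmetric] pf(6) by simp
    then have "set_lebesgue_integral lborel (cimg c) (\<lambda>z. \<Theta> c c z frame)
        = set_lebesgue_integral lborel (cimg c) (\<lambda>z. \<Sum>d\<in>F. ?r d c z * \<Theta> c c z frame)" by simp
    also have "\<dots> = (\<Sum>d\<in>F. set_lebesgue_integral lborel (cimg c) (\<lambda>z. ?r d c z * \<Theta> c c z frame))"
      by (rule set_integral_sum_finite) (rule int[OF c])
    also have "\<dots> = (\<Sum>d\<in>F. set_lebesgue_integral lborel (cimg d) (\<lambda>z. ?r d d z * \<Theta> c d z frame))"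
      by (rule sum.cong[OF refl]) (rule swap[OF c])
    finally show ?thesis .
  qed
  have sum0: "(\<Sum>c\<in>F. ?r d d z * \<Theta> c d z frame) = 0" if d: "d \<in> A" and z: "z \<in> cimg d" for d z
  proof -
    have "(\<Sum>c\<in>F. frechet_derivative (\<lambda>y. ?r c d y) (at z) v) = 0" for v
    proof -
      have "((\<lambda>y. \<Sum>c\<in>F. ?r c d y) has_derivative (\<lambda>v. \<Sum>c\<in>F. frechet_derivative (\<lambda>y. ?r c d y) (at z) v)) (at z)"
        by (rule has_derivative_sum) (rule smooth_on_has_derivative[OF smooth_fun_chart_of_real[OF pf(3) d] z])
      moreover have "(\<lambda>y. \<Sum>c\<in>F. ?r c d y) = (\<lambda>y. 1)"
        unfolding of_real_sum[symmetric] pf(6) by simp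
      ultimately have "((\<lambda>y. 1) has_derivative (\<lambda>v. \<Sum>c\<in>F. frechet_derivative (\<lambda>y. ?r c d y) (at z) v)) (at z)"
        by simp
      from has_derivative_unique[OF this has_derivative_const] show ?thesis by metis
    qed
    then have "(\<Sum>c\<in>F. dwedge (\<rho> c) \<alpha> d z [v, w]) = 0" for v w
      unfolding dwedge_def sum_subtractf sum_distrib_right[symmetric] by simp
    then have "(\<Sum>c\<in>F. \<Theta> c d z frame) = 0"
      unfolding \<Theta>_def wedge22_def sum.distrib sum_subtractf sum_distrib_right[symmetric] by simp
    then show ?thesis unfolding sum_distrib_left[symmetric] by simp
  qed
  have int2: "set_integrable lborel (cimg d) (\<lambda>z. ?r d d z * \<Theta> c d z frame)" if "c \<in> F" "d \<in> F" for c d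
    by (rule partition_integrable[OF p that(2) cont\<Theta>[OF that(1) pf(2)[OF that(2)]]])
  have "form_integral A (\<lambda>c z. wedge22 (local_d (\<alpha> c) z) (\<Psi> c z))
      = (\<Sum>c\<in>F. - set_lebesgue_integral lborel (cimg c) (\<lambda>z. \<Theta> c c z frame))"
    unfolding fi \<Theta>_def by (rule sum.cong[OF refl]) (rule chart_integration_by_parts[OF p _ \<alpha> \<Psi> closed])
  also have "\<dots> = - (\<Sum>c\<in>F. \<Sum>d\<in>F. set_lebesgue_integral lborel (cimg d) (\<lambda>z. ?r d d z * \<Theta> c d z frame))"
    by (simp add: sum_negf split)
  also have "(\<Sum>c\<in>F. \<Sum>d\<in>F. set_lebesgue_integral lborel (cimg d) (\<lambda>z. ?r d d z * \<Theta> c d z frame))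
      = (\<Sum>d\<in>F. \<Sum>c\<in>F. set_lebesgue_integral lborel (cimg d) (\<lambda>z. ?r d d z * \<Theta> c d z frame))"
    by (rule sum.swap)
  also have "\<dots> = (\<Sum>d\<in>F. set_lebesgue_integral lborel (cimg d) (\<lambda>z. \<Sum>c\<in>F. ?r d d z * \<Theta> c d z frame))"
    by (rule sum.cong[OF refl]) (rule set_integral_sum_finite[symmetric], rule int2)
  also have "\<dots> = (\<Sum>d\<in>F. set_lebesgue_integral lborel (cimg d) (\<lambda>z. 0))"
    by (rule sum.cong[OF refl], rule set_lebesgue_integral_cong) (use open_cimg pf(2) sum0 in auto)
  also have "\<dots> = 0" by (simp add: set_lebesgue_integral_def)
  finally show "form_integral A (\<lambda>c z. wedge22 (local_d (\<alpha> c) z) (\<Psi> c z)) = 0" by simp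
qed

definition top_continuous :: "('x, 2) dform \<Rightarrow> bool" where
  "top_continuous \<Theta> \<longleftrightarrow> (\<forall>c\<in>A. continuous_on (cimg c) (\<lambda>z. \<Theta> c z frame))"

lemma form_integral_cong:
  assumes "\<And>c z. c \<in> A \<Longrightarrow> z \<in> cimg c \<Longrightarrow> \<Theta> c z frame = \<Theta>' c z frame"
  shows "form_integral A \<Theta> = form_integral A \<Theta>'"
proof (rule form_integral_partition)
  fix F \<rho> assume p: "partition_of_unity A F \<rho>"
    and fi: "\<And>\<alpha> :: ('x, 2) dform. form_integral A \<alpha> = (\<Sum>c\<in>F. set_lebesgue_integral lborel (cimg c)
        (\<lambda>z. complex_of_real (\<rho> c (cinv c z)) * \<alpha> c z frame))"
  show ?thesis
    unfolding fi
    by (rule sum.cong[OF refl], rule set_lebesgue_integral_cong)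
      (use assms open_cimg partition_of_unity_facts(2)[OF p] in auto)
qed

lemma form_integral_diff:
  assumes "top_continuous \<Theta>" "top_continuous \<Theta>'"
  shows "form_integral A (\<lambda>c z vs. \<Theta> c z vs - \<Theta>' c z vs) = form_integral A \<Theta> - form_integral A \<Theta>'"
proof (rule form_integral_partition)
  fix F \<rho> assume p: "partition_of_unity A F \<rho>"
    and fi: "\<And>\<alpha> :: ('x, 2) dform. form_integral A \<alpha> = (\<Sum>c\<in>F. set_lebesgue_integral lborel (cimg c)
        (\<lambda>z. complex_of_real (\<rho> c (cinv c z)) * \<alpha> c z frame))"
  show ?thesis
    unfolding fi sum_subtractf[symmetric]
  proof (rule sum.cong[OF refl])
    fix c assume c: "c \<in> F"
    then have "c \<in> A" using partition_of_unity_facts(2)[OF p] by blast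
    then show "set_lebesgue_integral lborel (cimg c) (\<lambda>z. complex_of_real (\<rho> c (cinv c z)) * (\<Theta> c z frame - \<Theta>' c z frame))
      = set_lebesgue_integral lborel (cimg c) (\<lambda>z. complex_of_real (\<rho> c (cinv c z)) * \<Theta> c z frame)
      - set_lebesgue_integral lborel (cimg c) (\<lambda>z. complex_of_real (\<rho> c (cinv c z)) * \<Theta>' c z frame)"
      unfolding right_diff_distrib
      by (intro set_integral_diff(2) partition_integrable[OF p c]) (use assms in \<open>auto simp: top_continuous_def\<close>)
  qed
qed

lemma form_integral_scale: "form_integral A (\<lambda>c z vs. k * \<Theta> c z vs) = k * form_integral A \<Theta>"
proof (rule form_integral_partition)
  fix F \<rho> assume "partition_of_unity A F \<rho>"
    and fi: "\<And>\<alpha> :: ('x, 2) dform. form_integral A \<alpha> = (\<Sum>c\<in>F. set_lebesgue_integral lborel (cimg c)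
        (\<lambda>z. complex_of_real (\<rho> c (cinv c z)) * \<alpha> c z frame))"
  show ?thesis
    unfolding fi mult.left_commute[of _ k] set_integral_mult_right sum_distrib_left ..
qed

text \<open>A continuous nonnegative density with integral 0 vanishes wherever the weight of some chart is
  positive. The conclusion provides one such chart at each point; pointwise statements that do not
  depend on coordinates can be moved from it to the others.\<close>

lemma form_integral_nonneg:
  assumes cont: "top_continuous \<Theta>" and nn: "\<And>c z. c \<in> A \<Longrightarrow> z \<in> cimg c \<Longrightarrow> 0 \<le> Re (\<Theta> c z frame)"
  shows "0 \<le> Re (form_integral A \<Theta>)"
    and "Re (form_integral A \<Theta>) = 0 \<Longrightarrow> \<exists>c\<in>A. x \<in> cdom c \<and> Re (\<Theta> c (cmap c x) frame) = 0"
proof -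
  obtain F \<rho> where p: "partition_of_unity A F \<rho>"
    and fi: "\<And>\<alpha> :: ('x, 2) dform. form_integral A \<alpha> = (\<Sum>c\<in>F. set_lebesgue_integral lborel (cimg c)
        (\<lambda>z. complex_of_real (\<rho> c (cinv c z)) * \<alpha> c z frame))"
    by (rule form_integral_partition) (rule that)
  note pf = partition_of_unity_facts[OF p]
  define I where "I = (\<lambda>c. integral\<^sup>L lborel (\<lambda>z. indicator (cimg c) z * (\<rho> c (cinv c z) * Re (\<Theta> c z frame))))"
  have int: "integrable lborel (\<lambda>z. indicator (cimg c) z *\<^sub>R (complex_of_real (\<rho> c (cinv c z)) * \<Theta> c z frame))" if "c \<in> F" for c
    using partition_integrable[OF p that, of "\<lambda>z. \<Theta> c z frame"] cont pf(2)[OF that]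
    by (simp add: top_continuous_def set_integrable_def)
  have intR: "integrable lborel (\<lambda>z. indicator (cimg c) z * (\<rho> c (cinv c z) * Re (\<Theta> c z frame)))" if "c \<in> F" for c
    using integrable_Re[OF int[OF that]] by (simp add: cond_case_prod_eta)
  have Re: "Re (form_integral A \<Theta>) = (\<Sum>c\<in>F. I c)"
  proof -
    have "Re (set_lebesgue_integral lborel (cimg c) (\<lambda>z. complex_of_real (\<rho> c (cinv c z)) * \<Theta> c z frame)) = I c" if "c \<in> F" for c
      unfolding set_lebesgue_integral_def I_def
      using integral_Re[OF int[OF that]] by simp
    then show ?thesis unfolding fi Re_sum by (rule sum.cong[OF refl])
  qed
  have nn': "0 \<le> indicator (cimg c) z * (\<rho> c (cinv c z) * Re (\<Theta> c z frame))" if "c \<in> F" for c z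
    using nn[OF pf(2)[OF that]] pf(4)[OF that] by (auto simp: indicator_def)
  have I0: "0 \<le> I c" if "c \<in> F" for c
    unfolding I_def by (rule Bochner_Integration.integral_nonneg) (rule nn'[OF that])
  show "0 \<le> Re (form_integral A \<Theta>)" unfolding Re by (rule sum_nonneg) (rule I0)
  assume "Re (form_integral A \<Theta>) = 0"
  then have zero: "I c = 0" if "c \<in> F" for c
    using sum_nonneg_eq_0_iff[OF pf(1) I0] Re that by simp
  have "(\<Sum>c\<in>F. \<rho> c x) \<noteq> 0" using pf(6) by simp
  then obtain c where c: "c \<in> F" "\<rho> c x \<noteq> 0" by (meson sum.neutral)
  have cA: "c \<in> A" by (rule pf(2)[OF c(1)])
  have x: "x \<in> cdom c" using pf(5,7) c by blast
  let ?f = "\<lambda>z. \<rho> c (cinv c z) * Re (\<Theta> c z frame)"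
  let ?N = "cimg c \<inter> ?f -` (- {0})"
  have "continuous_on (cimg c) ?f"
    using cont cA unfolding top_continuous_def
    by (intro continuous_on_mult continuous_on_Re continuous_on_chart[OF cA smooth_fun_imp_continuous[OF pf(3)[OF c(1)]]]) blast
  then have oN: "open ?N" by (rule continuous_open_preimage[OF _ open_cimg[OF cA]]) auto
  have "AE z in lborel. indicator (cimg c) z * ?f z = 0"
    using zero[OF c(1)] unfolding I_def
    by (subst (asm) integral_nonneg_eq_0_iff_AE[OF intR[OF c(1)]]) (use nn'[OF c(1)] in auto)
  then have "AE z in lborel. z \<notin> ?N" by (rule AE_mp) (auto simp: indicator_def)
  then have "?N \<in> null_sets lborel" using oN by (simp add: AE_iff_null_sets)
  then have "negligible ?N" by (simp add: negligible_iff_null_sets null_sets_completionI)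
  then have "?N = {}" using open_not_negligible[OF oN] by blast
  then have "?f (cmap c x) = 0" using cmap_in_cimg[OF x] by blast
  then have "Re (\<Theta> c (cmap c x) frame) = 0" using c(2) by (simp add: cinv_cmap[OF cA x])
  then show "\<exists>c\<in>A. x \<in> cdom c \<and> Re (\<Theta> c (cmap c x) frame) = 0" using cA x by blast
qed

end

section \<open>Forms of type (1,1) at a point\<close>

text \<open>Among alternating 2-forms, this singles out those of type \<open>(1,1)\<close>.\<close>

definition J_invariant :: "((complex^'n) list \<Rightarrow> complex) \<Rightarrow> bool" where
  "J_invariant b \<longleftrightarrow> (\<forall>v w. b [\<i> *s v, \<i> *s w] = b [v, w])"

lemma basic_form_11: "basic_form [k] [l] [v, w] = v $ k * cnj (w $ l) - w $ k * cnj (v $ l)"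
  using sum_permutations_2[of "\<lambda>i j. ([v, w] ! i) $ k * cnj (([v, w] ! j) $ l)"]
  by (simp add: basic_form_def mult.assoc numeral_2_eq_2)

lemma basic_form_01: "basic_form [] [l] [v] = cnj (v $ l)"
  and basic_form_10: "basic_form [k] [] [v] = v $ k"
proof -
  have "{s. s permutes {..<Suc 0}} = {id}" by (auto simp: lessThan_Suc)
  then show "basic_form [] [l] [v] = cnj (v $ l)" "basic_form [k] [] [v] = v $ k"
    by (simp_all add: basic_form_def)
qed

lemma form_of_type_coefficients:
  assumes "form_of_type A p q \<alpha>" "c \<in> A" "z \<in> cimg c"
  obtains a where "\<And>vs. length vs = p + q \<Longrightarrow>
    \<alpha> c z vs = (\<Sum>I | length I = p. \<Sum>J | length J = q. a I J * basic_form I J vs)"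
proof -
  have "\<exists>a. \<forall>vs. length vs = p + q \<longrightarrow>
      \<alpha> c z vs = (\<Sum>I | length I = p. \<Sum>J | length J = q. a I J * basic_form I J vs)"
    using assms unfolding form_of_type_def by blast
  then show thesis using that by blast
qed

lemma form_of_type_11_J_invariant:
  assumes "form_of_type A 1 1 \<omega>"
  shows "J_invariant (\<omega> c z)"
  unfolding J_invariant_def
proof (intro allI)
  fix v w
  have form: "is_form A 2 \<omega>" using assms by (simp add: form_of_type_def numeral_2_eq_2)
  show "\<omega> c z [\<i> *s v, \<i> *s w] = \<omega> c z [v, w]"
  proof (cases "c \<in> A \<and> z \<in> cimg c")
    case True
    then obtain a where a: "\<And>vs. length vs = 1 + 1 \<Longrightarrow> \<omega> c z vs =
        (\<Sum>I | length I = 1. \<Sum>J | length J = 1. a I J * basic_form I J vs)"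
      using form_of_type_coefficients[OF assms, of c z] by blast
    have "basic_form I J [\<i> *s v, \<i> *s w] = basic_form I J [v, w]" if len: "length I = 1" "length J = 1" for I J
    proof -
      obtain k l where "I = [k]" "J = [l]" using len by (cases I; cases J) auto
      moreover have "\<i> * a * (\<i> * b) = - (a * b)" for a b by (simp add: complex_eq_iff)
      ultimately show ?thesis by (simp add: basic_form_11)
    qed
    then show ?thesis by (simp add: a)
  next
    case False
    then show ?thesis using is_form_outside[OF form] by metis
  qed
qed

lemma form_of_type_01_antilinear:
  assumes "form_of_type A 0 1 \<alpha>"
  shows "\<alpha> c z [\<i> *s v] = - \<i> * \<alpha> c z [v]"
proof (cases "c \<in> A \<and> z \<in> cimg c")
  case True
  then obtain a where a: "\<And>vs. length vs = 1 \<Longrightarrow> \<alpha> c z vs =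
      (\<Sum>I | length I = 0. \<Sum>J | length J = 1. a I J * basic_form I J vs)"
    using form_of_type_coefficients[OF assms, of c z] by auto
  have *: "basic_form I J [\<i> *s v] = - \<i> * basic_form I J [v]" if len: "length I = 0" "length J = 1" for I J
  proof -
    obtain l where "I = []" "J = [l]" using len by (cases I; cases J) auto
    then show ?thesis by (simp add: basic_form_01)
  qed
  show ?thesis
    unfolding a[of "[\<i> *s v]", simplified] a[of "[v]", simplified] sum_distrib_left
    by (intro sum.cong refl) (simp add: *)
next
  case False
  have "is_form A 1 \<alpha>" using assms by (simp add: form_of_type_def)
  then have "\<alpha> c z vs = 0" for vs using is_form_outside[of A 1 \<alpha> c z vs] False by blast
  then show ?thesis by simp
qed

lemma form_of_type_10_linear:
  assumes "form_of_type A 1 0 \<alpha>"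
  shows "\<alpha> c z [\<i> *s v] = \<i> * \<alpha> c z [v]"
proof (cases "c \<in> A \<and> z \<in> cimg c")
  case True
  then obtain a where a: "\<And>vs. length vs = 1 \<Longrightarrow> \<alpha> c z vs =
      (\<Sum>I | length I = 1. \<Sum>J | length J = 0. a I J * basic_form I J vs)"
    using form_of_type_coefficients[OF assms, of c z] by auto
  have *: "basic_form I J [\<i> *s v] = \<i> * basic_form I J [v]" if len: "length I = 1" "length J = 0" for I J
  proof -
    obtain l where "I = [l]" "J = []" using len by (cases I; cases J) auto
    then show ?thesis by (simp add: basic_form_10)
  qed
  show ?thesis
    unfolding a[of "[\<i> *s v]", simplified] a[of "[v]", simplified] sum_distrib_left
    by (intro sum.cong refl) (simp add: *)
next
  case False
  have "is_form A 1 \<alpha>" using assms by (simp add: form_of_type_def)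
  then have "\<alpha> c z vs = 0" for vs using is_form_outside[of A 1 \<alpha> c z vs] False by blast
  then show ?thesis by simp
qed

lemma smult_i_i: "\<i> *s (\<i> *s v) = - v" for v :: "complex^'n"
  by (simp add: vec_eq_iff)

lemma frame_2_smult: "frame = [axis 2 1, \<i> *s axis 2 1, axis 1 1, \<i> *s axis (1::2) 1]"
  by (simp add: frame_2 axis_def vec_eq_iff)

lemma J_invariant_swap:
  fixes b :: "(complex^'n) list \<Rightarrow> complex"
  assumes b: "alternating_multilinear 2 b" "J_invariant b"
  shows "b [\<i> *s v, w] = - b [v, \<i> *s w]"
proof -
  have "b [\<i> *s v, w] = b [\<i> *s (\<i> *s v), \<i> *s w]" using b(2) unfolding J_invariant_def by metis
  also have "\<dots> = b [- v, \<i> *s w]" by (simp only: smult_i_i)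
  also have "\<dots> = - b [v, \<i> *s w]" by (rule linear_neg[OF alternating_2(1)[OF b(1)]])
  finally show ?thesis .
qed

text \<open>A form with \<open>\<epsilon> = -i\<close> is of type \<open>(0,2)\<close>, one with \<open>\<epsilon> = i\<close> of type \<open>(2,0)\<close>; its product with a
  \<open>(1,1)\<close>-form has type \<open>(1,3)\<close> or \<open>(3,1)\<close>, and there are no such forms in dimension two.\<close>

lemma wedge22_type_02:
  fixes a b :: "(complex^2) list \<Rightarrow> complex"
  assumes anti: "\<And>v w. a [w, v] = - a [v, w]" and J: "\<And>v w. a [\<i> *s v, w] = \<epsilon> * a [v, w]"
    and \<epsilon>: "\<epsilon> * \<epsilon> = - 1" and b: "alternating_multilinear 2 b" "J_invariant b"
  shows "wedge22 a b frame = 0"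
proof -
  let ?p = "axis 2 1 :: complex^2" and ?q = "axis 1 1 :: complex^2"
  have same: "a [v, v] = 0" for v using anti[of v v] by simp
  have right: "a [v, \<i> *s w] = \<epsilon> * a [v, w]" for v w
    using anti[of v "\<i> *s w"] anti[of v w] J[of w v] by simp
  have both: "a [\<i> *s v, \<i> *s w] = - a [v, w]" for v w
    using \<epsilon> by (simp add: J right flip: mult.assoc)
  have \<epsilon>2: "\<epsilon> * (\<epsilon> * t) = - t" for t using \<epsilon> by (simp flip: mult.assoc)
  have b1: "b [\<i> *s ?p, \<i> *s ?q] = b [?p, ?q]" using b(2) by (simp add: J_invariant_def)
  show ?thesis
    unfolding frame_2_smult wedge22_def
    by (simp add: numeral_eq_Suc same right both J b1 \<epsilon>2 J_invariant_swap[OF b, where v = ?p and w = ?q])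
qed

lemma local_d_eq_del_delbar: "local_d \<beta> z [v, w] = local_del \<beta> z [v, w] + local_delbar \<beta> z [v, w]"
  by (simp add: local_d_def local_del_def local_delbar_def dir_del_def dir_delbar_def numeral_2_eq_2 field_simps)

lemma frechet_derivative_cmult:
  fixes f :: "'a::real_normed_vector \<Rightarrow> complex"
  assumes "f differentiable (at z)"
  shows "frechet_derivative (\<lambda>y. k * f y) (at z) v = k * frechet_derivative f (at z) v"
  using fun_cong[OF frechet_derivative_at[OF has_derivative_mult_right], of f _ z k v] assms
  by (simp add: frechet_derivative_works)

lemma local_delbar_type_02:
  fixes \<alpha> :: "complex^'n \<Rightarrow> (complex^'n) list \<Rightarrow> complex"
  assumes J: "\<And>y v. \<alpha> y [\<i> *s v] = - \<i> * \<alpha> y [v]" and diff: "\<And>v. (\<lambda>y. \<alpha> y [v]) differentiable (at z)"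
  shows "local_delbar \<alpha> z [\<i> *s v, w] = - \<i> * local_delbar \<alpha> z [v, w]"
    and "local_delbar \<alpha> z [w, v] = - local_delbar \<alpha> z [v, w]"
proof -
  have lin: "linear (frechet_derivative (\<lambda>y. \<alpha> y [v]) (at z))" for v
    using diff has_derivative_linear frechet_derivative_works by blast
  have e: "local_delbar \<alpha> z [v, w] = dir_delbar (\<lambda>y. \<alpha> y [w]) z v - dir_delbar (\<lambda>y. \<alpha> y [v]) z w" for v w
    by (simp add: local_delbar_def drop_nth_def numeral_2_eq_2)
  have 1: "dir_delbar (\<lambda>y. \<alpha> y [w]) z (\<i> *s v) = - \<i> * dir_delbar (\<lambda>y. \<alpha> y [w]) z v"
    unfolding dir_delbar_def smult_i_i linear_neg[OF lin] by (simp add: field_simps)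
  have 2: "dir_delbar (\<lambda>y. \<alpha> y [\<i> *s v]) z w = - \<i> * dir_delbar (\<lambda>y. \<alpha> y [v]) z w"
    unfolding dir_delbar_def J frechet_derivative_cmult[OF diff] by (simp add: field_simps)
  show "local_delbar \<alpha> z [\<i> *s v, w] = - \<i> * local_delbar \<alpha> z [v, w]"
    unfolding e 1 2 by (simp add: algebra_simps)
  show "local_delbar \<alpha> z [w, v] = - local_delbar \<alpha> z [v, w]" unfolding e by simp
qed

lemma local_del_type_20:
  fixes \<alpha> :: "complex^'n \<Rightarrow> (complex^'n) list \<Rightarrow> complex"
  assumes J: "\<And>y v. \<alpha> y [\<i> *s v] = \<i> * \<alpha> y [v]" and diff: "\<And>v. (\<lambda>y. \<alpha> y [v]) differentiable (at z)"
  shows "local_del \<alpha> z [\<i> *s v, w] = \<i> * local_del \<alpha> z [v, w]"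
    and "local_del \<alpha> z [w, v] = - local_del \<alpha> z [v, w]"
proof -
  have lin: "linear (frechet_derivative (\<lambda>y. \<alpha> y [v]) (at z))" for v
    using diff has_derivative_linear frechet_derivative_works by blast
  have e: "local_del \<alpha> z [v, w] = dir_del (\<lambda>y. \<alpha> y [w]) z v - dir_del (\<lambda>y. \<alpha> y [v]) z w" for v w
    by (simp add: local_del_def drop_nth_def numeral_2_eq_2)
  have 1: "dir_del (\<lambda>y. \<alpha> y [w]) z (\<i> *s v) = \<i> * dir_del (\<lambda>y. \<alpha> y [w]) z v"
    unfolding dir_del_def smult_i_i linear_neg[OF lin] by (simp add: field_simps)
  have 2: "dir_del (\<lambda>y. \<alpha> y [\<i> *s v]) z w = \<i> * dir_del (\<lambda>y. \<alpha> y [v]) z w"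
    unfolding dir_del_def J frechet_derivative_cmult[OF diff] by (simp add: field_simps)
  show "local_del \<alpha> z [\<i> *s v, w] = \<i> * local_del \<alpha> z [v, w]"
    unfolding e 1 2 by (simp add: algebra_simps)
  show "local_del \<alpha> z [w, v] = - local_del \<alpha> z [v, w]" unfolding e by simp
qed

lemma vector_frame_expansion:
  fixes v :: "complex^2"
  shows "v = Re (v $ 2) *\<^sub>R axis 2 1 + Im (v $ 2) *\<^sub>R (\<i> *s axis 2 1)
    + Re (v $ 1) *\<^sub>R axis 1 1 + Im (v $ 1) *\<^sub>R (\<i> *s axis 1 1)"
  by (simp add: vec_eq_iff forall_2 axis_def complex_eq_iff)

lemma linear_eq_on_frame:
  fixes f g :: "complex^2 \<Rightarrow> complex"
  assumes "linear f" "linear g" "\<And>u. u \<in> set frame \<Longrightarrow> f u = g u"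
  shows "f v = g v"
proof -
  have *: "f (axis 2 1) = g (axis 2 1)" "f (\<i> *s axis 2 1) = g (\<i> *s axis 2 1)"
    "f (axis 1 1) = g (axis 1 1)" "f (\<i> *s axis 1 1) = g (\<i> *s axis 1 1)"
    by (rule assms(3), simp add: frame_2_smult)+
  show ?thesis
    by (subst (1 2) vector_frame_expansion[of v])
      (simp only: linear_add[OF assms(1)] linear_add[OF assms(2)] linear_scale[OF assms(1)] linear_scale[OF assms(2)] *)
qed

definition herm_a :: "((complex^2) list \<Rightarrow> complex) \<Rightarrow> real" where "herm_a b = Re (b [axis 2 1, \<i> *s axis 2 1])"
definition herm_d :: "((complex^2) list \<Rightarrow> complex) \<Rightarrow> real" where "herm_d b = Re (b [axis 1 1, \<i> *s axis 1 1])"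
definition herm_x :: "((complex^2) list \<Rightarrow> complex) \<Rightarrow> real" where "herm_x b = Re (b [axis 2 1, axis 1 1])"
definition herm_y :: "((complex^2) list \<Rightarrow> complex) \<Rightarrow> real" where "herm_y b = Re (b [axis 2 1, \<i> *s axis 1 1])"

text \<open>The real \<open>(1,1)\<close>-forms at a point of a complex surface form a Lorentzian space of dimension 4
  for the wedge product, with the coordinates \<open>herm_a, herm_d, herm_x, herm_y\<close>.\<close>

definition real_11 :: "((complex^2) list \<Rightarrow> complex) \<Rightarrow> bool" where
  "real_11 b \<longleftrightarrow> alternating_multilinear 2 b \<and> J_invariant b \<and> (\<forall>vs. b vs \<in> \<real>)"

lemma real_11_frame_values:
  assumes b: "real_11 b"
  shows "b [axis 2 1, \<i> *s axis 2 1] = of_real (herm_a b)" "b [axis 1 1, \<i> *s axis 1 1] = of_real (herm_d b)"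
    "b [axis 2 1, axis 1 1] = of_real (herm_x b)" "b [axis 2 1, \<i> *s axis 1 1] = of_real (herm_y b)"
    "b [\<i> *s axis 2 1, axis 1 1] = - of_real (herm_y b)" "b [\<i> *s axis 2 1, \<i> *s axis 1 1] = of_real (herm_x b)"
proof -
  have b': "alternating_multilinear 2 b" "J_invariant b" and r: "\<And>vs. b vs \<in> \<real>"
    using b by (auto simp: real_11_def)
  have re: "b vs = of_real (Re (b vs))" for vs using r by simp
  show 1: "b [axis 2 1, \<i> *s axis 2 1] = of_real (herm_a b)" "b [axis 1 1, \<i> *s axis 1 1] = of_real (herm_d b)"
    "b [axis 2 1, axis 1 1] = of_real (herm_x b)" "b [axis 2 1, \<i> *s axis 1 1] = of_real (herm_y b)"
    unfolding herm_a_def herm_d_def herm_x_def herm_y_def by (rule re)+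
  show "b [\<i> *s axis 2 1, axis 1 1] = - of_real (herm_y b)"
    using J_invariant_swap[OF b', where v = "axis 2 1" and w = "axis 1 1"] 1(4) by simp
  show "b [\<i> *s axis 2 1, \<i> *s axis 1 1] = of_real (herm_x b)"
    using b'(2) 1(3) by (simp add: J_invariant_def)
qed

text \<open>The Lorentzian scalar product, twice the mixed discriminant of two hermitian \<open>2 \<times> 2\<close> matrices.\<close>

definition mixed_disc :: "((complex^2) list \<Rightarrow> complex) \<Rightarrow> ((complex^2) list \<Rightarrow> complex) \<Rightarrow> real" where
  "mixed_disc b b' = herm_a b * herm_d b' + herm_a b' * herm_d b
     - 2 * (herm_x b * herm_x b') - 2 * (herm_y b * herm_y b')"

lemma wedge22_real_11:
  assumes "real_11 b" "real_11 b'"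
  shows "wedge22 b b' frame = of_real (mixed_disc b b')"
  unfolding frame_2_smult wedge22_def mixed_disc_def
  by (simp add: numeral_eq_Suc real_11_frame_values[OF assms(1)] real_11_frame_values[OF assms(2)] algebra_simps)

lemma real_11_eq_scale:
  assumes b: "real_11 b" and b': "real_11 b'"
    and "herm_a b = k * herm_a b'" "herm_d b = k * herm_d b'" "herm_x b = k * herm_x b'" "herm_y b = k * herm_y b'"
  shows "b [v, w] = of_real k * b' [v, w]"
proof -
  have alt: "alternating_multilinear 2 b" "alternating_multilinear 2 b'" using b b' by (auto simp: real_11_def)
  have lk: "linear (\<lambda>v. of_real k * f v)" if "linear f" for f :: "complex^2 \<Rightarrow> complex"
    using linear_compose[OF that, of "\<lambda>x. of_real k * x"]
    by (simp add: o_def linear_conv_bounded_linear bounded_linear_mult_right)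
  note vals = real_11_frame_values[OF b, unfolded assms(3-6)] real_11_frame_values[OF b']
  have up: "b [v, w] = of_real k * b' [v, w]"
    if "(v, w) \<in> {(axis 2 1, \<i> *s axis 2 1), (axis 1 1, \<i> *s axis 1 1), (axis 2 1, axis 1 1),
       (axis 2 1, \<i> *s axis 1 1), (\<i> *s axis 2 1, axis 1 1), (\<i> *s axis 2 1, \<i> *s axis 1 1)}" for v w
    using that by (elim insertE emptyE; simp add: vals)
  have "b [v, w] = of_real k * b' [v, w]" if "v \<in> set frame" "w \<in> set frame" for v w
  proof -
    have "v = w \<or> b [v, w] = of_real k * b' [v, w] \<or> b [w, v] = of_real k * b' [w, v]"
      using that up[of v w] up[of w v] unfolding frame_2_smult list.set by (elim insertE emptyE) auto
    then show ?thesis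
    proof (elim disjE)
      assume "b [w, v] = of_real k * b' [w, v]"
      then show ?thesis
        using alternating_2(4)[OF alt(1), where v = w and w = v] alternating_2(4)[OF alt(2), where v = w and w = v] by simp
    qed (auto simp: alternating_2(3)[OF alt(1)] alternating_2(3)[OF alt(2)])
  qed
  then have "b [v, w] = of_real k * b' [v, w]" if "v \<in> set frame" for v w
    using linear_eq_on_frame[OF alternating_2(2)[OF alt(1)] lk[OF alternating_2(2)[OF alt(2)]]] that by blast
  then show ?thesis
    using linear_eq_on_frame[OF alternating_2(1)[OF alt(1)] lk[OF alternating_2(1)[OF alt(2)]]] by blast
qed

lemma positive_real_11:
  assumes b: "real_11 b" and pos: "\<And>v. v \<noteq> 0 \<Longrightarrow> 0 < Re (b [v, \<i> *s v])"
  shows "0 < herm_a b" "0 < herm_d b" "0 < herm_a b * herm_d b - (herm_x b)\<^sup>2 - (herm_y b)\<^sup>2"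
proof -
  let ?p = "axis 2 1 :: complex^2" and ?q = "axis 1 1 :: complex^2"
  let ?a = "herm_a b" and ?d = "herm_d b" and ?x = "herm_x b" and ?y = "herm_y b"
  have alt: "alternating_multilinear 2 b" using b by (simp add: real_11_def)
  note vals = real_11_frame_values[OF b]
  show "0 < ?a" using pos[of ?p] by (simp add: herm_a_def axis_eq_0_iff)
  show d: "0 < ?d" using pos[of ?q] by (simp add: herm_d_def axis_eq_0_iff)
  \<comment> \<open>Completing the square: this vector minimises \<open>b(v, iv)\<close> for a fixed \<open>p\<close>-component.\<close>
  let ?v = "?d *\<^sub>R ?p + (- ?y) *\<^sub>R ?q + ?x *\<^sub>R (\<i> *s ?q)"
  have iv: "\<i> *s ?v = ?d *\<^sub>R (\<i> *s ?p) + (- ?y) *\<^sub>R (\<i> *s ?q) + (- ?x) *\<^sub>R ?q"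
    by (simp add: vec_eq_iff forall_2 axis_def complex_eq_iff)
  have rev: "b [?q, \<i> *s ?p] = of_real ?y" "b [\<i> *s ?q, \<i> *s ?p] = - of_real ?x" "b [\<i> *s ?q, ?q] = - of_real ?d"
    "b [?q, ?q] = 0" "b [\<i> *s ?q, \<i> *s ?q] = 0"
    using alternating_2(4)[OF alt, where v = "\<i> *s ?p" and w = ?q] alternating_2(4)[OF alt, where v = "\<i> *s ?p" and w = "\<i> *s ?q"]
      alternating_2(4)[OF alt, where v = ?q and w = "\<i> *s ?q"] by (simp_all add: vals alternating_2(3)[OF alt])
  have "b [?v, \<i> *s ?v] = of_real (?d * (?a * ?d - ?x\<^sup>2 - ?y\<^sup>2))"
    unfolding iv
    by (simp only: linear_add[OF alternating_2(1)[OF alt]] linear_add[OF alternating_2(2)[OF alt]]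
        linear_scale[OF alternating_2(1)[OF alt]] linear_scale[OF alternating_2(2)[OF alt]] vals rev)
      (simp add: scaleR_conv_of_real algebra_simps power2_eq_square)
  moreover have "?v \<noteq> 0"
  proof
    assume "?v = 0"
    then have "?v $ 2 = 0" by (metis zero_index)
    then show False using d by (simp add: axis_def)
  qed
  ultimately have "0 < ?d * (?a * ?d - ?x\<^sup>2 - ?y\<^sup>2)" using pos[of ?v] by (metis Re_complex_of_real)
  then show "0 < ?a * ?d - ?x\<^sup>2 - ?y\<^sup>2" using d by (simp add: zero_less_mult_iff)
qed

text \<open>The reversed Cauchy--Schwarz inequality in a time cone, by a sum of squares.\<close>

lemma reversed_cauchy_schwarz:
  fixes a d x y a' d' x' y' D D' :: real
  assumes a: "0 < a" "0 < a'" and D: "0 < D" "0 < D'" "D\<^sup>2 = a * d - x\<^sup>2 - y\<^sup>2" "D'\<^sup>2 = a' * d' - x'\<^sup>2 - y'\<^sup>2"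
  defines "N \<equiv> a * d' + a' * d - 2 * (x * x') - 2 * (y * y')"
  shows "2 * (D * D') \<le> N"
    and "N = 2 * (D * D') \<Longrightarrow> a = D / D' * a' \<and> d = D / D' * d' \<and> x = D / D' * x' \<and> y = D / D' * y'"
proof -
  have ad: "a * d = D\<^sup>2 + x\<^sup>2 + y\<^sup>2" "a' * d' = D'\<^sup>2 + x'\<^sup>2 + y'\<^sup>2" using D by simp_all
  have "a * a' * N = a\<^sup>2 * (a' * d') + a'\<^sup>2 * (a * d) - 2 * a * a' * (x * x' + y * y')"
    by (simp add: N_def algebra_simps power2_eq_square)
  then have sq: "a * a' * (N - 2 * (D * D')) = (a * D' - a' * D)\<^sup>2 + (a * x' - a' * x)\<^sup>2 + (a * y' - a' * y)\<^sup>2"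
    unfolding ad by (simp add: algebra_simps power2_eq_square)
  have "0 \<le> a * a' * (N - 2 * (D * D'))" unfolding sq by simp
  then show "2 * (D * D') \<le> N"
    using mult_pos_neg[OF mult_pos_pos[OF a], of "N - 2 * (D * D')"] by (auto simp: not_less[symmetric])
  assume "N = 2 * (D * D')"
  then have "(a * D' - a' * D)\<^sup>2 + (a * x' - a' * x)\<^sup>2 + (a * y' - a' * y)\<^sup>2 = 0" using sq by simp
  then have eqs: "a * D' = a' * D" "a * x' = a' * x" "a * y' = a' * y"
    by (simp_all add: add_nonneg_eq_0_iff)
  have 1: "a = D / D' * a'" using eqs(1) D by (simp add: field_simps)
  have 2: "x = D / D' * x'" "y = D / D' * y'" using eqs(2,3) a D unfolding 1 by (simp_all add: field_simps)
  have "a * d = (D / D')\<^sup>2 * (a' * d')" unfolding ad 2 using D(1,2) by (simp add: field_simps power2_eq_square)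
  also have "\<dots> = D / D' * a' * (D / D' * d')" by (simp add: power2_eq_square)
  also have "\<dots> = a * (D / D' * d')" using 1 by simp
  finally have "a * d = a * (D / D' * d')" .
  then have "d = D / D' * d'" using a(1) mult_left_cancel[of a] by (metis less_irrefl)
  with 1 2 show "a = D / D' * a' \<and> d = D / D' * d' \<and> x = D / D' * x' \<and> y = D / D' * y'" by blast
qed

text \<open>A nonzero vector of the closed light cone pairs positively with the interior of the time cone.\<close>

lemma light_cone_pairing:
  fixes a d x y a' d' x' y' :: real
  assumes nn: "0 \<le> a" "0 \<le> d" "a * d = x\<^sup>2 + y\<^sup>2" and pos: "0 < a'" "0 < d'" "x'\<^sup>2 + y'\<^sup>2 < a' * d'"
  defines "N \<equiv> a * d' + a' * d - 2 * (x * x') - 2 * (y * y')"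
  shows "0 \<le> N" "N = 0 \<Longrightarrow> a = 0 \<and> d = 0"
proof -
  have "0 \<le> N \<and> (N = 0 \<longrightarrow> a = 0 \<and> d = 0)"
  proof (cases "a = 0")
    case True
    then have "x = 0" "y = 0" using nn(3) by (simp_all add: add_nonneg_eq_0_iff)
    then show ?thesis using True nn pos by (simp add: N_def)
  next
    case False
    have "a * a' * N = a\<^sup>2 * (a' * d') + a'\<^sup>2 * (a * d) - 2 * a * a' * (x * x' + y * y')"
      by (simp add: N_def algebra_simps power2_eq_square)
    also have "\<dots> = a\<^sup>2 * (a' * d' - x'\<^sup>2 - y'\<^sup>2) + (a * x' - a' * x)\<^sup>2 + (a * y' - a' * y)\<^sup>2"
      unfolding nn(3) by (simp add: algebra_simps power2_eq_square)
    also have "\<dots> > 0" using False pos(3) by (intro add_pos_nonneg mult_pos_pos) auto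
    finally have "0 < a * a' * N" .
    moreover have "0 < a * a'" using False nn(1) pos(1) by simp
    ultimately have "0 < N" by (simp only: zero_less_mult_pos)
    then show ?thesis by simp
  qed
  then show "0 \<le> N" "N = 0 \<Longrightarrow> a = 0 \<and> d = 0" by blast+
qed

section \<open>The dilaton function\<close>

text \<open>The factor \<open>k\<close> does not depend on the form: it is the determinant of the map that takes the frame
  to \<open>vs\<close>.\<close>

lemma alternating_4_proportional:
  fixes vs :: "(complex^2) list"
  assumes "length vs = 4"
  obtains k :: real where "\<And>a. alternating_multilinear 4 a \<Longrightarrow> a vs = k *\<^sub>R a frame"
proof -
  obtain p q r s where vs: "vs = [p, q, r, s]" using assms by (auto simp: length_Suc_conv numeral_eq_Suc)
  define L where "L = (\<lambda>z :: complex^2. Re (z $ 2) *\<^sub>R p + Im (z $ 2) *\<^sub>R q + Re (z $ 1) *\<^sub>R r + Im (z $ 1) *\<^sub>R s)"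
  have lin: "linear L" by (rule linearI) (auto simp: L_def algebra_simps)
  have "map L frame = vs" by (simp add: L_def frame_2 vs axis_def)
  with alternating_form_det[OF _ lin] show thesis using that by metis
qed

lemma wedge_power_1:
  assumes "is_form A 2 \<omega>"
  shows "wedge_power \<omega> 1 = \<omega>"
proof (intro ext)
  fix c z vs
  show "wedge_power \<omega> 1 c z vs = \<omega> c z vs"
  proof (cases "length vs = 2")
    case True
    then obtain v w where vs: "vs = [v, w]" by (auto simp: length_Suc_conv numeral_2_eq_2)
    have m: "map (\<lambda>i. vs ! s i) [0..<2] = [vs ! s 0, vs ! s 1]" for s by (simp add: upt_rec)
    have "wedge_power \<omega> 1 c z vs
        = (\<Sum>s | s permutes {..<2}. of_int (sign s) * \<omega> c z [vs ! s 0, vs ! s 1]) / 2"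
      using True by (simp add: wedge_def m fact_numeral)
    also have "\<dots> = (\<omega> c z [v, w] - \<omega> c z [w, v]) / 2"
      unfolding sum_permutations_2[of "\<lambda>i j. \<omega> c z [vs ! i, vs ! j]"] by (simp add: vs)
    also have "\<dots> = \<omega> c z [v, w]"
    proof (cases "c \<in> A \<and> z \<in> cimg c")
      case True
      then have "alternating_multilinear 2 (\<omega> c z)" using is_form_alternating[OF assms] by blast
      from alternating_2(4)[OF this, where v = v and w = w] show ?thesis by simp
    next
      case False
      then have "\<omega> c z us = 0" for us using is_form_outside[OF assms, of c z us] by blast
      then show ?thesis by simp
    qed
    finally show ?thesis by (simp add: vs)
  next
    case False
    then show ?thesis using is_form_outside[OF assms, of c z vs] by (simp add: wedge_def)
  qed
qed

lemma top_power_eq: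
  fixes \<omega> :: "('x, 2) dform"
  assumes \<omega>: "is_form A 2 \<omega>"
  shows "top_power \<omega> c z vs = wedge 2 2 \<omega> \<omega> c z vs / 2"
proof -
  have "wedge_power \<omega> 2 = wedge 2 (2 * 1) \<omega> (wedge_power \<omega> 1)"
    by (simp only: wedge_power.simps(2)[symmetric] Suc_1)
  then have "wedge_power \<omega> 2 = wedge 2 2 \<omega> \<omega>" unfolding wedge_power_1[OF \<omega>] by simp
  then show ?thesis by (simp add: top_power_def form_scale_def fact_numeral)
qed

lemma wedge_length: "length vs \<noteq> k + l \<Longrightarrow> wedge k l \<alpha> \<beta> c z vs = 0"
  by (simp add: wedge_def)

text \<open>The discriminant \<open>b \<and> b / 2\<close>, so \<open>herm_det\<close> is the volume density of a hermitian form.\<close>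

definition herm_det :: "((complex^2) list \<Rightarrow> complex) \<Rightarrow> real" where
  "herm_det b = herm_a b * herm_d b - (herm_x b)\<^sup>2 - (herm_y b)\<^sup>2"

lemma mixed_disc_same: "mixed_disc b b = 2 * herm_det b"
  by (simp add: mixed_disc_def herm_det_def power2_eq_square)

lemma frechet_derivative_cong_open:
  assumes "open U" "z \<in> U" "\<And>y. y \<in> U \<Longrightarrow> f y = g y"
  shows "frechet_derivative f (at z) = frechet_derivative g (at z)"
proof -
  have "(f has_derivative L) (at z) \<longleftrightarrow> (g has_derivative L) (at z)" for L
    using has_derivative_transform_within_open[OF _ assms(1,2), of f L UNIV g]
      has_derivative_transform_within_open[OF _ assms(1,2), of g L UNIV f] assms(3) by auto
  then show ?thesis by (simp add: frechet_derivative_def)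
qed

lemma alternating_1I:
  fixes a :: "(complex^'n) list \<Rightarrow> complex"
  assumes "linear (\<lambda>v. a [v])"
  shows "alternating_multilinear 1 a"
  unfolding alternating_multilinear_def
proof (intro conjI allI impI)
  fix vs :: "(complex^'n) list" and i :: nat assume "length vs = 1" "i < 1"
  then obtain x where "vs = [x]" "i = 0" by (auto simp: length_Suc_conv)
  then show "linear (\<lambda>v. a (vs[i := v]))" using assms by simp
qed auto

lemma ext_dc_3:
  assumes "z \<in> cimg c"
  shows "ext_dc \<omega> c z [u, v, w] = - (frechet_derivative (\<lambda>y. \<omega> c y [v, w]) (at z) (\<i> *s u)
    - frechet_derivative (\<lambda>y. \<omega> c y [u, w]) (at z) (\<i> *s v) + frechet_derivative (\<lambda>y. \<omega> c y [u, v]) (at z) (\<i> *s w))"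
  using assms
  by (simp add: ext_dc_def form_scale_def form_diff_def del_def delbar_def local_del_def local_delbar_def
      dir_del_def dir_delbar_def drop_nth_def numeral_3_eq_3 field_simps)

context surface
begin

lemma wedge22_top_density:
  assumes \<omega>: "is_form A 2 \<omega>" and \<Psi>: "is_form A 2 \<Psi>"
  shows "top_density (\<lambda>c z. wedge22 (\<omega> c z) (\<Psi> c z))"
  unfolding top_density_def
proof (intro conjI ballI)
  fix c assume c: "c \<in> A"
  have *: "continuous_on (cimg c) (\<lambda>z. \<omega> c z [v, w])" "continuous_on (cimg c) (\<lambda>z. \<Psi> c z [v, w])" for v w
    by (intro smooth_on_continuous is_form_smooth[OF \<omega> c] is_form_smooth[OF \<Psi> c]; simp)+
  show "continuous_on (cimg c) (\<lambda>z. wedge22 (\<omega> c z) (\<Psi> c z) frame)"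
    unfolding wedge22_def by (intro continuous_on_add continuous_on_diff continuous_on_mult *)
  fix z assume "z \<in> cimg c"
  then show "alternating_multilinear 4 (wedge22 (\<omega> c z) (\<Psi> c z))"
    by (intro wedge22_alternating is_form_alternating[OF \<omega> c] is_form_alternating[OF \<Psi> c])
next
  fix c c' z assume c: "c \<in> A" "c' \<in> A" and z: "z \<in> overlap c c'"
  let ?J = "jac c c' z" and ?z = "transition c c' z"
  show "wedge22 (\<omega> c' ?z) (\<Psi> c' ?z) (map ?J frame) = wedge22 (\<omega> c z) (\<Psi> c z) frame"
  proof (rule wedge22_map[OF length_frame_2])
    show "\<omega> c' ?z [?J v, ?J w] = \<omega> c z [v, w]" for v w
      using is_form_transition[OF \<omega> c z, of "[v, w]"] by simp
    show "\<Psi> c' ?z [?J v, ?J w] = \<Psi> c z [v, w]" for v w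
      using is_form_transition[OF \<Psi> c z, of "[v, w]"] by simp
  qed
qed

lemma top_density_continuous: "top_density \<Theta> \<Longrightarrow> top_continuous \<Theta>"
  by (simp add: top_density_def top_continuous_def)

lemma volume_frame: "\<mu> c z frame = complex_of_real (Re (\<mu> c z frame))"
  using volume_real[of c z frame] by simp

text \<open>Both densities change by the same determinant.\<close>

lemma top_density_proportional:
  assumes \<Theta>: "top_density \<Theta>" and c: "c \<in> A" "c' \<in> A" and z: "z \<in> overlap c c'"
  shows "\<Theta> c z frame * \<mu> c' (transition c c' z) frame = \<Theta> c' (transition c c' z) frame * \<mu> c z frame"
proof -
  let ?J = "jac c c' z" and ?z = "transition c c' z"
  have lin: "linear ?J" using jac_derivative(1)[OF c z] has_derivative_linear by blast
  have z': "?z \<in> cimg c'" using transition_overlap(1)[OF c z] by (simp add: overlap_def)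
  have law: "X c z frame = det (matrix (\<lambda>x. complex2_to_real4 (?J (real4_to_complex2 x)))) *\<^sub>R X c' ?z frame"
    if "top_density X" for X
  proof -
    have "alternating_multilinear 4 (X c' ?z)" "X c' ?z (map ?J frame) = X c z frame"
      using that c z z' unfolding top_density_def by blast+
    with alternating_form_det[OF _ lin] show ?thesis by metis
  qed
  show ?thesis
    unfolding law[OF \<Theta>] law[OF is_form_top_density[OF volume_is_form]] by simp
qed

definition real_form_11 :: "('x, 2) dform \<Rightarrow> bool" where
  "real_form_11 \<Psi> \<longleftrightarrow> is_form A 2 \<Psi> \<and> (\<forall>c z. J_invariant (\<Psi> c z)) \<and> real_form \<Psi>"

definition hermitian :: "('x, 2) dform \<Rightarrow> bool" where
  "hermitian \<omega> \<longleftrightarrow> real_form_11 \<omega> \<and> positive_form A \<omega>"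

lemma real_form_11_at: "real_form_11 \<Psi> \<Longrightarrow> c \<in> A \<Longrightarrow> z \<in> cimg c \<Longrightarrow> real_11 (\<Psi> c z)"
  using is_form_alternating[of A 2 \<Psi> c z] unfolding real_form_11_def real_11_def real_form_def by blast

lemma real_form_11_is_form: "real_form_11 \<Psi> \<Longrightarrow> is_form A 2 \<Psi>"
  by (simp add: real_form_11_def)

lemma hermitian_real_form_11: "hermitian \<omega> \<Longrightarrow> real_form_11 \<omega>"
  by (simp add: hermitian_def)

lemma hermitian_positive:
  assumes "hermitian \<omega>" "c \<in> A" "z \<in> cimg c"
  shows "0 < herm_a (\<omega> c z)" "0 < herm_d (\<omega> c z)" "0 < herm_det (\<omega> c z)"
proof -
  have pos: "0 < Re (\<omega> c z [v, \<i> *s v])" if "v \<noteq> 0" for v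
    using assms that unfolding hermitian_def positive_form_def by blast
  note R = real_form_11_at[OF hermitian_real_form_11[OF assms(1)] assms(2,3)]
  show "0 < herm_a (\<omega> c z)" by (rule positive_real_11(1)[OF R pos])
  show "0 < herm_d (\<omega> c z)" by (rule positive_real_11(2)[OF R pos])
  show "0 < herm_det (\<omega> c z)" unfolding herm_det_def by (rule positive_real_11(3)[OF R pos])
qed

lemma herm_det_smooth:
  assumes \<omega>: "is_form A 2 \<omega>" and c: "c \<in> A"
  shows "smooth_on (cimg c) (\<lambda>z. herm_det (\<omega> c z))"
proof -
  note U = open_cimg[OF c]
  have *: "smooth_on (cimg c) (\<lambda>z. Re (\<omega> c z [v, w]))" for v w
    by (rule smooth_on_bounded_linear[OF bounded_linear_Re U]) (rule is_form_smooth[OF \<omega> c], simp)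
  show ?thesis
    unfolding herm_det_def herm_a_def herm_d_def herm_x_def herm_y_def power2_eq_square
    by (intro smooth_on_diff[OF U] smooth_on_mult[OF U] *)
qed

text \<open>The quotient of two 4-forms is a function on the manifold; it may be computed in any chart.\<close>

lemma volume_ratio_exists:
  assumes \<omega>: "hermitian \<omega>"
  obtains r where "\<And>x. 0 < r x" "\<And>k. smooth_fun A UNIV (\<lambda>x. r x powr k)"
    "\<And>c z. c \<in> A \<Longrightarrow> z \<in> cimg c \<Longrightarrow> herm_det (\<omega> c z) = r (cinv c z) * Re (\<mu> c z frame)"
proof -
  have form: "is_form A 2 \<omega>" using \<omega> by (simp add: hermitian_def real_form_11_def)
  define ch where "ch = (\<lambda>x. SOME c. c \<in> A \<and> x \<in> cdom c)"
  have ch: "ch x \<in> A" "x \<in> cdom (ch x)" for x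
    using someI_ex[of "\<lambda>c. c \<in> A \<and> x \<in> cdom c"] charts_cover[of x] unfolding ch_def by blast+
  define r where "r = (\<lambda>x. herm_det (\<omega> (ch x) (cmap (ch x) x)) / Re (\<mu> (ch x) (cmap (ch x) x) frame))"
  have pos: "0 < r x" for x
    unfolding r_def using hermitian_positive(3)[OF \<omega> ch(1) cmap_in_cimg[OF ch(2)]] volume_pos[OF ch(1) cmap_in_cimg[OF ch(2)]]
    by simp
  have eq: "herm_det (\<omega> c z) = r (cinv c z) * Re (\<mu> c z frame)" if c: "c \<in> A" and z: "z \<in> cimg c" for c z
  proof -
    let ?x = "cinv c z"
    let ?d = "ch ?x"
    have ov: "z \<in> overlap c ?d" using z ch(2) by (simp add: overlap_def)
    have tr: "transition c ?d z = cmap ?d ?x" by (simp add: transition_def)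
    have w: "wedge22 (\<omega> c z) (\<omega> c z) frame = of_real (2 * herm_det (\<omega> c z))" if "c \<in> A" "z \<in> cimg c" for c z
      using wedge22_real_11[OF real_form_11_at[OF hermitian_real_form_11[OF \<omega>] that] real_form_11_at[OF hermitian_real_form_11[OF \<omega>] that]]
      by (simp add: mixed_disc_same)
    from top_density_proportional[OF wedge22_top_density[OF form form] c ch(1) ov]
    have "of_real (2 * herm_det (\<omega> c z)) * \<mu> ?d (cmap ?d ?x) frame
        = of_real (2 * herm_det (\<omega> ?d (cmap ?d ?x))) * \<mu> c z frame"
      unfolding tr w[OF c z] w[OF ch(1) cmap_in_cimg[OF ch(2)]] .
    then have "2 * herm_det (\<omega> c z) * Re (\<mu> ?d (cmap ?d ?x) frame)
        = 2 * herm_det (\<omega> ?d (cmap ?d ?x)) * Re (\<mu> c z frame)"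
      by (subst (asm) (1 2) volume_frame) (simp only: of_real_mult[symmetric] of_real_eq_iff)
    then show ?thesis
      using volume_pos[OF ch(1) cmap_in_cimg[OF ch(2)], of ?x] by (simp add: r_def field_simps)
  qed
  have "smooth_fun A UNIV (\<lambda>x. r x powr k)" for k
    unfolding smooth_fun_iff
  proof
    fix c assume c: "c \<in> A"
    note U = open_cimg[OF c]
    have m: "smooth_on (cimg c) (\<lambda>z. Re (\<mu> c z frame))"
      by (rule smooth_on_bounded_linear[OF bounded_linear_Re U]) (rule is_form_smooth[OF volume_is_form c length_frame_2])
    have "smooth_on (cimg c) (\<lambda>z. herm_det (\<omega> c z) * Re (\<mu> c z frame) powr - 1)"
      by (intro smooth_on_mult[OF U] herm_det_smooth[OF form c] smooth_on_powr[OF U m] volume_pos[OF c])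
    then have "smooth_on (cimg c) (\<lambda>z. r (cinv c z))"
    proof (rule smooth_on_cong[OF U])
      fix z assume z: "z \<in> cimg c"
      show "herm_det (\<omega> c z) * Re (\<mu> c z frame) powr - 1 = r (cinv c z)"
        using volume_pos[OF c z] by (simp add: eq[OF c z] powr_minus)
    qed
    then show "smooth_on (cimg c) (\<lambda>z. r (cinv c z) powr k)" by (rule smooth_on_powr[OF U]) (rule pos)
  qed
  with pos eq show thesis using that by blast
qed

text \<open>The dilaton function is half the logarithm of the volume ratio. Its defining equation on arbitrary
  vectors reduces to the frame, since both sides are 4-forms.\<close>

lemma dilaton_characterization:
  assumes \<omega>: "hermitian \<omega>"
  shows "c \<in> A \<Longrightarrow> z \<in> cimg c \<Longrightarrow> herm_det (\<omega> c z) = exp (2 * dilaton \<mu> A \<omega> (cinv c z)) * Re (\<mu> c z frame)"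
    and "smooth_fun A UNIV (\<lambda>x. exp (k * dilaton \<mu> A \<omega> x))"
proof -
  have form: "is_form A 2 \<omega>" using \<omega> by (simp add: hermitian_def real_form_11_def)
  obtain r where r: "\<And>x. 0 < r x" "\<And>k. smooth_fun A UNIV (\<lambda>x. r x powr k)"
    "\<And>c z. c \<in> A \<Longrightarrow> z \<in> cimg c \<Longrightarrow> herm_det (\<omega> c z) = r (cinv c z) * Re (\<mu> c z frame)"
    by (rule volume_ratio_exists[OF \<omega>]) (rule that)
  define g where "g = (\<lambda>x. ln (r x) / 2)"
  have g: "exp (2 * g x) = r x" for x using r(1) by (simp add: g_def)
  have top: "top_power \<omega> c z vs = k * of_real (herm_det (\<omega> c z))"
    if c: "c \<in> A" "z \<in> cimg c" and "length vs = 4"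
      and k: "\<And>a. alternating_multilinear 4 a \<Longrightarrow> a vs = k * a frame" for c z vs k
  proof -
    have alt: "alternating_multilinear 2 (\<omega> c z)" by (rule is_form_alternating[OF form c])
    have "top_power \<omega> c z vs = wedge22 (\<omega> c z) (\<omega> c z) vs / 2"
      using wedge_2_2[where \<alpha> = \<omega> and \<beta> = \<omega> and c = c and z = z, OF alt alt \<open>length vs = 4\<close>] by (simp add: top_power_eq[OF form])
    also have "wedge22 (\<omega> c z) (\<omega> c z) vs = k * of_real (2 * herm_det (\<omega> c z))"
      using k[OF wedge22_alternating[OF alt alt]] real_form_11_at[OF hermitian_real_form_11[OF \<omega>] c]
      by (simp add: wedge22_real_11 mixed_disc_same)
    finally show ?thesis by simp
  qed
  have "dilaton \<mu> A \<omega> = g"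
    unfolding dilaton_def
  proof (rule the_equality)
    show "\<forall>c\<in>A. \<forall>z\<in>cimg c. \<forall>vs. top_power \<omega> c z vs = fun_mult (\<lambda>x. exp (2 * g x)) \<mu> c z vs"
    proof (intro ballI allI)
      fix c z vs assume c: "c \<in> A" "z \<in> cimg c"
      show "top_power \<omega> c z vs = fun_mult (\<lambda>x. exp (2 * g x)) \<mu> c z vs"
      proof (cases "length vs = 4")
        case True
        obtain k :: real where k: "\<And>a. alternating_multilinear 4 a \<Longrightarrow> a vs = k *\<^sub>R a frame"
          using alternating_4_proportional[OF True] by blast
        have k': "a vs = of_real k * a frame" if "alternating_multilinear 4 a" for a
          using k[OF that] by (simp add: scaleR_conv_of_real)
        have "\<mu> c z vs = of_real k * of_real (Re (\<mu> c z frame))"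
          using k'[OF is_form_alternating[OF volume_is_form c]] volume_frame by metis
        moreover have "top_power \<omega> c z vs = of_real k * of_real (herm_det (\<omega> c z))"
          by (rule top[OF c True]) (rule k')
        ultimately show ?thesis
          unfolding fun_mult_def g r(3)[OF c] by (simp add: mult_ac)
      next
        case False
        then show ?thesis
          using is_form_outside[OF volume_is_form, of c z vs]
          by (simp add: top_power_eq[OF form] wedge_length fun_mult_def)
      qed
    qed
  next
    fix f assume f: "\<forall>c\<in>A. \<forall>z\<in>cimg c. \<forall>vs. top_power \<omega> c z vs = fun_mult (\<lambda>x. exp (2 * f x)) \<mu> c z vs"
    show "f = g"
    proof
      fix x
      obtain c where c: "c \<in> A" "x \<in> cdom c" using charts_cover by blast
      let ?z = "cmap c x"
      have z: "?z \<in> cimg c" by (rule cmap_in_cimg[OF c(2)])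
      have "top_power \<omega> c ?z frame = of_real (herm_det (\<omega> c ?z))"
        using top[OF c(1) z length_frame_2, of 1] by simp
      then have "of_real (herm_det (\<omega> c ?z)) = complex_of_real (exp (2 * f x)) * \<mu> c ?z frame"
        using f c(1) z by (simp add: fun_mult_def cinv_cmap[OF c])
      then have "herm_det (\<omega> c ?z) = exp (2 * f x) * Re (\<mu> c ?z frame)"
        by (subst (asm) volume_frame) (simp only: of_real_mult[symmetric] of_real_eq_iff)
      then have "exp (2 * f x) = exp (2 * g x)"
        using r(3)[OF c(1) z] volume_pos[OF c(1) z] by (simp add: g cinv_cmap[OF c])
      then show "f x = g x" by simp
    qed
  qed
  then have d: "dilaton \<mu> A \<omega> x = ln (r x) / 2" for x by (simp add: g_def)
  show "herm_det (\<omega> c z) = exp (2 * dilaton \<mu> A \<omega> (cinv c z)) * Re (\<mu> c z frame)" if "c \<in> A" "z \<in> cimg c"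
    using r(3)[OF that] r(1) by (simp add: d)
  have "exp (k * dilaton \<mu> A \<omega> x) = r x powr (k / 2)" for x
    using r(1)[of x] by (simp add: d powr_def)
  then show "smooth_fun A UNIV (\<lambda>x. exp (k * dilaton \<mu> A \<omega> x))" using r(2) by simp
qed

lemma is_form_fun_mult:
  assumes g: "smooth_fun A UNIV g" and \<alpha>: "is_form A k \<alpha>"
  shows "is_form A k (fun_mult g \<alpha>)"
  unfolding is_form_def
proof (intro conjI ballI allI impI)
  fix c z vs assume "fun_mult g \<alpha> c z vs \<noteq> 0"
  then have "\<alpha> c z vs \<noteq> 0" by (simp add: fun_mult_def)
  then show "c \<in> A" "z \<in> cimg c" "length vs = k" using is_form_outside[OF \<alpha>, of c z vs] by blast+
next
  fix c z assume "c \<in> A" "z \<in> cimg c"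
  then show "alternating_multilinear k (fun_mult g \<alpha> c z)"
    unfolding fun_mult_def by (intro alternating_scale is_form_alternating[OF \<alpha>])
next
  fix c and vs :: "(complex^2) list" assume c: "c \<in> A" and "length vs = k"
  then show "smooth_on (cimg c) (\<lambda>z. fun_mult g \<alpha> c z vs)"
    unfolding fun_mult_def
    by (intro smooth_on_mult[OF open_cimg[OF c]] smooth_fun_chart_of_real[OF g c] is_form_smooth[OF \<alpha> c])
next
  fix c c' z and vs :: "(complex^2) list"
  assume c: "c \<in> A" "c' \<in> A" and "z \<in> cmap c ` (cdom c \<inter> cdom c')" and vs: "length vs = k"
  then have z: "z \<in> overlap c c'" using overlap_image[OF c(1)] by blast
  show "fun_mult g \<alpha> c' (transition c c' z) (map (jac c c' z) vs) = fun_mult g \<alpha> c z vs"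
    unfolding fun_mult_def is_form_transition[OF \<alpha> c z vs] transition_overlap(2)[OF c z] ..
qed

lemma real_form_11_fun_mult:
  "smooth_fun A UNIV g \<Longrightarrow> real_form_11 \<Psi> \<Longrightarrow> real_form_11 (fun_mult g \<Psi>)"
  using is_form_fun_mult[of g 2 \<Psi>]
  unfolding real_form_11_def J_invariant_def real_form_def fun_mult_def by (simp add: Reals_mult)

lemma form_differentiable:
  "is_form A k \<alpha> \<Longrightarrow> c \<in> A \<Longrightarrow> z \<in> cimg c \<Longrightarrow> length vs = k \<Longrightarrow> (\<lambda>y. \<alpha> c y vs) differentiable (at z)"
  using smooth_on_has_derivative[OF is_form_smooth] differentiableI by blast

text \<open>\<open>\<partial>\<alpha>\<close> may be replaced by \<open>d\<alpha>\<close> in the pairing with a form of type \<open>(1,1)\<close>, since the missing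
  part has type \<open>(0,2)\<close>; then Stokes' theorem applies.\<close>

lemma aeppli_pairing:
  assumes \<Psi>: "real_form_11 \<Psi>" and closed: "\<And>c z u v w. c \<in> A \<Longrightarrow> z \<in> cimg c \<Longrightarrow> local_d (\<Psi> c) z [u, v, w] = 0"
    and \<tau>: "is_form A 2 \<tau>" and \<omega>: "is_form A 2 \<omega>" and zero: "aeppli_zero A (form_diff \<tau> \<omega>)"
  shows "form_integral A (\<lambda>c z. wedge22 (\<tau> c z) (\<Psi> c z)) = form_integral A (\<lambda>c z. wedge22 (\<omega> c z) (\<Psi> c z))"
proof -
  have \<Psi>2: "is_form A 2 \<Psi>" by (rule real_form_11_is_form[OF \<Psi>])
  obtain \<alpha> \<beta> where \<alpha>: "form_of_type A 0 1 \<alpha>" and \<beta>: "form_of_type A 1 0 \<beta>"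
    and eq: "form_diff \<tau> \<omega> = form_add (del \<alpha>) (delbar \<beta>)"
    using zero unfolding aeppli_zero_def by blast
  have \<alpha>1: "is_form A 1 \<alpha>" and \<beta>1: "is_form A 1 \<beta>" using \<alpha> \<beta> by (simp_all add: form_of_type_def)
  let ?X = "\<lambda>c z vs. wedge22 (\<tau> c z) (\<Psi> c z) vs - wedge22 (\<omega> c z) (\<Psi> c z) vs"
  let ?W = "\<lambda>\<alpha> c z. wedge22 (local_d (\<alpha> c) z) (\<Psi> c z)"
  have cW: "top_continuous (?W \<alpha>)" if "is_form A 1 \<alpha>" for \<alpha>
    unfolding top_continuous_def wedge22_def
    by (intro ballI continuous_on_add continuous_on_diff continuous_on_mult continuous_on_local_d[OF that]
        smooth_on_continuous is_form_smooth[OF \<Psi>2]) auto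
  have c\<tau>: "top_continuous (\<lambda>c z. wedge22 (\<tau> c z) (\<Psi> c z))" and c\<omega>: "top_continuous (\<lambda>c z. wedge22 (\<omega> c z) (\<Psi> c z))"
    by (intro top_density_continuous wedge22_top_density \<tau> \<omega> \<Psi>2)+
  have cX: "top_continuous ?X"
    using c\<tau> c\<omega> unfolding top_continuous_def by (intro ballI continuous_on_diff) auto
  have "?X c z frame - ?W \<alpha> c z frame = ?W \<beta> c z frame" if c: "c \<in> A" and z: "z \<in> cimg c" for c z
  proof -
    have \<Psi>z: "alternating_multilinear 2 (\<Psi> c z)" "J_invariant (\<Psi> c z)"
      using real_form_11_at[OF \<Psi> c z] by (simp_all add: real_11_def)
    have d\<alpha>: "(\<lambda>y. \<alpha> c y [v]) differentiable (at z)" and d\<beta>: "(\<lambda>y. \<beta> c y [v]) differentiable (at z)" for v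
      by (rule form_differentiable[OF \<alpha>1 c z] form_differentiable[OF \<beta>1 c z], simp)+
    have "\<tau> c z vs - \<omega> c z vs = local_del (\<alpha> c) z vs + local_delbar (\<beta> c) z vs" for vs
      using fun_cong[OF fun_cong[OF fun_cong[OF eq, of c], of z], of vs] z
      by (simp add: form_diff_def form_add_def del_def delbar_def)
    then have t: "\<tau> c z [v, w] = \<omega> c z [v, w] + 1 * (local_del (\<alpha> c) z [v, w] + local_delbar (\<beta> c) z [v, w])" for v w
      by (metis add.commute diff_add_cancel mult_1)
    have X: "?X c z frame = wedge22 (\<lambda>vs. local_del (\<alpha> c) z vs + local_delbar (\<beta> c) z vs) (\<Psi> c z) frame"
    proof -
      have "wedge22 (\<tau> c z) (\<Psi> c z) frame = wedge22 (\<omega> c z) (\<Psi> c z) frame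
          + 1 * wedge22 (\<lambda>vs. local_del (\<alpha> c) z vs + local_delbar (\<beta> c) z vs) (\<Psi> c z) frame"
        by (rule wedge22_lincomb_left) (rule t)
      then show ?thesis by simp
    qed
    have X': "\<dots> = wedge22 (local_del (\<alpha> c) z) (\<Psi> c z) frame + 1 * wedge22 (local_delbar (\<beta> c) z) (\<Psi> c z) frame"
      by (rule wedge22_lincomb_left) simp
    have W\<alpha>: "?W \<alpha> c z frame = wedge22 (local_del (\<alpha> c) z) (\<Psi> c z) frame + 1 * wedge22 (local_delbar (\<alpha> c) z) (\<Psi> c z) frame"
      by (rule wedge22_lincomb_left) (simp add: local_d_eq_del_delbar)
    have W\<beta>: "?W \<beta> c z frame = wedge22 (local_del (\<beta> c) z) (\<Psi> c z) frame + 1 * wedge22 (local_delbar (\<beta> c) z) (\<Psi> c z) frame"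
      by (rule wedge22_lincomb_left) (simp add: local_d_eq_del_delbar)
    have "wedge22 (local_delbar (\<alpha> c) z) (\<Psi> c z) frame = 0"
      by (rule wedge22_type_02[where \<epsilon> = "- \<i>", OF _ _ _ \<Psi>z];
          (rule local_delbar_type_02[where \<alpha> = "\<alpha> c", OF form_of_type_01_antilinear[OF \<alpha>] d\<alpha>])?) simp
    moreover have "wedge22 (local_del (\<beta> c) z) (\<Psi> c z) frame = 0"
      by (rule wedge22_type_02[where \<epsilon> = \<i>, OF _ _ _ \<Psi>z];
          (rule local_del_type_20[where \<alpha> = "\<beta> c", OF form_of_type_10_linear[OF \<beta>] d\<beta>])?) simp
    ultimately show ?thesis unfolding X X' W\<alpha> W\<beta> by simp
  qed
  then have "form_integral A (\<lambda>c z vs. ?X c z vs - ?W \<alpha> c z vs) = form_integral A (?W \<beta>)"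
    by (rule form_integral_cong)
  also have "\<dots> = 0" by (rule integral_exact_wedge_closed[OF \<beta>1 \<Psi>2 closed])
  also have "form_integral A (\<lambda>c z vs. ?X c z vs - ?W \<alpha> c z vs) = form_integral A ?X - form_integral A (?W \<alpha>)"
    by (rule form_integral_diff[OF cX cW[OF \<alpha>1]])
  also have "form_integral A (?W \<alpha>) = 0" by (rule integral_exact_wedge_closed[OF \<alpha>1 \<Psi>2 closed])
  also have "form_integral A ?X = form_integral A (\<lambda>c z. wedge22 (\<tau> c z) (\<Psi> c z)) - form_integral A (\<lambda>c z. wedge22 (\<omega> c z) (\<Psi> c z))"
    by (rule form_integral_diff[OF c\<tau> c\<omega>])
  finally show ?thesis by simp
qed

text \<open>The reversed Cauchy--Schwarz inequality with \<open>D\<^sup>2 = exp(2f) m\<close> and \<open>D0\<^sup>2 = exp(2f0) m\<close>, where \<open>m\<close> is the density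
  of \<open>\<mu>\<close>. Equality forces proportionality with the factor \<open>D / D0\<close>.\<close>

lemma volume_density_le_mixed:
  assumes \<omega>: "hermitian \<omega>" and \<omega>0: "hermitian \<omega>0" and c: "c \<in> A" "z \<in> cimg c"
  defines "f \<equiv> dilaton \<mu> A \<omega> (cinv c z)" and "f0 \<equiv> dilaton \<mu> A \<omega>0 (cinv c z)"
  shows "2 * (exp f * Re (\<mu> c z frame)) \<le> exp (- f0) * mixed_disc (\<omega> c z) (\<omega>0 c z)"
    and "exp (- f0) * mixed_disc (\<omega> c z) (\<omega>0 c z) = 2 * (exp f * Re (\<mu> c z frame)) \<Longrightarrow>
      \<omega> c z [v, w] = of_real (exp (f - f0)) * \<omega>0 c z [v, w]"
proof -
  let ?b = "\<omega> c z" and ?bb = "\<omega>0 c z" and ?m = "Re (\<mu> c z frame)"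
  have m: "0 < ?m" by (rule volume_pos[OF c])
  define D D0 where "D = exp f * sqrt ?m" and "D0 = exp f0 * sqrt ?m"
  have D: "0 < D" "0 < D0" using m by (simp_all add: D_def D0_def)
  have sq: "D\<^sup>2 = herm_det ?b" "D0\<^sup>2 = herm_det ?bb"
    using dilaton_characterization(1)[OF \<omega> c] dilaton_characterization(1)[OF \<omega>0 c] m
    by (simp_all add: D_def D0_def f_def f0_def power_mult_distrib exp_double)
  have DD: "D * D0 = exp f0 * (exp f * ?m)" using m by (simp add: D_def D0_def)
  have quot: "D / D0 = exp (f - f0)" using m by (simp add: D_def D0_def exp_diff)
  note rcs = reversed_cauchy_schwarz[OF hermitian_positive(1)[OF \<omega> c] hermitian_positive(1)[OF \<omega>0 c] D
      sq(1)[unfolded herm_det_def] sq(2)[unfolded herm_det_def], folded mixed_disc_def]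
  have e: "exp (- f0) * (2 * (D * D0)) = 2 * (exp f * ?m)" unfolding DD by (simp add: exp_minus)
  show "2 * (exp f * ?m) \<le> exp (- f0) * mixed_disc ?b ?bb"
    unfolding e[symmetric] using rcs(1) by (intro mult_left_mono) auto
  assume "exp (- f0) * mixed_disc ?b ?bb = 2 * (exp f * ?m)"
  then have "mixed_disc ?b ?bb = 2 * (D * D0)" unfolding e[symmetric] by simp
  from rcs(2)[OF this] show "?b [v, w] = of_real (exp (f - f0)) * ?bb [v, w]"
    unfolding quot
    by (intro real_11_eq_scale real_form_11_at[OF hermitian_real_form_11[OF \<omega>] c]
        real_form_11_at[OF hermitian_real_form_11[OF \<omega>0] c]) auto
qed

end

section \<open>Pluriclosed conformal factors\<close>

context surface
begin

abbreviation chart_deriv :: "('x \<Rightarrow> real) \<Rightarrow> ('x, 2) chart \<Rightarrow> complex^2 \<Rightarrow> complex^2 \<Rightarrow> complex" where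
  "chart_deriv u c z \<equiv> frechet_derivative (\<lambda>y. complex_of_real (u (cinv c y))) (at z)"

lemma chart_deriv_linear: "smooth_fun A UNIV u \<Longrightarrow> c \<in> A \<Longrightarrow> z \<in> cimg c \<Longrightarrow> linear (chart_deriv u c z)"
  using smooth_on_has_derivative[OF smooth_fun_chart_of_real] has_derivative_linear by blast

lemma chart_deriv_real:
  assumes "smooth_fun A UNIV u" "c \<in> A" "z \<in> cimg c"
  shows "chart_deriv u c z v \<in> \<real>"
proof -
  have "((\<lambda>y. u (cinv c y)) has_derivative frechet_derivative (\<lambda>y. u (cinv c y)) (at z)) (at z)"
    using assms by (intro smooth_on_has_derivative) (auto simp: smooth_fun_iff)
  from bounded_linear.has_derivative[OF bounded_linear_of_real this]
  have "((\<lambda>y. complex_of_real (u (cinv c y))) has_derivative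
      (\<lambda>v. complex_of_real (frechet_derivative (\<lambda>y. u (cinv c y)) (at z) v))) (at z)" .
  from fun_cong[OF frechet_derivative_at[OF this], of v] show ?thesis by (metis Reals_of_real)
qed

text \<open>The 1-form \<open>d\<^sup>c u\<close>, extended by 0 off the atlas as forms are.\<close>

definition dc_fun :: "('x \<Rightarrow> real) \<Rightarrow> ('x, 2) dform" where
  "dc_fun u c z vs = (if c \<in> A \<and> z \<in> cimg c \<and> length vs = 1 then - chart_deriv u c z (\<i> *s (vs ! 0)) else 0)"

lemma linear_smult_i: "linear (\<lambda>v :: complex^'n. \<i> *s v)"
  by (rule linearI) (auto simp: vec_eq_iff algebra_simps)

lemma dc_fun_is_form:
  assumes u: "smooth_fun A UNIV u"
  shows "is_form A 1 (dc_fun u)"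
  unfolding is_form_def
proof (intro conjI ballI allI impI)
  fix c z vs assume "dc_fun u c z vs \<noteq> 0"
  then show "c \<in> A" "z \<in> cimg c" "length vs = 1" by (auto simp: dc_fun_def split: if_splits)
next
  fix c z assume c: "c \<in> A" "z \<in> cimg c"
  have "linear (\<lambda>v. - chart_deriv u c z (\<i> *s v))"
    using linear_compose_neg[OF linear_compose[OF linear_smult_i chart_deriv_linear[OF u c]]] by (simp add: o_def)
  then show "alternating_multilinear 1 (dc_fun u c z)"
    by (intro alternating_1I) (simp add: dc_fun_def c)
next
  fix c and vs :: "(complex^2) list" assume c: "c \<in> A" and vs: "length vs = 1"
  have "smooth_on (cimg c) (\<lambda>z. - chart_deriv u c z (\<i> *s (vs ! 0)))"
    by (rule smooth_on_bounded_linear[OF bounded_linear_minus[OF bounded_linear_ident] open_cimg[OF c]])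
      (rule smooth_on_derivative[OF smooth_fun_chart_of_real[OF u c]])
  then show "smooth_on (cimg c) (\<lambda>z. dc_fun u c z vs)"
    by (rule smooth_on_cong[OF open_cimg[OF c]]) (simp add: dc_fun_def c vs)
next
  fix c c' z and vs :: "(complex^2) list"
  assume c: "c \<in> A" "c' \<in> A" and "z \<in> cmap c ` (cdom c \<inter> cdom c')" and vs: "length vs = 1"
  then have z: "z \<in> overlap c c'" using overlap_image[OF c(1)] by blast
  have zz: "z \<in> cimg c" "transition c c' z \<in> cimg c'"
    using z transition_overlap(1)[OF c z] by (simp_all add: overlap_def)
  obtain v where vs': "vs = [v]" using vs by (auto simp: length_Suc_conv)
  show "dc_fun u c' (transition c c' z) (map (jac c c' z) vs) = dc_fun u c z vs"
    using c zz chain_rule_transition[OF c z smooth_fun_chart_of_real[OF u c(2)], of "\<i> *s v"]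
    by (simp add: dc_fun_def vs' jac_derivative(2)[OF c z])
qed

lemma dc_fun_at: "c \<in> A \<Longrightarrow> z \<in> cimg c \<Longrightarrow> dc_fun u c z [v] = - chart_deriv u c z (\<i> *s v)"
  by (simp add: dc_fun_def)

text \<open>The form \<open>du \<and> d\<^sup>cu\<close>. It has rank one and so lies on the closed light cone.\<close>

definition gradient_form :: "('x \<Rightarrow> real) \<Rightarrow> ('x, 2) dform" where
  "gradient_form u = dwedge u (dc_fun u)"

lemma gradient_form_at:
  assumes "c \<in> A" "z \<in> cimg c"
  shows "gradient_form u c z [v, w] =
    chart_deriv u c z (\<i> *s v) * chart_deriv u c z w - chart_deriv u c z v * chart_deriv u c z (\<i> *s w)"
  by (simp add: gradient_form_def dwedge_def dc_fun_at[OF assms])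

lemma gradient_form_real_11:
  assumes u: "smooth_fun A UNIV u" and c: "c \<in> A" "z \<in> cimg c"
  shows "real_11 (gradient_form u c z)"
  unfolding real_11_def
proof (intro conjI allI)
  show "alternating_multilinear 2 (gradient_form u c z)"
    unfolding gradient_form_def by (rule dwedge_alternating[OF u dc_fun_is_form[OF u] c])
  note neg = linear_neg[OF chart_deriv_linear[OF u c]]
  show "J_invariant (gradient_form u c z)"
    unfolding J_invariant_def gradient_form_at[OF c] smult_i_i neg by simp
  have "dc_fun u c z [v] \<in> \<real>" for v
    unfolding dc_fun_at[OF c] by (intro Reals_minus chart_deriv_real[OF u c])
  then show "gradient_form u c z vs \<in> \<real>" for vs
    unfolding gradient_form_def dwedge_def by (intro Reals_diff Reals_mult chart_deriv_real[OF u c])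
qed

lemma gradient_form_light_cone:
  assumes u: "smooth_fun A UNIV u" and c: "c \<in> A" "z \<in> cimg c"
    and b: "0 < herm_a b" "0 < herm_d b" "0 < herm_det b"
  shows "0 \<le> mixed_disc (gradient_form u c z) b"
    and "mixed_disc (gradient_form u c z) b = 0 \<Longrightarrow> chart_deriv u c z v = 0"
proof -
  let ?D = "chart_deriv u c z" and ?e = "gradient_form u c z"
  define R where "R = (\<lambda>v. Re (?D v))"
  have DR: "?D v = of_real (R v)" for v using chart_deriv_real[OF u c, of v] by (simp add: R_def)
  note lin = chart_deriv_linear[OF u c]
  have neg: "R (- v) = - R v" for v using linear_neg[OF lin] by (simp add: R_def)
  let ?p = "axis 2 1 :: complex^2" and ?q = "axis 1 1 :: complex^2"
  have vals: "herm_a ?e = (R ?p)\<^sup>2 + (R (\<i> *s ?p))\<^sup>2" "herm_d ?e = (R ?q)\<^sup>2 + (R (\<i> *s ?q))\<^sup>2"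
    "herm_x ?e = R (\<i> *s ?p) * R ?q - R ?p * R (\<i> *s ?q)" "herm_y ?e = R (\<i> *s ?p) * R (\<i> *s ?q) + R ?p * R ?q"
    unfolding herm_a_def herm_d_def herm_x_def herm_y_def gradient_form_at[OF c] smult_i_i DR neg
    by (simp_all add: power2_eq_square)
  have light: "herm_a ?e * herm_d ?e = (herm_x ?e)\<^sup>2 + (herm_y ?e)\<^sup>2"
    unfolding vals by (simp add: power2_eq_square algebra_simps)
  have nn: "0 \<le> herm_a ?e" "0 \<le> herm_d ?e" by (simp_all add: vals)
  have b': "(herm_x b)\<^sup>2 + (herm_y b)\<^sup>2 < herm_a b * herm_d b" using b(3) by (simp add: herm_det_def)
  note lc = light_cone_pairing[OF nn light b(1,2) b', folded mixed_disc_def]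
  show "0 \<le> mixed_disc ?e b" by (rule lc(1))
  assume "mixed_disc ?e b = 0"
  from lc(2)[OF this] have "R ?p = 0" "R (\<i> *s ?p) = 0" "R ?q = 0" "R (\<i> *s ?q) = 0"
    unfolding vals by (simp_all add: add_nonneg_eq_0_iff)
  then have "?D w = 0" if "w \<in> set frame" for w
    using that unfolding frame_2_smult DR by auto
  from linear_eq_on_frame[OF lin linear_zero this] show "?D v = 0" by simp
qed

text \<open>\<open>d(u d\<^sup>cu) = du \<and> d\<^sup>cu + u dd\<^sup>cu\<close>\<close>

lemma local_d_scaled_dc:
  assumes u: "smooth_fun A UNIV u" and c: "c \<in> A" "z \<in> cimg c"
  shows "local_d (fun_mult u (dc_fun u) c) z [v, w]
    = gradient_form u c z [v, w] + of_real (u (cinv c z)) * local_d (dc_fun u c) z [v, w]"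
proof -
  have "(\<lambda>y. complex_of_real (u (cinv c y))) differentiable (at z)"
    using smooth_on_has_derivative[OF smooth_fun_chart_of_real[OF u c(1)] c(2)] differentiableI by blast
  moreover have "(\<lambda>y. dc_fun u c y [v]) differentiable (at z)" for v
    by (rule form_differentiable[OF dc_fun_is_form[OF u] c]) simp
  ultimately show ?thesis
    unfolding local_d_1 fun_mult_def gradient_form_def dwedge_def
    by (simp add: frechet_derivative_mult algebra_simps)
qed

lemma local_d_J:
  fixes \<Psi> :: "complex^'n \<Rightarrow> (complex^'n) list \<Rightarrow> complex"
  assumes "\<And>y. J_invariant (\<Psi> y)"
  shows "local_d \<Psi> z [\<i> *s u, \<i> *s v, \<i> *s w] = frechet_derivative (\<lambda>y. \<Psi> y [v, w]) (at z) (\<i> *s u)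
    - frechet_derivative (\<lambda>y. \<Psi> y [u, w]) (at z) (\<i> *s v) + frechet_derivative (\<lambda>y. \<Psi> y [u, v]) (at z) (\<i> *s w)"
  using assms unfolding local_d_2 J_invariant_def by simp

text \<open>For closed \<open>\<Psi>\<close> of type \<open>(1,1)\<close> also \<open>d\<^sup>c\<Psi> = 0\<close>, so \<open>d\<^sup>c(u\<Psi>) = d\<^sup>cu \<and> \<Psi>\<close>.\<close>

lemma dc_of_multiple:
  assumes u: "smooth_fun A UNIV u" and \<Psi>: "real_form_11 \<Psi>" and \<omega>0: "is_form A 2 \<omega>0"
    and closed: "\<And>c z u v w. c \<in> A \<Longrightarrow> z \<in> cimg c \<Longrightarrow> local_d (\<Psi> c) z [u, v, w] = 0"
    and eq: "\<And>c z v w. c \<in> A \<Longrightarrow> z \<in> cimg c \<Longrightarrow> \<omega> c z [v, w] = \<omega>0 c z [v, w] + of_real (u (cinv c z)) * \<Psi> c z [v, w]"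
    and c: "c \<in> A" "z \<in> cimg c"
  shows "ext_dc \<omega> c z [v1, v2, v3] - ext_dc \<omega>0 c z [v1, v2, v3] = wedge12 (dc_fun u c z) (\<Psi> c z) [v1, v2, v3]"
proof -
  have \<Psi>2: "is_form A 2 \<Psi>" by (rule real_form_11_is_form[OF \<Psi>])
  have du: "(\<lambda>y. complex_of_real (u (cinv c y))) differentiable (at z)"
    using smooth_on_has_derivative[OF smooth_fun_chart_of_real[OF u c(1)] c(2)] differentiableI by blast
  have d\<Psi>: "(\<lambda>y. \<Psi> c y [v, w]) differentiable (at z)" and d0: "(\<lambda>y. \<omega>0 c y [v, w]) differentiable (at z)" for v w
    by (rule form_differentiable[OF \<Psi>2 c] form_differentiable[OF \<omega>0 c], simp)+
  have D: "frechet_derivative (\<lambda>y. \<omega> c y [v, w]) (at z) x = frechet_derivative (\<lambda>y. \<omega>0 c y [v, w]) (at z) x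
      + (of_real (u (cinv c z)) * frechet_derivative (\<lambda>y. \<Psi> c y [v, w]) (at z) x + chart_deriv u c z x * \<Psi> c z [v, w])" for v w x
  proof -
    have e: "frechet_derivative (\<lambda>y. \<omega> c y [v, w]) (at z)
        = frechet_derivative (\<lambda>y. \<omega>0 c y [v, w] + of_real (u (cinv c y)) * \<Psi> c y [v, w]) (at z)"
      by (rule frechet_derivative_cong_open[OF open_cimg[OF c(1)] c(2)]) (rule eq[OF c(1)])
    show ?thesis
      unfolding e frechet_derivative_add_diff(1)[OF d0 differentiable_mult[OF du d\<Psi>]] frechet_derivative_mult[OF du d\<Psi>] ..
  qed
  have "local_d (\<Psi> c) z [\<i> *s v1, \<i> *s v2, \<i> *s v3] = 0" by (rule closed[OF c])
  moreover have "J_invariant (\<Psi> c y)" for y using \<Psi> unfolding real_form_11_def by blast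
  ultimately have z0: "frechet_derivative (\<lambda>y. \<Psi> c y [v2, v3]) (at z) (\<i> *s v1)
    = frechet_derivative (\<lambda>y. \<Psi> c y [v1, v3]) (at z) (\<i> *s v2) - frechet_derivative (\<lambda>y. \<Psi> c y [v1, v2]) (at z) (\<i> *s v3)"
    using local_d_J[of "\<Psi> c" z v1 v2 v3] by (simp add: algebra_simps)
  show ?thesis
    unfolding ext_dc_3[OF c(2)] D wedge12_def
    by (simp add: numeral_2_eq_2 dc_fun_at[OF c] z0 algebra_simps)
qed

lemma ext_dc_differentiable:
  assumes \<omega>: "is_form A 2 \<omega>" and c: "c \<in> A" "z \<in> cimg c"
  shows "(\<lambda>y. ext_dc \<omega> c y [v1, v2, v3]) differentiable (at z)"
proof -
  note U = open_cimg[OF c(1)]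
  have s: "smooth_on (cimg c) (\<lambda>y. frechet_derivative (\<lambda>y. \<omega> c y [v, w]) (at y) x)" for v w x
    by (rule smooth_on_derivative, rule is_form_smooth[OF \<omega> c(1)]) simp
  have "smooth_on (cimg c) (\<lambda>y. 0 - (frechet_derivative (\<lambda>y. \<omega> c y [v2, v3]) (at y) (\<i> *s v1)
    - frechet_derivative (\<lambda>y. \<omega> c y [v1, v3]) (at y) (\<i> *s v2) + frechet_derivative (\<lambda>y. \<omega> c y [v1, v2]) (at y) (\<i> *s v3)))"
    by (intro smooth_on_diff[OF U smooth_on_const] smooth_on_add[OF U] smooth_on_diff[OF U s s] s)
  then have "smooth_on (cimg c) (\<lambda>y. ext_dc \<omega> c y [v1, v2, v3])"
    by (rule smooth_on_cong[OF U]) (simp add: ext_dc_3)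
  from smooth_on_has_derivative[OF this c(2)] show ?thesis by (rule differentiableI)
qed

text \<open>A function \<open>u\<close> with \<open>dd\<^sup>c(u\<Psi>) = 0\<close> for a Kaehler form \<open>\<Psi>\<close> is locally constant: integrating
  \<open>d(u d\<^sup>cu) \<and> \<Psi>\<close> shows that \<open>du \<and> d\<^sup>cu \<and> \<Psi>\<close> vanishes.\<close>

lemma pluriclosed_conformal_factor:
  assumes u: "smooth_fun A UNIV u" and \<Psi>: "hermitian \<Psi>"
    and \<omega>: "is_form A 2 \<omega>" "ext_d (ext_dc \<omega>) = form_zero" and \<omega>0: "is_form A 2 \<omega>0" "ext_d (ext_dc \<omega>0) = form_zero"
    and closed: "\<And>c z u v w. c \<in> A \<Longrightarrow> z \<in> cimg c \<Longrightarrow> local_d (\<Psi> c) z [u, v, w] = 0"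
    and eq: "\<And>c z v w. c \<in> A \<Longrightarrow> z \<in> cimg c \<Longrightarrow> \<omega> c z [v, w] = \<omega>0 c z [v, w] + of_real (u (cinv c z)) * \<Psi> c z [v, w]"
    and c: "c \<in> A" "z \<in> cimg c"
  shows "chart_deriv u c z v = 0"
proof -
  have \<Psi>11: "real_form_11 \<Psi>" and \<Psi>2: "is_form A 2 \<Psi>"
    using \<Psi> by (simp_all add: hermitian_def real_form_11_def)
  have dcu: "is_form A 1 (dc_fun u)" by (rule dc_fun_is_form[OF u])
  have form: "is_form A 1 (fun_mult u (dc_fun u))" by (rule is_form_fun_mult[OF u dcu])
  have pointwise: "wedge22 (local_d (fun_mult u (dc_fun u) c) z) (\<Psi> c z) frame
      = of_real (mixed_disc (gradient_form u c z) (\<Psi> c z))" if c: "c \<in> A" "z \<in> cimg c" for c z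
  proof -
    have diff: "(\<lambda>y. dc_fun u c y [v]) differentiable (at z)" "(\<lambda>y. \<Psi> c y [v, w]) differentiable (at z)" for v w
      by (rule form_differentiable[OF dcu c] form_differentiable[OF \<Psi>2 c], simp)+
    have "wedge22 (local_d (dc_fun u c) z) (\<Psi> c z) frame = local_d (\<lambda>y. wedge12 (dc_fun u c y) (\<Psi> c y)) z frame"
      unfolding frame_2_smult
      by (rule local_d_wedge12[where \<beta> = "dc_fun u c" and \<Psi> = "\<Psi> c", OF diff closed[OF c], symmetric])
    also have "\<dots> = local_d (\<lambda>y vs. ext_dc \<omega> c y vs - ext_dc \<omega>0 c y vs) z frame"
    proof -
      have "frechet_derivative (\<lambda>y. wedge12 (dc_fun u c y) (\<Psi> c y) [v1, v2, v3]) (at z)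
          = frechet_derivative (\<lambda>y. ext_dc \<omega> c y [v1, v2, v3] - ext_dc \<omega>0 c y [v1, v2, v3]) (at z)" for v1 v2 v3
        by (rule frechet_derivative_cong_open[OF open_cimg[OF c(1)] c(2)])
          (rule dc_of_multiple[OF u \<Psi>11 \<omega>0(1) closed eq c(1), symmetric])
      then show ?thesis unfolding frame_2_smult local_d_3 by simp
    qed
    also have "\<dots> = local_d (ext_dc \<omega> c) z frame - local_d (ext_dc \<omega>0 c) z frame"
      unfolding frame_2_smult local_d_3
      by (simp add: frechet_derivative_add_diff(2) ext_dc_differentiable[OF \<omega>(1) c] ext_dc_differentiable[OF \<omega>0(1) c])
    also have "\<dots> = 0" unfolding closed_local_d[OF \<omega>(2) c(2)] closed_local_d[OF \<omega>0(2) c(2)] by simp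
    finally have 0: "wedge22 (local_d (dc_fun u c) z) (\<Psi> c z) frame = 0" .
    have "wedge22 (local_d (fun_mult u (dc_fun u) c) z) (\<Psi> c z) frame = wedge22 (gradient_form u c z) (\<Psi> c z) frame
        + of_real (u (cinv c z)) * wedge22 (local_d (dc_fun u c) z) (\<Psi> c z) frame"
      by (rule wedge22_lincomb_left) (rule local_d_scaled_dc[OF u c])
    then show ?thesis
      unfolding 0 using wedge22_real_11[OF gradient_form_real_11[OF u c] real_form_11_at[OF \<Psi>11 c]] by simp
  qed
  let ?\<Theta> = "\<lambda>c z. wedge22 (local_d (fun_mult u (dc_fun u) c) z) (\<Psi> c z)"
  have cont: "top_continuous ?\<Theta>"
    unfolding top_continuous_def wedge22_def
    by (intro ballI continuous_on_add continuous_on_diff continuous_on_mult continuous_on_local_d[OF form]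
        smooth_on_continuous is_form_smooth[OF \<Psi>2]) auto
  have nn: "0 \<le> Re (?\<Theta> c z frame)" if "c \<in> A" "z \<in> cimg c" for c z
    unfolding pointwise[OF that]
    using gradient_form_light_cone(1)[OF u that hermitian_positive[OF \<Psi> that]] by simp
  have "form_integral A ?\<Theta> = 0" by (rule integral_exact_wedge_closed[OF form \<Psi>2 closed])
  then have "\<exists>d\<in>A. cinv c z \<in> cdom d \<and> Re (?\<Theta> d (cmap d (cinv c z)) frame) = 0"
    by (intro form_integral_nonneg(2)[OF cont nn]) simp_all
  then obtain d where d: "d \<in> A" "cinv c z \<in> cdom d" and zero: "Re (?\<Theta> d (cmap d (cinv c z)) frame) = 0" by blast
  have dz: "cmap d (cinv c z) \<in> cimg d" by (rule cmap_in_cimg[OF d(2)])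
  have ov: "z \<in> overlap c d" using c(2) d(2) by (simp add: overlap_def)
  have "chart_deriv u d (cmap d (cinv c z)) w = 0" for w
    using zero unfolding pointwise[OF d(1) dz]
    by (intro gradient_form_light_cone(2)[OF u d(1) dz hermitian_positive[OF \<Psi> d(1) dz]]) simp
  then show ?thesis
    using chain_rule_transition[OF c(1) d(1) ov smooth_fun_chart_of_real[OF u d(1)], of v]
    by (simp add: transition_def)
qed

text \<open>The form \<open>exp(-f) \<omega>\<close>, which the system requires to be closed.\<close>

definition balanced_form :: "('x, 2) dform \<Rightarrow> ('x, 2) dform" where
  "balanced_form \<omega> = fun_mult (\<lambda>x. exp (- dilaton \<mu> A \<omega> x)) \<omega>"

lemma balanced_form_hermitian:
  assumes \<omega>: "hermitian \<omega>"
  shows "hermitian (balanced_form \<omega>)"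
proof -
  have "smooth_fun A UNIV (\<lambda>x. exp (- dilaton \<mu> A \<omega> x))"
    using dilaton_characterization(2)[OF \<omega>, of "- 1"] by simp
  then have "real_form_11 (balanced_form \<omega>)"
    unfolding balanced_form_def by (rule real_form_11_fun_mult[OF _ hermitian_real_form_11[OF \<omega>]])
  then show ?thesis
    using \<omega> unfolding hermitian_def positive_form_def balanced_form_def fun_mult_def by simp
qed

lemma solution_balanced_closed:
  assumes \<omega>: "hermitian \<omega>" and sol: "is_solution \<mu> A \<omega>" and c: "c \<in> A" "z \<in> cimg c"
  shows "local_d (balanced_form \<omega> c) z [u, v, w] = 0"
proof (rule closed_local_d[OF _ c(2)])
  have "is_form A 2 \<omega>" using \<omega> by (simp add: hermitian_def real_form_11_def)
  then have "wedge_power \<omega> (CARD(2) - 1) = \<omega>" using wedge_power_1 by (simp del: wedge_power.simps)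
  then show "ext_d (balanced_form \<omega>) = form_zero"
    using sol unfolding is_solution_def balanced_form_def by (simp del: wedge_power.simps)
qed

text \<open>This is \<open>exp(-f) \<omega>\<^sup>2 / 2 = exp(-f) exp(2f) \<mu> = exp(f) \<mu>\<close>.\<close>

lemma dilaton_functional_density:
  assumes \<omega>: "hermitian \<omega>" and c: "c \<in> A" "z \<in> cimg c"
  shows "fun_mult (\<lambda>x. exp (- dilaton \<mu> A \<omega> x)) (top_power \<omega>) c z frame
    = of_real (exp (dilaton \<mu> A \<omega> (cinv c z)) * Re (\<mu> c z frame))"
proof -
  let ?f = "dilaton \<mu> A \<omega> (cinv c z)"
  have form: "is_form A 2 \<omega>" using \<omega> by (simp add: hermitian_def real_form_11_def)
  have alt: "alternating_multilinear 2 (\<omega> c z)" by (rule is_form_alternating[OF form c])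
  have r: "real_11 (\<omega> c z)" by (rule real_form_11_at[OF hermitian_real_form_11[OF \<omega>] c])
  have "top_power \<omega> c z frame = of_real (herm_det (\<omega> c z))"
    unfolding top_power_eq[OF form] wedge_2_2[where \<alpha> = \<omega> and \<beta> = \<omega> and c = c and z = z, OF alt alt length_frame_2]
      wedge22_real_11[OF r r] mixed_disc_same by simp
  also have "\<dots> = of_real (exp (2 * ?f) * Re (\<mu> c z frame))"
    unfolding dilaton_characterization(1)[OF \<omega> c] ..
  finally have "fun_mult (\<lambda>x. exp (- dilaton \<mu> A \<omega> x)) (top_power \<omega>) c z frame
      = of_real (exp (- ?f) * (exp (2 * ?f) * Re (\<mu> c z frame)))"
    by (simp add: fun_mult_def)
  also have "exp (- ?f) * (exp (2 * ?f) * Re (\<mu> c z frame)) = exp ?f * Re (\<mu> c z frame)"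
    by (simp add: exp_add[symmetric] mult.assoc[symmetric])
  finally show ?thesis .
qed

lemma balanced_pairing_density:
  assumes \<omega>: "hermitian \<omega>" and \<omega>0: "hermitian \<omega>0" and c: "c \<in> A" "z \<in> cimg c"
  shows "wedge22 (\<omega> c z) (balanced_form \<omega>0 c z) frame
    = of_real (exp (- dilaton \<mu> A \<omega>0 (cinv c z)) * mixed_disc (\<omega> c z) (\<omega>0 c z))"
proof -
  let ?k = "complex_of_real (exp (- dilaton \<mu> A \<omega>0 (cinv c z)))"
  have "wedge22 (\<omega> c z) (balanced_form \<omega>0 c z) frame = ?k * wedge22 (\<omega> c z) (\<omega>0 c z) frame"
    unfolding balanced_form_def fun_mult_def wedge22_def by (simp add: algebra_simps)
  then show ?thesis
    using wedge22_real_11[OF real_form_11_at[OF hermitian_real_form_11[OF \<omega>] c] real_form_11_at[OF hermitian_real_form_11[OF \<omega>0] c]]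
    by simp
qed

text \<open>The gap between \<open>\<integral> exp(-f\<^sub>0) \<omega>\<^sub>0 \<and> \<omega> / 2\<close> and \<open>M(\<omega>)\<close> has a nonnegative density.\<close>

lemma pairing_minus_functional:
  assumes \<omega>: "hermitian \<omega>" and \<omega>0: "hermitian \<omega>0"
  defines "\<Theta> \<equiv> \<lambda>c z vs. (1/2) * wedge22 (\<omega> c z) (balanced_form \<omega>0 c z) vs
    - fun_mult (\<lambda>x. exp (- dilaton \<mu> A \<omega> x)) (top_power \<omega>) c z vs"
  shows "top_continuous \<Theta>" "\<And>c z. c \<in> A \<Longrightarrow> z \<in> cimg c \<Longrightarrow> 0 \<le> Re (\<Theta> c z frame)"
    "Re (form_integral A \<Theta>) = Re (form_integral A (\<lambda>c z. wedge22 (\<omega> c z) (balanced_form \<omega>0 c z))) / 2 - dilaton_functional \<mu> A \<omega>"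
proof -
  have form: "is_form A 2 \<omega>" "is_form A 2 (balanced_form \<omega>0)"
    using \<omega> balanced_form_hermitian[OF \<omega>0] by (simp_all add: hermitian_def real_form_11_def)
  let ?P = "\<lambda>c z. wedge22 (\<omega> c z) (balanced_form \<omega>0 c z)"
  let ?M = "fun_mult (\<lambda>x. exp (- dilaton \<mu> A \<omega> x)) (top_power \<omega>)"
  have cP: "top_continuous (\<lambda>c z vs. (1/2) * ?P c z vs)"
    using top_density_continuous[OF wedge22_top_density[OF form]]
    unfolding top_continuous_def by (intro ballI continuous_on_mult continuous_on_const) auto
  have cM: "top_continuous ?M"
    unfolding top_continuous_def
  proof
    fix c assume c: "c \<in> A"
    have "smooth_on (cimg c) (\<lambda>z. exp (1 * dilaton \<mu> A \<omega> (cinv c z)))"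
      using dilaton_characterization(2)[OF \<omega>, of 1] c by (simp add: smooth_fun_iff)
    moreover have "smooth_on (cimg c) (\<lambda>z. \<mu> c z frame)" by (rule is_form_smooth[OF volume_is_form c length_frame_2])
    ultimately have "continuous_on (cimg c) (\<lambda>z. complex_of_real (exp (1 * dilaton \<mu> A \<omega> (cinv c z)) * Re (\<mu> c z frame)))"
      by (intro continuous_on_of_real continuous_on_mult continuous_on_Re smooth_on_continuous)
    then show "continuous_on (cimg c) (\<lambda>z. ?M c z frame)"
      by (rule continuous_on_eq) (simp add: dilaton_functional_density[OF \<omega> c])
  qed
  show "top_continuous \<Theta>"
    using cP cM unfolding \<Theta>_def top_continuous_def by (intro ballI continuous_on_diff) auto
  show "0 \<le> Re (\<Theta> c z frame)" if c: "c \<in> A" "z \<in> cimg c" for c z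
    unfolding \<Theta>_def balanced_pairing_density[OF \<omega> \<omega>0 c] dilaton_functional_density[OF \<omega> c]
    using volume_density_le_mixed(1)[OF \<omega> \<omega>0 c] by simp
  show "Re (form_integral A \<Theta>) = Re (form_integral A ?P) / 2 - dilaton_functional \<mu> A \<omega>"
    unfolding \<Theta>_def form_integral_diff[OF cP cM] form_integral_scale dilaton_functional_def by simp
qed

lemma functional_eq_pairing:
  assumes \<omega>: "hermitian \<omega>"
  shows "dilaton_functional \<mu> A \<omega> = Re (form_integral A (\<lambda>c z. wedge22 (\<omega> c z) (balanced_form \<omega> c z))) / 2"
proof -
  have "form_integral A (fun_mult (\<lambda>x. exp (- dilaton \<mu> A \<omega> x)) (top_power \<omega>))
      = form_integral A (\<lambda>c z vs. (1/2) * wedge22 (\<omega> c z) (balanced_form \<omega> c z) vs)"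
  proof (rule form_integral_cong)
    fix c z assume c: "c \<in> A" "z \<in> cimg c"
    have form: "is_form A 2 \<omega>" using \<omega> by (simp add: hermitian_def real_form_11_def)
    have alt: "alternating_multilinear 2 (\<omega> c z)" by (rule is_form_alternating[OF form c])
    let ?k = "complex_of_real (exp (- dilaton \<mu> A \<omega> (cinv c z)))"
    have "wedge22 (\<omega> c z) (balanced_form \<omega> c z) frame = ?k * wedge22 (\<omega> c z) (\<omega> c z) frame"
      by (simp add: balanced_form_def fun_mult_def wedge22_def algebra_simps)
    moreover have "top_power \<omega> c z frame = wedge22 (\<omega> c z) (\<omega> c z) frame / 2"
      unfolding top_power_eq[OF form] wedge_2_2[where \<alpha> = \<omega> and \<beta> = \<omega> and c = c and z = z, OF alt alt length_frame_2] ..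
    ultimately show "fun_mult (\<lambda>x. exp (- dilaton \<mu> A \<omega> x)) (top_power \<omega>) c z frame
        = (1/2) * wedge22 (\<omega> c z) (balanced_form \<omega> c z) frame"
      by (simp add: fun_mult_def)
  qed
  note eq = this[unfolded form_integral_scale]
  show ?thesis unfolding dilaton_functional_def eq by simp
qed

text \<open>The closed form \<open>exp(-f\<^sub>0) \<omega>\<^sub>0\<close> calibrates the functional: its pairing with \<open>\<omega>\<close> bounds \<open>M(\<omega>)\<close> and is constant
  on the Aeppli class.\<close>

lemma functional_le_solution:
  assumes \<omega>: "hermitian \<omega>" and \<omega>0: "hermitian \<omega>0" and sol: "is_solution \<mu> A \<omega>0"
    and \<tau>: "is_form A 2 \<tau>" "aeppli_zero A (form_diff \<tau> \<omega>)" "aeppli_zero A (form_diff \<tau> \<omega>0)"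
  shows "dilaton_functional \<mu> A \<omega> \<le> dilaton_functional \<mu> A \<omega>0"
    and "dilaton_functional \<mu> A \<omega> = dilaton_functional \<mu> A \<omega>0 \<Longrightarrow> c \<in> A \<Longrightarrow> z \<in> cimg c \<Longrightarrow>
      \<omega> c z [v, w] = of_real (exp (dilaton \<mu> A \<omega> (cinv c z) - dilaton \<mu> A \<omega>0 (cinv c z))) * \<omega>0 c z [v, w]"
proof -
  have form: "is_form A 2 \<omega>" "is_form A 2 \<omega>0" and bal: "real_form_11 (balanced_form \<omega>0)"
    using \<omega> \<omega>0 balanced_form_hermitian[OF \<omega>0] by (simp_all add: hermitian_def real_form_11_def)
  have pair: "form_integral A (\<lambda>c z. wedge22 (\<tau> c z) (balanced_form \<omega>0 c z))
      = form_integral A (\<lambda>c z. wedge22 (\<theta> c z) (balanced_form \<omega>0 c z))"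
    if "is_form A 2 \<theta>" "aeppli_zero A (form_diff \<tau> \<theta>)" for \<theta>
    by (rule aeppli_pairing[OF bal _ \<tau>(1) that]) (rule solution_balanced_closed[OF \<omega>0 sol])
  have "form_integral A (\<lambda>c z. wedge22 (\<omega> c z) (balanced_form \<omega>0 c z))
      = form_integral A (\<lambda>c z. wedge22 (\<omega>0 c z) (balanced_form \<omega>0 c z))"
    using pair[OF form(1) \<tau>(2)] pair[OF form(2) \<tau>(3)] by simp
  then have eq: "Re (form_integral A (\<lambda>c z. wedge22 (\<omega> c z) (balanced_form \<omega>0 c z))) / 2 = dilaton_functional \<mu> A \<omega>0"
    by (simp add: functional_eq_pairing[OF \<omega>0])
  note gap = pairing_minus_functional[OF \<omega> \<omega>0]
  show "dilaton_functional \<mu> A \<omega> \<le> dilaton_functional \<mu> A \<omega>0"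
    using form_integral_nonneg(1)[OF gap(1,2)] unfolding gap(3) eq by simp
  assume same: "dilaton_functional \<mu> A \<omega> = dilaton_functional \<mu> A \<omega>0" and c: "c \<in> A" "z \<in> cimg c"
  let ?x = "cinv c z"
  let ?k = "of_real (exp (dilaton \<mu> A \<omega> ?x - dilaton \<mu> A \<omega>0 ?x))"
  obtain d where d: "d \<in> A" "?x \<in> cdom d" and zero: "Re ((1/2) * wedge22 (\<omega> d (cmap d ?x)) (balanced_form \<omega>0 d (cmap d ?x)) frame
    - fun_mult (\<lambda>x. exp (- dilaton \<mu> A \<omega> x)) (top_power \<omega>) d (cmap d ?x) frame) = 0"
    using form_integral_nonneg(2)[OF gap(1,2), of ?x] same unfolding gap(3) eq by auto
  have dz: "cmap d ?x \<in> cimg d" by (rule cmap_in_cimg[OF d(2)])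
  have ov: "z \<in> overlap c d" using c(2) d(2) by (simp add: overlap_def)
  have tr: "transition c d z = cmap d ?x" by (simp add: transition_def)
  have scaled: "\<omega> d (cmap d ?x) [v, w] = ?k * \<omega>0 d (cmap d ?x) [v, w]" for v w
    using volume_density_le_mixed(2)[OF \<omega> \<omega>0 d(1) dz, of v w] zero
    unfolding balanced_pairing_density[OF \<omega> \<omega>0 d(1) dz] dilaton_functional_density[OF \<omega> d(1) dz]
    by (simp add: cinv_cmap[OF d])
  have "\<omega> c z [v, w] = \<omega> d (cmap d ?x) [jac c d z v, jac c d z w]"
    using is_form_transition[OF form(1) c(1) d(1) ov, of "[v, w]"] by (simp add: tr)
  also have "\<dots> = ?k * \<omega>0 d (cmap d ?x) [jac c d z v, jac c d z w]" by (rule scaled)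
  also have "\<omega>0 d (cmap d ?x) [jac c d z v, jac c d z w] = \<omega>0 c z [v, w]"
    using is_form_transition[OF form(2) c(1) d(1) ov, of "[v, w]"] by (simp add: tr)
  finally show "\<omega> c z [v, w] = ?k * \<omega>0 c z [v, w]" .
qed

text \<open>Two solutions bound each other, so they are conformal: \<open>\<omega> = \<omega>\<^sub>0 + u \<Omega>\<close> with the closed form
  \<open>\<Omega> = exp(-f\<^sub>0) \<omega>\<^sub>0\<close>. Then \<open>du = 0\<close>, so \<open>u \<Omega>\<close> is closed too and may be paired with \<open>\<omega> - \<omega>\<^sub>0\<close>, which is zero in
  Aeppli cohomology: \<open>\<integral> u\<^sup>2 \<Omega>\<^sup>2 = 0\<close>.\<close>

lemma solution_unique:
  assumes \<omega>: "hermitian \<omega>" and \<omega>0: "hermitian \<omega>0" and sol: "is_solution \<mu> A \<omega>" and sol0: "is_solution \<mu> A \<omega>0"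
    and \<tau>: "is_form A 2 \<tau>" "aeppli_zero A (form_diff \<tau> \<omega>)" "aeppli_zero A (form_diff \<tau> \<omega>0)"
  shows "\<omega> = \<omega>0"
proof -
  have form: "is_form A 2 \<omega>" "is_form A 2 \<omega>0" using \<omega> \<omega>0 by (simp_all add: hermitian_def real_form_11_def)
  have same: "dilaton_functional \<mu> A \<omega> = dilaton_functional \<mu> A \<omega>0"
    using functional_le_solution(1)[OF \<omega> \<omega>0 sol0 \<tau>] functional_le_solution(1)[OF \<omega>0 \<omega> sol \<tau>(1,3,2)] by simp
  note conf = functional_le_solution(2)[OF \<omega> \<omega>0 sol0 \<tau> same]
  let ?f = "dilaton \<mu> A \<omega>" and ?g = "dilaton \<mu> A \<omega>0"
  let ?\<Omega> = "balanced_form \<omega>0"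
  define u where "u = (\<lambda>x. exp (?f x) - exp (?g x))"
  have u: "smooth_fun A UNIV u"
    unfolding smooth_fun_iff
  proof
    fix c assume c: "c \<in> A"
    have "smooth_on (cimg c) (\<lambda>z. exp (1 * ?f (cinv c z)) - exp (1 * ?g (cinv c z)))"
      using dilaton_characterization(2)[OF \<omega>, of 1] dilaton_characterization(2)[OF \<omega>0, of 1] c
      by (intro smooth_on_diff[OF open_cimg[OF c]]) (simp_all add: smooth_fun_iff)
    then show "smooth_on (cimg c) (\<lambda>z. u (cinv c z))" by (simp add: u_def)
  qed
  have \<Omega>: "hermitian ?\<Omega>" by (rule balanced_form_hermitian[OF \<omega>0])
  have \<Omega>11: "real_form_11 ?\<Omega>" and \<Omega>2: "is_form A 2 ?\<Omega>" using \<Omega> by (simp_all add: hermitian_def real_form_11_def)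
  have closed: "local_d (?\<Omega> c) z [p, q, r] = 0" if "c \<in> A" "z \<in> cimg c" for c z p q r
    by (rule solution_balanced_closed[OF \<omega>0 sol0 that])
  have eq: "\<omega> c z [v, w] = \<omega>0 c z [v, w] + of_real (u (cinv c z)) * ?\<Omega> c z [v, w]" if "c \<in> A" "z \<in> cimg c" for c z v w
  proof -
    let ?x = "cinv c z"
    have "exp (?f ?x - ?g ?x) = 1 + u ?x * exp (- ?g ?x)"
      by (simp add: u_def left_diff_distrib exp_add[symmetric])
    then have "complex_of_real (exp (?f ?x - ?g ?x)) = 1 + of_real (u ?x) * of_real (exp (- ?g ?x))"
      by (metis of_real_1 of_real_add of_real_mult)
    then show ?thesis unfolding conf[OF that] balanced_form_def fun_mult_def by (simp add: algebra_simps)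
  qed
  have ddc: "ext_d (ext_dc \<omega>) = form_zero" "ext_d (ext_dc \<omega>0) = form_zero"
    using sol sol0 by (simp_all add: is_solution_def)
  have du: "chart_deriv u c z v = 0" if "c \<in> A" "z \<in> cimg c" for c z v
    by (rule pluriclosed_conformal_factor[OF u \<Omega> form(1) ddc(1) form(2) ddc(2) closed eq that])
  let ?\<Psi> = "fun_mult u ?\<Omega>"
  have \<Psi>: "real_form_11 ?\<Psi>" by (rule real_form_11_fun_mult[OF u \<Omega>11])
  have closed': "local_d (?\<Psi> c) z [p, q, r] = 0" if c: "c \<in> A" "z \<in> cimg c" for c z p q r
  proof -
    have "(\<lambda>y. complex_of_real (u (cinv c y))) differentiable (at z)"
      using smooth_on_has_derivative[OF smooth_fun_chart_of_real[OF u c(1)] c(2)] differentiableI by blast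
    moreover have "(\<lambda>y. ?\<Omega> c y [v, w]) differentiable (at z)" for v w
      by (rule form_differentiable[OF \<Omega>2 c]) simp
    ultimately have "local_d (?\<Psi> c) z [p, q, r] = of_real (u (cinv c z)) * local_d (?\<Omega> c) z [p, q, r]"
      unfolding local_d_2 fun_mult_def by (simp add: frechet_derivative_mult du[OF c] algebra_simps)
    then show ?thesis using closed[OF c] by simp
  qed
  have pair: "form_integral A (\<lambda>c z. wedge22 (\<tau> c z) (?\<Psi> c z)) = form_integral A (\<lambda>c z. wedge22 (\<theta> c z) (?\<Psi> c z))"
    if "is_form A 2 \<theta>" "aeppli_zero A (form_diff \<tau> \<theta>)" for \<theta>
    by (rule aeppli_pairing[OF \<Psi> _ \<tau>(1) that]) (rule closed')
  let ?W = "\<lambda>\<omega> c z. wedge22 (\<omega> c z) (?\<Psi> c z)"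
  have c1: "top_continuous (?W \<omega>)" and c2: "top_continuous (?W \<omega>0)"
    by (intro top_density_continuous wedge22_top_density form real_form_11_is_form[OF \<Psi>])+
  let ?X = "\<lambda>c z vs. ?W \<omega> c z vs - ?W \<omega>0 c z vs"
  have cX: "top_continuous ?X" using c1 c2 unfolding top_continuous_def by (intro ballI continuous_on_diff) auto
  have X: "?X c z frame = of_real ((u (cinv c z))\<^sup>2 * (2 * herm_det (?\<Omega> c z)))" if c: "c \<in> A" "z \<in> cimg c" for c z
  proof -
    have r: "real_11 (?\<Omega> c z)" by (rule real_form_11_at[OF \<Omega>11 c])
    have "?W \<omega> c z frame = ?W \<omega>0 c z frame + of_real (u (cinv c z)) * wedge22 (?\<Omega> c z) (?\<Psi> c z) frame"
      by (rule wedge22_lincomb_left) (rule eq[OF c])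
    moreover have "wedge22 (?\<Omega> c z) (?\<Psi> c z) frame = of_real (u (cinv c z)) * wedge22 (?\<Omega> c z) (?\<Omega> c z) frame"
      by (simp add: wedge22_def fun_mult_def algebra_simps)
    ultimately show ?thesis
      using wedge22_real_11[OF r r] by (simp add: mixed_disc_same power2_eq_square)
  qed
  have nn: "0 \<le> Re (?X c z frame)" if "c \<in> A" "z \<in> cimg c" for c z
    unfolding X[OF that] using hermitian_positive(3)[OF \<Omega> that] by simp
  have "form_integral A ?X = 0"
    unfolding form_integral_diff[OF c1 c2] using pair[OF form(1) \<tau>(2)] pair[OF form(2) \<tau>(3)] by simp
  then have "\<exists>c\<in>A. x \<in> cdom c \<and> Re (?X c (cmap c x) frame) = 0" for x
    by (intro form_integral_nonneg(2)[OF cX nn]) simp_all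
  then have u0: "u x = 0" for x
  proof -
    obtain c where c: "c \<in> A" "x \<in> cdom c" and zero: "Re (?X c (cmap c x) frame) = 0"
      using \<open>\<And>x. \<exists>c\<in>A. x \<in> cdom c \<and> Re (?X c (cmap c x) frame) = 0\<close> by blast
    have z: "cmap c x \<in> cimg c" by (rule cmap_in_cimg[OF c(2)])
    show "u x = 0"
      using zero hermitian_positive(3)[OF \<Omega> c(1) z] unfolding X[OF c(1) z] by (simp add: cinv_cmap[OF c])
  qed
  show "\<omega> = \<omega>0"
  proof (intro ext)
    fix c z vs
    show "\<omega> c z vs = \<omega>0 c z vs"
    proof (cases "c \<in> A \<and> z \<in> cimg c \<and> length vs = 2")
      case True
      then obtain v w where "vs = [v, w]" by (auto simp: length_Suc_conv numeral_2_eq_2)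
      then show ?thesis using eq[of c z v w] True u0 by simp
    next
      case False
      then show ?thesis using is_form_outside[OF form(1), of c z vs] is_form_outside[OF form(2), of c z vs] by metis
    qed
  qed
qed

end

theorem theorem4p14:
  fixes A :: "('x::t2_space, 2) chart set"
    and \<mu> :: "('x, 2) dform"
    and Q :: "('x, 2, 'q, 'r::finite) courant"
    and \<sigma> :: "('x, 2) dform set"
    and \<omega>0 :: "('x, 2) dform"
  assumes "compact (UNIV :: 'x set)"
    and "holomorphic_atlas A"
    and "volume_form A \<mu>"
    and "exact_courant_algebroid A Q"
    and "bott_chern A Q"
    and "\<sigma> \<in> aeppli_classes A Q"
    and "positive_class A \<sigma>"
    and "\<omega>0 \<in> B_plus A \<sigma>"
    and "is_solution \<mu> A \<omega>0"
  shows "(\<forall>\<omega>\<in>B_plus A \<sigma>. is_solution \<mu> A \<omega> \<longrightarrow> \<omega> = \<omega>0) \<and>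
         bdd_above (dilaton_functional \<mu> A ` B_plus A \<sigma>)"
proof -
  interpret surface A \<mu> by unfold_locales (fact assms)+
  obtain \<tau> where \<tau>B: "\<tau> \<in> B_set A Q"
    and \<sigma>: "\<And>\<omega>. \<omega> \<in> \<sigma> \<Longrightarrow> \<omega> \<in> B_set A Q \<and> aeppli_zero A (form_diff \<tau> \<omega>)"
    using assms(6) unfolding aeppli_classes_def quotient_def by auto
  have two: "is_form A 2 \<omega>" if "\<omega> \<in> B_set A Q" for \<omega>
    using that by (simp add: B_set_def form_of_type_def numeral_2_eq_2)
  have \<tau>: "is_form A 2 \<tau>" by (rule two[OF \<tau>B])
  have herm: "hermitian \<omega>" and zero: "aeppli_zero A (form_diff \<tau> \<omega>)" if "\<omega> \<in> B_plus A \<sigma>" for \<omega>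
  proof -
    have \<omega>: "\<omega> \<in> B_set A Q" "aeppli_zero A (form_diff \<tau> \<omega>)" "positive_form A \<omega>"
      using that \<sigma> by (auto simp: B_plus_def)
    then have "form_of_type A 1 1 \<omega>" "real_form \<omega>" by (auto simp: B_set_def)
    then show "hermitian \<omega>"
      unfolding hermitian_def real_form_11_def
      using form_of_type_11_J_invariant two[OF \<omega>(1)] \<omega>(3) by blast
    show "aeppli_zero A (form_diff \<tau> \<omega>)" by (rule \<omega>(2))
  qed
  show ?thesis
  proof (intro conjI ballI impI)
    fix \<omega> assume \<omega>: "\<omega> \<in> B_plus A \<sigma>" and sol: "is_solution \<mu> A \<omega>"
    show "\<omega> = \<omega>0"
      by (rule solution_unique[OF herm[OF \<omega>] herm[OF assms(8)] sol assms(9) \<tau> zero[OF \<omega>] zero[OF assms(8)]])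
  next
    show "bdd_above (dilaton_functional \<mu> A ` B_plus A \<sigma>)"
      using functional_le_solution(1)[OF herm herm[OF assms(8)] assms(9) \<tau> zero zero[OF assms(8)]]
      by (intro bdd_aboveI2[where M = "dilaton_functional \<mu> A \<omega>0"]) blast
  qed
qed

end
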